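(* Let $G$ be a connected graph on $n$ vertices. Then $\partial_3(G)\leq -1$ and $\partial_{n-1}(G)\geq -2$ if and only if one of the following holds: \begin{enumerate} \item[(i)] $d(G)\leq 2$ and $G$ is isomorphic to one of: $I_1=K_n$ ($n\geq 4$); $I_2=K_a\vee K_b^c$ ($a\geq 2$, $b\geq 1$); $I_3=K_a\vee (K_b\cup K_c)$ ($a,b,c\geq 2$); $I_4=K_a\vee (K_b\cup K_c^c)$ ($a,b\geq 2$, $c\geq 1$); $I_5=K_a^c\vee K_b^c$ ($a,b\geq 1$); $I_6=K_a^c\vee (K_b\cup K_c)$ ($a\geq 1$, $b,c\geq 2$); $I_7=K_a^c\vee (K_b\cup K_c^c)$ ($a,c\geq 1$, $b\geq 2$); or \item[(ii)] $d(G)=3$ and, with $a,b,c,d$ positive integers, one of the following holds: \begin{enumerate} \item[1)] $G=P_4[K_a^c,K_b,K_c^c,K_d^c]$, where $b\geq 1$, and either ($a=c=1$, $d\geq 1$) or ($a=1$, $c=2$, $d\leq 2$) or ($a=1$, $c\geq 3$, $d=1$) or ($a=2$, $c=1$, $d\leq 2$) or ($a\geq 3$, $c=1$, $d=1$); \item[2)] $G=P_4[K_a^c,K_b,K_c,K_d^c]$, where $b,c\geq 1$, and either ($a=1$, $d\geq 1$) or ($a=2$, $d\leq 2$) or ($a\geq 3$, $d=1$); \item[3)] $G=P_4[K_a^c,K_b,K_c^c,K_d]$, where $b,d\geq 1$, and either ($a=1$, $c\geq 1$) or ($a\geq 2$, $c=1$); \item[4)] $G=P_4[K_a^c,K_b^c,K_c,K_d]$,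 where $c,d\geq 1$, and either ($a=1$, $b\geq 1$) or ($a=2$, $b\leq 2$) or ($a\geq 3$, $b=1$); \item[5)] $G=P_4[K_a^c,K_b,K_c,K_d]$, where $a,b,c,d\geq 1$; \item[6)] $G=P_4[K_a,K_b,K_c^c,K_d]$, where $a,b,c,d\geq 1$; \item[7)] $G=P_4[K_a,K_b,K_c,K_d]$, where $a,b,c,d\geq 1$ and $a+b+c+d-3ac-8ad-3bd-abc-abd-acd-bcd+abcd+1\leq 0$. \end{enumerate} \end{enumerate}
   Context: All graphs are finite, simple and undirected. For a connected graph $G$ with vertices $v_1,\dots,v_n$, $d_G(v_i,v_j)$ is the length of a shortest $v_i$–$v_j$ path, $d(G)$ is the diameter, and the distance matrix is $D(G)=[d_G(v_i,v_j)]_{n\times n}$. Its eigenvalues (distance eigenvalues) are denoted $\partial_1(G)\geq \partial_2(G)\geq\cdots\geq\partial_n(G)$. $K_m$ is the complete graph on $m$ vertices, $K_m^c$ its complement (the edgeless graph on $m$ vertices), $G_1\cup G_2$ is the disjoint union, and $G_1\vee G_2$ (join) is obtained from $G_1\cup G_2$ by adding all edges between $G_1$ and $G_2$. For the path $P_4=v_1v_2v_3v_4$ and graphs $H_1,H_2,H_3,H_4$, the generalized lexicographic product $P_4[H_1,H_2,H_3,H_4]$ is the graph obtained from $P_4$ by replacing each $v_i$ by a copy of $H_i$ and adding all edges between $H_i$ and $H_j$ whenever $v_i$ and $v_j$ are adjacent in $P_4$ (i.e. for $|i-j|=1$). *)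

theory Defs
  imports
    "HOL-Computational_Algebra.Polynomial"
    "Graph_Theory.Graph_Theory"
    "Jordan_Normal_Form.Char_Poly"
begin

text \<open>
  A finite simple undirected graph is a \<open>pair_graph\<close>: a finite vertex set \<open>pverts\<close> with a
  symmetric, irreflexive set \<open>parcs\<close> of ordered pairs, so each edge occurs as two arcs.
\<close>

abbreviation graph_isomorphic :: "'a pair_pre_digraph \<Rightarrow> 'b pair_pre_digraph \<Rightarrow> bool"
    (infix \<open>\<cong>\<^sub>G\<close> 50) where
  "G \<cong>\<^sub>G H \<equiv> digraph_iso (with_proj G) (with_proj H)"

text \<open>
  \<open>apath u p v\<close> says that \<open>p\<close> is the arc list of a path (no repeated vertices) from \<open>u\<close> to \<open>v\<close>.
  The value is only meaningful for vertices of the same component.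
\<close>
definition gdist :: "'a pair_pre_digraph \<Rightarrow> 'a \<Rightarrow> 'a \<Rightarrow> nat" where
  "gdist G u v = (LEAST k. \<exists>p. pre_digraph.apath (with_proj G) u p v \<and> length p = k)"

definition diam :: "'a pair_pre_digraph \<Rightarrow> nat" where
  "diam G = Max {gdist G u v | u v. u \<in> pverts G \<and> v \<in> pverts G}"

text \<open>The list \<open>vs\<close> is the enumeration \<open>v\<^sub>1, \<dots>, v\<^sub>n\<close> of the vertices.\<close>
definition distance_matrix :: "'a pair_pre_digraph \<Rightarrow> 'a list \<Rightarrow> real mat" where
  "distance_matrix G vs =
     mat (length vs) (length vs) (\<lambda>(i, j). real (gdist G (vs ! i) (vs ! j)))"

text \<open>
  Real eigenvalues with algebraic multiplicity, in decreasing order. For a symmetric \<open>n \<times> n\<close> matrix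
  the characteristic polynomial splits over the reals, so the list has length \<open>n\<close>.
\<close>
definition eigenvalues_desc :: "real mat \<Rightarrow> real list" where
  "eigenvalues_desc A = rev (sorted_list_of_multiset (proots (char_poly A)))"

text \<open>The \<open>k\<close>-th largest distance eigenvalue, with \<open>k\<close> counted from 1.\<close>
definition dist_eigenvalue :: "'a pair_pre_digraph \<Rightarrow> 'a list \<Rightarrow> nat \<Rightarrow> real" where
  "dist_eigenvalue G vs k = eigenvalues_desc (distance_matrix G vs) ! (k - 1)"

definition complete_graph :: "nat \<Rightarrow> nat pair_pre_digraph" where
  "complete_graph m =
     \<lparr> pverts = {..<m}, parcs = {(x, y). x < m \<and> y < m \<and> x \<noteq> y} \<rparr>"

definition graph_complement :: "'a pair_pre_digraph \<Rightarrow> 'a pair_pre_digraph" where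
  "graph_complement G =
     \<lparr> pverts = pverts G,
       parcs = {(x, y). x \<in> pverts G \<and> y \<in> pverts G \<and> x \<noteq> y \<and> (x, y) \<notin> parcs G} \<rparr>"

abbreviation edgeless_graph :: "nat \<Rightarrow> nat pair_pre_digraph" where
  "edgeless_graph m \<equiv> graph_complement (complete_graph m)"

definition graph_union ::
    "'a pair_pre_digraph \<Rightarrow> 'b pair_pre_digraph \<Rightarrow> ('a + 'b) pair_pre_digraph" where
  "graph_union G H =
     \<lparr> pverts = pverts G <+> pverts H,
       parcs = {(Inl x, Inl y) | x y. (x, y) \<in> parcs G} \<union> {(Inr x, Inr y) | x y. (x, y) \<in> parcs H} \<rparr>"

definition graph_join ::
    "'a pair_pre_digraph \<Rightarrow> 'b pair_pre_digraph \<Rightarrow> ('a + 'b) pair_pre_digraph" where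
  "graph_join G H =
     \<lparr> pverts = pverts (graph_union G H),
       parcs = parcs (graph_union G H)
         \<union> {(Inl x, Inr y) | x y. x \<in> pverts G \<and> y \<in> pverts H}
         \<union> {(Inr y, Inl x) | x y. x \<in> pverts G \<and> y \<in> pverts H} \<rparr>"

definition path_graph :: "nat \<Rightarrow> nat pair_pre_digraph" where
  "path_graph m =
     \<lparr> pverts = {..<m}, parcs = {(i, j). i < m \<and> j < m \<and> (j = Suc i \<or> i = Suc j)} \<rparr>"

definition gen_lex_product ::
    "'a pair_pre_digraph \<Rightarrow> ('a \<Rightarrow> 'b pair_pre_digraph) \<Rightarrow> ('a \<times> 'b) pair_pre_digraph" where
  "gen_lex_product G H =
     \<lparr> pverts = (SIGMA i : pverts G. pverts (H i)),
       parcs = {((i, x), (j, y)) | i x j y.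
         i \<in> pverts G \<and> x \<in> pverts (H i) \<and> j \<in> pverts G \<and> y \<in> pverts (H j) \<and>
         (i = j \<and> (x, y) \<in> parcs (H i) \<or> (i, j) \<in> parcs G)} \<rparr>"

definition P4_product ::
    "'b pair_pre_digraph \<Rightarrow> 'b pair_pre_digraph \<Rightarrow> 'b pair_pre_digraph \<Rightarrow> 'b pair_pre_digraph
      \<Rightarrow> (nat \<times> 'b) pair_pre_digraph" where
  "P4_product H1 H2 H3 H4 = gen_lex_product (path_graph 4) (\<lambda>i. [H1, H2, H3, H4] ! i)"

end

theory Submission
  imports Defs "Jordan_Normal_Form.Schur_Decomposition"
begin

text \<open>
  Both eigenvalue conditions are rephrased through quadratic forms: \<open>\<partial>\<^sub>3 \<le> -1\<close> holds iff
  \<open>D + I\<close> is nonpositive on the common kernel of two linear functionals, and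
  \<open>\<partial>\<^bsub>n-1\<^esub> \<ge> -2\<close> holds iff \<open>D + 2I\<close> is nonnegative on the kernel of one. Such conditions pass to
  principal submatrices, so a three-dimensional (two-dimensional) subspace on which a small
  submatrix is definite of the wrong sign forbids it. Starting from a shortest path with four vertices
  (diameter 3), or from a triangle with a pendant edge or an induced path with three vertices
  (diameter 2), the distances of one further vertex to this base, and then the distance of two
  further vertices to each other, are forced by such forbidden submatrices on five and six vertices;
  this yields the block structure. On a block graph the two forms reduce to forms in the
  block sums, by the Cauchy-Schwarz inequality with equality for vectors constant on blocks: a block of
  size \<open>a\<close> gets the diagonal entry \<open>1\<close> (clique) or \<open>2 - 1/a\<close> (edgeless) in the first form, and
  \<open>1 + 1/a\<close> or \<open>2\<close> in the second. The numerical conditions on the sizes express the signatures of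
  these \<open>4 \<times> 4\<close> forms; the polynomial in the last case is the determinant of the second one, up to a
  positive factor.
\<close>

section \<open>Eigenvalues of real symmetric matrices\<close>

text \<open>The families have up to four size parameters, so eigenvalues are never computed. Stating
  the conditions through linear functionals lets one argument serve twice: vectors extended by zero
  pass to small submatrices, and vectors constant on blocks pass to block sums. The obstacle is that
  tests on one further vertex are inconclusive. Beside the twins of base vertices, two more profiles
  stay open for each four-vertex base: such a vertex is at distance 2 from some base vertex, yet no
  base vertex is adjacent to both. A common neighbour must exist outside the base, and the pair is
  refuted on six vertices. This is why distances are axiomatized together with intermediate
  vertices. Over an induced path with three vertices, the absence of triangles with a pendant edge
  does part of the work of the certificates, and the pentagon appears as an obstruction of its own.
  A further source of case distinctions is that a block with one vertex is both a clique and
  edgeless, and that a path of blocks can be read backwards, so the description of a graph by block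
  types is not unique.\<close>

lemma real_orthogonal_diagonalization:
  fixes A :: "real mat"
  assumes "A \<in> carrier_mat n n" and "transpose_mat A = A"
    and "char_poly A = (\<Prod>e\<leftarrow>es. [:- e, 1:])"
  shows "\<exists>U \<in> carrier_mat n n. transpose_mat U * U = 1\<^sub>m n \<and>
    transpose_mat U * A * U = mat n n (\<lambda>(i, j). if i = j then es ! i else 0)"
  using assms
proof (induction es arbitrary: n A)
  case Nil
  with degree_monic_char_poly[of A n] have "n = 0" by auto
  with Nil show ?case by (intro bexI[of _ "1\<^sub>m 0"]) auto
next
  case (Cons e es)
  \<comment> \<open>Deflation: an eigenvector for \<open>e\<close> becomes the first column of an
    orthogonal matrix \<open>W\<close>. Conjugation by \<open>W\<close> splits off the entry
    \<open>e\<close>, and symmetry clears the first row along with the first column. The list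
    \<open>es\<close> fixes the order of the diagonal entries.\<close>
  define m where "m = n - 1"
  note A = Cons.prems(1) and At = Cons.prems(2)
  have "degree (char_poly A) = Suc (length es)"
    unfolding Cons.prems(3) by (subst degree_linear_factors) simp
  with degree_monic_char_poly[OF A] have n: "n = Suc (length es)" by auto
  hence nm: "n = Suc m" by (simp add: m_def)
  have "eigenvalue A e" unfolding eigenvalue_root_char_poly[OF A] Cons.prems(3) by simp
  then obtain v where "eigenvector A v e" unfolding eigenvalue_def by auto
  hence v: "v \<in> carrier_vec n" "v \<noteq> 0\<^sub>v n" and ev: "A *\<^sub>v v = e \<cdot>\<^sub>v v"
    using A unfolding eigenvector_def by auto
  interpret cof_vec_space n "TYPE(real)" .
  define b where "b = basis_completion v"
  define ws where "ws = gram_schmidt n b"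
  from basis_completion[OF v, folded b_def]
  have dist_b: "distinct b" and indep: "\<not> lin_dep (set b)" and b: "set b \<subseteq> carrier_vec n"
    and hdb: "hd b = v" and len_b: "length b = n" by auto
  from hdb len_b n obtain bs where bv: "b = v # bs" by (cases b, auto)
  from gram_schmidt_result[OF b dist_b indep refl, folded ws_def]
  have ws: "set ws \<subseteq> carrier_vec n" "corthogonal ws" "length ws = n"
    by (auto simp: len_b)
  have hdws: "hd ws = v" using gram_schmidt_hd[OF v(1), of bs, folded bv] unfolding ws_def .
  hence ws0: "ws ! 0 = v" using ws(3) n by (cases ws) auto
  define c where "c i = 1 / sqrt (ws ! i \<bullet> ws ! i)" for i
  have wsc: "ws ! i \<in> carrier_vec n" if "i < n" for i using ws that by auto
  \<comment> \<open>\<open>corthogonal\<close> refers to the conjugated product, which over the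
    reals is the plain scalar product.\<close>
  have cj: "conjugate x = x" for x :: "real vec" by (intro eq_vecI) (auto simp: conjugate_vec_def)
  have orth: "ws ! i \<bullet> ws ! j = 0 \<longleftrightarrow> i \<noteq> j" if "i < n" "j < n" for i j
    using corthogonalD[OF ws(2)] that ws(3) by (simp add: cj)
  have pos: "ws ! i \<bullet> ws ! i > 0" if "i < n" for i
    using orth[OF that that] sum_nonneg[of "{0..<dim_vec (ws ! i)}" "\<lambda>k. ws ! i $ k * ws ! i $ k"]
    by (simp add: less_le scalar_prod_def)
  define W where "W = mat n n (\<lambda>(r, i). c i * ws ! i $ r)"
  have W: "W \<in> carrier_mat n n" by (simp add: W_def)
  have colW: "col W i = c i \<cdot>\<^sub>v ws ! i" if "i < n" for i
    using that wsc[OF that] by (intro eq_vecI) (auto simp: W_def)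
  have WW: "transpose_mat W * W = 1\<^sub>m n"
  proof (rule eq_matI)
    fix i j assume ij: "i < dim_row (1\<^sub>m n)" "j < dim_col (1\<^sub>m n)"
    hence "(transpose_mat W * W) $$ (i, j) = c i * c j * (ws ! i \<bullet> ws ! j)"
      using W wsc[of i] wsc[of j] by (simp add: colW)
    also have "\<dots> = 1\<^sub>m n $$ (i, j)"
    proof (cases "i = j")
      case True
      hence "c i * c j = 1 / (sqrt (ws ! i \<bullet> ws ! i))\<^sup>2"
        by (simp add: c_def power2_eq_square)
      with True ij pos[of i] show ?thesis by simp
    next
      case False
      thus ?thesis using orth[of i j] ij by simp
    qed
    finally show "(transpose_mat W * W) $$ (i, j) = 1\<^sub>m n $$ (i, j)" .
  qed (use W in auto)
  define A' where "A' = transpose_mat W * A * W"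
  have A': "A' \<in> carrier_mat n n" using W A by (auto simp: A'_def)
  have A't: "transpose_mat A' = A'"
    using W A by (simp add: A'_def transpose_mult[of _ n n _ n] At assoc_mult_mat[of _ n n _ n _ n])
  have WtW: "W * transpose_mat W = 1\<^sub>m n"
    using mat_mult_left_right_inverse[OF _ W WW] W by simp
  have AW0: "col (A * W) 0 = e \<cdot>\<^sub>v col W 0"
  proof -
    have "col (A * W) 0 = A *\<^sub>v col W 0" using A W n by (intro col_mult2) auto
    also have "\<dots> = c 0 \<cdot>\<^sub>v (A *\<^sub>v v)"
      using A n v(1) by (simp add: colW ws0 mult_mat_vec[of _ n n])
    finally show ?thesis using n by (simp add: ev colW ws0 smult_smult_assoc mult.commute)
  qed
  have col0: "A' $$ (i, 0) = (if i = 0 then e else 0)" if i: "i < n" for i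
  proof -
    have "A' = transpose_mat W * (A * W)" using A W by (simp add: A'_def assoc_mult_mat[of _ n n _ n _ n])
    hence "A' $$ (i, 0) = col W i \<bullet> col (A * W) 0" using A W i n by simp
    also have "\<dots> = e * (col W i \<bullet> col W 0)" unfolding AW0 using W n by simp
    also have "col W i \<bullet> col W 0 = (transpose_mat W * W) $$ (i, 0)" using W i n by simp
    finally show ?thesis unfolding WW using i n by simp
  qed
  have row0: "A' $$ (0, i) = (if i = 0 then e else 0)" if i: "i < n" for i
  proof -
    have "A' $$ (0, i) = transpose_mat A' $$ (0, i)" by (simp add: A't)
    also have "\<dots> = A' $$ (i, 0)" using A' i n by simp
    finally show ?thesis using col0[OF i] by simp
  qed
  define B where "B = mat m m (\<lambda>(i, j). A' $$ (Suc i, Suc j))"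
  have B: "B \<in> carrier_mat m m" by (simp add: B_def)
  have Bt: "transpose_mat B = B"
  proof (rule eq_matI)
    fix i j assume "i < dim_row B" "j < dim_col B"
    hence ij: "i < m" "j < m" using B by auto
    have "A' $$ (Suc j, Suc i) = transpose_mat A' $$ (Suc i, Suc j)"
      using ij A' nm by (subst index_transpose_mat) auto
    thus "transpose_mat B $$ (i, j) = B $$ (i, j)" using ij by (simp add: B_def A't)
  qed (use B in auto)
  let ?E = "mat 1 1 (\<lambda>_. e)"
  have block: "A' = four_block_mat ?E (0\<^sub>m 1 m) (0\<^sub>m m 1) B"
    using A' nm col0 row0 by (intro eq_matI) (auto simp: B_def)
  have "similar_mat A' A"
    unfolding similar_mat_def
    by (rule exI[of _ "transpose_mat W"], rule exI[of _ W], rule similar_mat_witI[of _ _ n])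
      (use W A A' WW WtW in \<open>auto simp: A'_def\<close>)
  \<comment> \<open>Similarity and the block shape both factor the characteristic polynomial;
    cancelling \<open>[:- e, 1:]\<close> leaves the factorization that the induction hypothesis asks
    for.\<close>
  from char_poly_similar[OF this]
  have cp: "char_poly A' = [:- e, 1:] * (\<Prod>e\<leftarrow>es. [:- e, 1:])" using Cons.prems(3) by simp
  have "char_poly A' = char_poly ?E * char_poly B"
    unfolding block by (rule char_poly_four_block_zeros_col[OF _ _ B]) auto
  moreover have "char_poly ?E = [:- e, 1:]"
    by (simp add: char_poly_defs det_def sign_def)
  ultimately have cpB: "char_poly B = (\<Prod>e\<leftarrow>es. [:- e, 1:])"
    using cp by (metis mult_cancel_left pCons_eq_0_iff zero_neq_one)
  obtain V where V: "V \<in> carrier_mat m m" and VV: "transpose_mat V * V = 1\<^sub>m m"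
    and VBV: "transpose_mat V * B * V = mat m m (\<lambda>(i, j). if i = j then es ! i else 0)"
    using Cons.IH[OF B Bt cpB] by auto
  define V' where "V' = four_block_mat (1\<^sub>m 1) (0\<^sub>m 1 m) (0\<^sub>m m 1) V"
  have V': "V' \<in> carrier_mat n n" using V nm by (auto simp: V'_def)
  have V't: "transpose_mat V' = four_block_mat (1\<^sub>m 1) (0\<^sub>m 1 m) (0\<^sub>m m 1) (transpose_mat V)"
    unfolding V'_def by (subst transpose_four_block_mat[of _ 1 1 _ m _ m]) (use V in auto)
  have "transpose_mat V' * V' = four_block_mat (1\<^sub>m 1) (0\<^sub>m 1 m) (0\<^sub>m m 1) (1\<^sub>m m)"
    unfolding V't unfolding V'_def
    by (subst mult_four_block_mat[of _ 1 1 _ m _ m _ _ 1 _ m]) (use V VV in auto)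
  also have "\<dots> = 1\<^sub>m n" by (intro eq_matI) (auto simp: nm)
  finally have V'V': "transpose_mat V' * V' = 1\<^sub>m n" .
  have tA: "transpose_mat V' * A' = four_block_mat ?E (0\<^sub>m 1 m) (0\<^sub>m m 1) (transpose_mat V * B)"
    unfolding V't block
    by (subst mult_four_block_mat[of _ 1 1 _ m _ m _ _ 1 _ m]) (use V B in auto)
  have "transpose_mat V' * A' * V' =
      four_block_mat ?E (0\<^sub>m 1 m) (0\<^sub>m m 1) (transpose_mat V * B * V)"
    unfolding tA unfolding V'_def
    by (subst mult_four_block_mat[of _ 1 1 _ m _ m _ _ 1 _ m]) (use V B in auto)
  also have "\<dots> = mat n n (\<lambda>(i, j). if i = j then (e # es) ! i else 0)"
    unfolding VBV by (intro eq_matI) (auto simp: nm)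
  finally have V'A'V': "transpose_mat V' * A' * V' = \<dots>" .
  have "transpose_mat (W * V') * (W * V') = transpose_mat V' * (transpose_mat W * W) * V'"
    using W V' by (simp add: transpose_mult[of _ n n _ n] assoc_mult_mat[of _ n n _ n _ n])
  hence 1: "transpose_mat (W * V') * (W * V') = 1\<^sub>m n" using V' by (simp add: WW V'V')
  have 2: "transpose_mat (W * V') * A * (W * V') = transpose_mat V' * A' * V'"
    using W V' A
    by (simp add: A'_def transpose_mult[of _ n n _ n] assoc_mult_mat[of _ n n _ n _ n])
  show ?case
    by (rule bexI[of _ "W * V'"]) (use W V' 1 2 V'A'V' in auto)
qed

interpretation of_real_poly_hom: map_poly_inj_idom_hom of_real ..

text \<open>Over the complex numbers the polynomial splits. For a root \<open>a\<close> with
  eigenvector \<open>v\<close>, the Hermitian form \<open>S\<close> of \<open>v\<close> equals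
  \<open>a * N\<close> with \<open>N > 0\<close> the squared norm. Symmetry of the matrix makes
  \<open>S\<close> invariant under conjugation, so every root is real.\<close>

lemma real_symmetric_char_poly_splits:
  fixes A :: "real mat"
  assumes A: "A \<in> carrier_mat n n" and At: "transpose_mat A = A"
  obtains es where "char_poly A = (\<Prod>e\<leftarrow>es. [:- e, 1:])" and "length es = n"
proof -
  let ?C = "map_mat complex_of_real A"
  have C: "?C \<in> carrier_mat n n" using A by simp
  obtain as where as: "char_poly ?C = (\<Prod>a\<leftarrow>as. [:- a, 1:])" and len: "length as = n"
    using char_poly_factorized[OF C] by auto
  have real: "a \<in> \<real>" if a: "a \<in> set as" for a
  proof -
    have "poly (char_poly ?C) a = 0"
      using a unfolding as poly_prod_list by (simp add: prod_list_zero_iff)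
    then obtain v where v: "v \<in> carrier_vec n" "v \<noteq> 0\<^sub>v n" and ev: "?C *\<^sub>v v = a \<cdot>\<^sub>v v"
      using eigenvalue_root_char_poly[OF C] A unfolding eigenvalue_def eigenvector_def by auto
    have sym: "A $$ (i, j) = A $$ (j, i)" if "i < n" "j < n" for i j
      using arg_cong[OF At, of "\<lambda>M. M $$ (i, j)"] that A by simp
    have row: "(\<Sum>j<n. A $$ (i, j) * v $ j) = a * v $ i" if "i < n" for i
      using arg_cong[OF ev, of "\<lambda>x. x $ i"] that A v
      by (simp add: scalar_prod_def atLeast0LessThan)
    define N where "N = (\<Sum>i<n. (norm (v $ i))\<^sup>2)"
    obtain i where i: "i < n" "v $ i \<noteq> 0" using v by (metis eq_vecI carrier_vecD index_zero_vec)
    have "N \<ge> (norm (v $ i))\<^sup>2" unfolding N_def by (rule member_le_sum) (use i in auto)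
    moreover have "(norm (v $ i))\<^sup>2 > 0" using i by simp
    ultimately have N: "N > 0" by linarith
    define S where "S = (\<Sum>i<n. \<Sum>j<n. complex_of_real (A $$ (i, j)) * v $ j * cnj (v $ i))"
    have "S = (\<Sum>i<n. a * v $ i * cnj (v $ i))"
      unfolding S_def by (intro sum.cong refl) (simp flip: row add: sum_distrib_right)
    also have "\<dots> = a * of_real N"
      by (simp add: N_def sum_distrib_left complex_norm_square mult.assoc del: of_real_power)
    finally have S: "S = a * of_real N" .
    have "cnj S = (\<Sum>i<n. \<Sum>j<n. complex_of_real (A $$ (i, j)) * cnj (v $ j) * v $ i)"
      by (simp add: S_def)
    also have "\<dots> = (\<Sum>j<n. \<Sum>i<n. complex_of_real (A $$ (i, j)) * cnj (v $ j) * v $ i)"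
      by (rule sum.swap)
    also have "\<dots> = S"
      unfolding S_def by (intro sum.cong refl) (auto simp: sym)
    finally have "S \<in> \<real>" by (simp add: Reals_cnj_iff)
    moreover have "a = S / of_real N" using S N by simp
    ultimately show ?thesis by simp
  qed
  define es where "es = map Re as"
  have "map complex_of_real es = as"
    unfolding es_def map_map by (rule map_idI) (use real in \<open>auto simp: of_real_Re\<close>)
  hence "char_poly ?C = (\<Prod>e\<leftarrow>es. [:- complex_of_real e, 1:])"
    unfolding as by (metis (no_types, lifting) comp_apply map_eq_conv map_map)
  also have "\<dots> = map_poly complex_of_real (\<Prod>e\<leftarrow>es. [:- e, 1:])"
    by (simp add: of_real_poly_hom.hom_prod_list o_def)
  finally have "map_poly complex_of_real (char_poly A) = map_poly complex_of_real (\<Prod>e\<leftarrow>es. [:- e, 1:])"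
    by (simp add: of_real_hom.char_poly_hom[OF A])
  hence "char_poly A = (\<Prod>e\<leftarrow>es. [:- e, 1:])"
    by simp
  thus thesis by (rule that) (simp add: es_def len)
qed

text \<open>The orthogonal change of coordinates, written with sums: the new coordinates preserve
  the norm, diagonalize the form, and can be prescribed arbitrarily. The third property is what lets
  the min-max argument build vectors inside a span of eigenvectors.\<close>

lemma symmetric_diagonal_form:
  fixes A :: "real mat"
  assumes A: "A \<in> carrier_mat n n" and At: "transpose_mat A = A"
    and cp: "char_poly A = (\<Prod>e\<leftarrow>es. [:- e, 1:])"
  obtains u :: "nat \<Rightarrow> nat \<Rightarrow> real" where
    "\<And>x. (\<Sum>i<n. (\<Sum>r<n. u r i * x r)\<^sup>2) = (\<Sum>r<n. (x r)\<^sup>2)"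
    "\<And>x. (\<Sum>r<n. \<Sum>s<n. A $$ (r, s) * x r * x s) = (\<Sum>i<n. es ! i * (\<Sum>r<n. u r i * x r)\<^sup>2)"
    "\<And>y i. i < n \<Longrightarrow> (\<Sum>r<n. u r i * (\<Sum>j<n. u r j * y j)) = y i"
proof -
  obtain U where U: "U \<in> carrier_mat n n" and UU: "transpose_mat U * U = 1\<^sub>m n"
    and UAU: "transpose_mat U * A * U = mat n n (\<lambda>(i, j). if i = j then es ! i else 0)"
    using real_orthogonal_diagonalization[OF A At cp] by auto
  define u where "u r i = U $$ (r, i)" for r i
  have UtU: "U * transpose_mat U = 1\<^sub>m n"
    using mat_mult_left_right_inverse[OF _ U UU] U by simp
  have o1: "(\<Sum>r<n. u r i * u r j) = (if i = j then 1 else 0)" if "i < n" "j < n" for i j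
    using arg_cong[OF UU, of "\<lambda>M. M $$ (i, j)"] that U
    by (simp add: scalar_prod_def u_def atLeast0LessThan)
  have o2: "(\<Sum>i<n. u r i * u s i) = (if r = s then 1 else 0)" if "r < n" "s < n" for r s
    using arg_cong[OF UtU, of "\<lambda>M. M $$ (r, s)"] that U
    by (simp add: scalar_prod_def u_def atLeast0LessThan)
  let ?L = "mat n n (\<lambda>(i, j). if i = j then es ! i else 0)"
  have "U * ?L * transpose_mat U = (U * transpose_mat U) * A * (U * transpose_mat U)"
    unfolding UAU[symmetric] using U A by (simp add: assoc_mult_mat[of _ n n _ n _ n])
  hence "A = U * ?L * transpose_mat U" using A by (simp add: UtU)
  moreover have "U * ?L = mat n n (\<lambda>(r, i). u r i * es ! i)"
    using U by (intro eq_matI)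
      (auto simp: scalar_prod_def u_def atLeast0LessThan if_distrib[of "\<lambda>c. _ * c"] cong: if_cong)
  ultimately have Ars: "A $$ (r, s) = (\<Sum>i<n. u r i * es ! i * u s i)" if "r < n" "s < n" for r s
    using that U by (simp add: scalar_prod_def u_def atLeast0LessThan)
  \<comment> \<open>With \<open>c\<close> constantly 1 this gives the identity for the norm, with
    the eigenvalues the identity for the form.\<close>
  have sq: "(\<Sum>i<n. c i * (\<Sum>r<n. u r i * x r)\<^sup>2)
      = (\<Sum>r<n. \<Sum>s<n. (\<Sum>i<n. u r i * c i * u s i) * x r * x s)" for c x
  proof -
    have "(\<Sum>i<n. c i * (\<Sum>r<n. u r i * x r)\<^sup>2)
        = (\<Sum>i<n. \<Sum>r<n. \<Sum>s<n. u r i * c i * u s i * x r * x s)"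
      by (simp add: power2_eq_square sum_product sum_distrib_left mult_ac)
    also have "\<dots> = (\<Sum>r<n. \<Sum>i<n. \<Sum>s<n. u r i * c i * u s i * x r * x s)"
      by (rule sum.swap)
    also have "\<dots> = (\<Sum>r<n. \<Sum>s<n. \<Sum>i<n. u r i * c i * u s i * x r * x s)"
      by (intro sum.cong refl sum.swap)
    finally show ?thesis by (simp add: sum_distrib_right)
  qed
  show thesis
  proof (rule that[of u])
    fix x :: "nat \<Rightarrow> real"
    have "(\<Sum>i<n. (\<Sum>r<n. u r i * x r)\<^sup>2) = (\<Sum>r<n. \<Sum>s<n. (\<Sum>i<n. u r i * u s i) * x r * x s)"
      using sq[of "\<lambda>_. 1" x] by simp
    also have "\<dots> = (\<Sum>r<n. \<Sum>s<n. (if r = s then 1 else 0) * x r * x s)"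
      by (intro sum.cong refl) (simp add: o2)
    also have "\<dots> = (\<Sum>r<n. (x r)\<^sup>2)"
      by (intro sum.cong refl) (simp add: power2_eq_square if_distrib[of "\<lambda>c. c * _"] cong: if_cong)
    finally show "(\<Sum>i<n. (\<Sum>r<n. u r i * x r)\<^sup>2) = (\<Sum>r<n. (x r)\<^sup>2)" .
    show "(\<Sum>r<n. \<Sum>s<n. A $$ (r, s) * x r * x s) = (\<Sum>i<n. es ! i * (\<Sum>r<n. u r i * x r)\<^sup>2)"
      unfolding sq by (intro sum.cong refl) (simp add: Ars)
  next
    fix y :: "nat \<Rightarrow> real" and i assume i: "i < n"
    have "(\<Sum>r<n. u r i * (\<Sum>j<n. u r j * y j)) = (\<Sum>r<n. \<Sum>j<n. u r i * u r j * y j)"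
      by (simp add: sum_distrib_left mult_ac)
    also have "\<dots> = (\<Sum>j<n. (\<Sum>r<n. u r i * u r j) * y j)"
      by (subst sum.swap) (simp add: sum_distrib_right)
    also have "\<dots> = (\<Sum>j<n. (if i = j then 1 else 0) * y j)"
      by (intro sum.cong refl) (simp add: o1 i)
    also have "\<dots> = y i" using i by (simp add: if_distrib[of "\<lambda>c. c * _"] cong: if_cong)
    finally show "(\<Sum>r<n. u r i * (\<Sum>j<n. u r j * y j)) = y i" .
  qed
qed

section \<open>Min-max characterization of the k-th eigenvalue\<close>

lemma homogeneous_system_nontrivial:
  fixes q :: "nat \<Rightarrow> nat \<Rightarrow> real"
  obtains y i where "i \<le> k" and "y i \<noteq> 0" and "\<And>j. j < k \<Longrightarrow> (\<Sum>i\<le>k. q j i * y i) = 0"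
proof -
  \<comment> \<open>A zero row completes the \<open>k\<close> equations in \<open>k + 1\<close>
    unknowns to a square matrix, whose determinant therefore vanishes.\<close>
  define M where "M = mat (Suc k) (Suc k) (\<lambda>(j, i). if j < k then q j i else 0)"
  have M: "M \<in> carrier_mat (Suc k) (Suc k)" by (simp add: M_def)
  have "det M = 0" using laplace_expansion_row[OF M, of k] by (simp add: M_def)
  then obtain v where v: "v \<in> carrier_vec (Suc k)" "v \<noteq> 0\<^sub>v (Suc k)" "M *\<^sub>v v = 0\<^sub>v (Suc k)"
    using det_0_iff_vec_prod_zero[OF M] by auto
  obtain i where "i < Suc k" "v $ i \<noteq> 0" using v by (metis eq_vecI carrier_vecD index_zero_vec)
  moreover have "(\<Sum>i\<le>k. q j i * v $ i) = 0" if "j < k" for j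
    using arg_cong[OF v(3), of "\<lambda>w. w $ j"] that M v(1)
    by (simp add: M_def scalar_prod_def atLeast0LessThan lessThan_Suc_atMost)
  ultimately show thesis using that[of i "\<lambda>i. v $ i"] by simp
qed

text \<open>Courant-Fischer, with eigenvalues counted from 0, so that \<open>e k\<close> is governed
  by \<open>k\<close> functionals. If \<open>e k\<close> is at most \<open>c\<close>, the first
  \<open>k\<close> eigencoordinates serve as functionals. Conversely the first \<open>k + 1\<close>
  eigenvectors span a space that meets the kernel of any \<open>k\<close> functionals nontrivially,
  and on it the form is at least \<open>e k\<close> times the squared norm.\<close>

lemma kth_eigenvalue_le_iff:
  fixes u :: "nat \<Rightarrow> nat \<Rightarrow> real" and e :: "nat \<Rightarrow> real" and F :: "(nat \<Rightarrow> real) \<Rightarrow> real"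
  assumes norm: "\<And>x. (\<Sum>i<n. (\<Sum>r<n. u r i * x r)\<^sup>2) = (\<Sum>r<n. (x r)\<^sup>2)"
    and F: "\<And>x. F x = (\<Sum>i<n. e i * (\<Sum>r<n. u r i * x r)\<^sup>2)"
    and surj: "\<And>y i. i < n \<Longrightarrow> (\<Sum>r<n. u r i * (\<Sum>j<n. u r j * y j)) = y i"
    and desc: "\<And>i j. i \<le> j \<Longrightarrow> j < n \<Longrightarrow> e j \<le> e i"
    and k: "k < n"
  shows "e k \<le> c \<longleftrightarrow> (\<exists>p::nat \<Rightarrow> nat \<Rightarrow> real. \<forall>x.
    (\<forall>j<k. (\<Sum>r<n. p j r * x r) = 0) \<longrightarrow> F x \<le> c * (\<Sum>r<n. (x r)\<^sup>2))"
proof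
  assume le: "e k \<le> c"
  show "\<exists>p::nat \<Rightarrow> nat \<Rightarrow> real. \<forall>x.
    (\<forall>j<k. (\<Sum>r<n. p j r * x r) = 0) \<longrightarrow> F x \<le> c * (\<Sum>r<n. (x r)\<^sup>2)"
  proof (intro exI[of _ "\<lambda>j r. u r j"] allI impI)
    fix x :: "nat \<Rightarrow> real" assume z: "\<forall>j<k. (\<Sum>r<n. u r j * x r) = 0"
    have "e i * (\<Sum>r<n. u r i * x r)\<^sup>2 \<le> c * (\<Sum>r<n. u r i * x r)\<^sup>2" if i: "i < n" for i
    proof (cases "i < k")
      case False
      hence "e i \<le> c" using desc[of k i] i le by simp
      thus ?thesis by (simp add: mult_right_mono)
    qed (use z in simp)
    thus "F x \<le> c * (\<Sum>r<n. (x r)\<^sup>2)"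
      unfolding F norm[of x, symmetric] sum_distrib_left[of c] by (intro sum_mono) auto
  qed
next
  assume "\<exists>p::nat \<Rightarrow> nat \<Rightarrow> real. \<forall>x.
    (\<forall>j<k. (\<Sum>r<n. p j r * x r) = 0) \<longrightarrow> F x \<le> c * (\<Sum>r<n. (x r)\<^sup>2)"
  then obtain p :: "nat \<Rightarrow> nat \<Rightarrow> real" where
    p: "\<And>x. (\<And>j. j < k \<Longrightarrow> (\<Sum>r<n. p j r * x r) = 0) \<Longrightarrow> F x \<le> c * (\<Sum>r<n. (x r)\<^sup>2)" by blast
  obtain y i where y: "i \<le> k" "y i \<noteq> 0"
    "\<And>j. j < k \<Longrightarrow> (\<Sum>i\<le>k. (\<Sum>r<n. p j r * u r i) * y i) = 0"
    using homogeneous_system_nontrivial[of k "\<lambda>j i. \<Sum>r<n. p j r * u r i"] by metis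
  \<comment> \<open>Coordinates beyond \<open>k\<close> are set to 0, which keeps \<open>x\<close>
    in the span of the first \<open>k + 1\<close> eigenvectors.\<close>
  define y' where "y' i = (if i \<le> k then y i else 0)" for i
  define x where "x r = (\<Sum>j<n. u r j * y' j)" for r
  have yx: "(\<Sum>r<n. u r i * x r) = y' i" if "i < n" for i
    unfolding x_def by (rule surj[OF that])
  have sub: "(\<Sum>i<n. g i * y' i) = (\<Sum>i\<le>k. g i * y i)" for g
    using k by (intro sum.mono_neutral_cong_right) (auto simp: y'_def)
  have "(\<Sum>r<n. p j r * x r) = 0" if "j < k" for j
  proof -
    have "(\<Sum>r<n. p j r * x r) = (\<Sum>i<n. \<Sum>r<n. p j r * u r i * y' i)"
      unfolding x_def sum_distrib_left by (subst sum.swap) (simp add: mult_ac)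
    also have "\<dots> = (\<Sum>i<n. (\<Sum>r<n. p j r * u r i) * y' i)" by (simp add: sum_distrib_right)
    finally show ?thesis using y(3)[OF that] by (simp add: sub)
  qed
  from p[OF this] have "F x \<le> c * (\<Sum>i<n. (y' i)\<^sup>2)"
    using norm[of x] by (simp add: yx)
  moreover have "e k * (y' i)\<^sup>2 \<le> e i * (y' i)\<^sup>2" for i
    using desc[of i k] k by (cases "i \<le> k") (auto simp: y'_def intro: mult_right_mono)
  hence "e k * (\<Sum>i<n. (y' i)\<^sup>2) \<le> F x"
    unfolding F sum_distrib_left by (intro sum_mono) (simp add: yx)
  ultimately have "e k * (\<Sum>i<n. (y' i)\<^sup>2) \<le> c * (\<Sum>i<n. (y' i)\<^sup>2)" by linarith
  moreover have "(\<Sum>i<n. (y' i)\<^sup>2) \<ge> (y' i)\<^sup>2"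
    using y(1) k by (intro member_le_sum) auto
  hence "(\<Sum>i<n. (y' i)\<^sup>2) > 0" using y(1,2) by (simp add: y'_def less_le_trans[of _ "(y i)\<^sup>2"])
  ultimately show "e k \<le> c" by simp
qed

text \<open>The upper bound applied to the negated form; the index reflection
  \<open>n - Suc i\<close> restores the decreasing order.\<close>

lemma kth_eigenvalue_ge_iff:
  fixes u :: "nat \<Rightarrow> nat \<Rightarrow> real" and e :: "nat \<Rightarrow> real" and F :: "(nat \<Rightarrow> real) \<Rightarrow> real"
  assumes norm: "\<And>x. (\<Sum>i<n. (\<Sum>r<n. u r i * x r)\<^sup>2) = (\<Sum>r<n. (x r)\<^sup>2)"
    and F: "\<And>x. F x = (\<Sum>i<n. e i * (\<Sum>r<n. u r i * x r)\<^sup>2)"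
    and surj: "\<And>y i. i < n \<Longrightarrow> (\<Sum>r<n. u r i * (\<Sum>j<n. u r j * y j)) = y i"
    and desc: "\<And>i j. i \<le> j \<Longrightarrow> j < n \<Longrightarrow> e j \<le> e i"
    and k: "k < n"
  shows "c \<le> e (n - Suc k) \<longleftrightarrow> (\<exists>p::nat \<Rightarrow> nat \<Rightarrow> real. \<forall>x.
    (\<forall>j<k. (\<Sum>r<n. p j r * x r) = 0) \<longrightarrow> c * (\<Sum>r<n. (x r)\<^sup>2) \<le> F x)"
proof -
  have "- e (n - Suc k) \<le> - c \<longleftrightarrow> (\<exists>p::nat \<Rightarrow> nat \<Rightarrow> real. \<forall>x.
    (\<forall>j<k. (\<Sum>r<n. p j r * x r) = 0) \<longrightarrow> - F x \<le> - c * (\<Sum>r<n. (x r)\<^sup>2))"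
  proof (rule kth_eigenvalue_le_iff[where u = "\<lambda>r i. u r (n - Suc i)"])
    show "(\<Sum>i<n. (\<Sum>r<n. u r (n - Suc i) * x r)\<^sup>2) = (\<Sum>r<n. (x r)\<^sup>2)" for x
      using norm[of x] sum.nat_diff_reindex[of "\<lambda>i. (\<Sum>r<n. u r i * x r)\<^sup>2" n] by simp
    show "- F x = (\<Sum>i<n. - e (n - Suc i) * (\<Sum>r<n. u r (n - Suc i) * x r)\<^sup>2)" for x
      using F[of x] sum.nat_diff_reindex[of "\<lambda>i. e i * (\<Sum>r<n. u r i * x r)\<^sup>2" n]
      by (simp add: sum_negf)
    show "(\<Sum>r<n. u r (n - Suc i) * (\<Sum>j<n. u r (n - Suc j) * y j)) = y i" if i: "i < n" for y i
    proof -
      have "(\<Sum>j<n. u r (n - Suc j) * y j) = (\<Sum>j<n. u r j * y (n - Suc j))" for r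
        using sum.nat_diff_reindex[of "\<lambda>j. u r j * y (n - Suc j)" n, symmetric]
        by (auto intro!: sum.cong)
      thus ?thesis using surj[of "n - Suc i" "\<lambda>j. y (n - Suc j)"] i by simp
    qed
    show "- e (n - Suc j) \<le> - e (n - Suc i)" if "i \<le> j" "j < n" for i j
      using desc[of "n - Suc j" "n - Suc i"] that by simp
  qed (rule k)
  thus ?thesis by simp
qed

lemma proots_prod_linear: "proots (\<Prod>e\<leftarrow>es. [:- e, 1:]) = mset (es :: real list)"
proof (induction es)
  case (Cons e es)
  have "(\<Prod>e\<leftarrow>es. [:- e, 1:]) \<noteq> (0 :: real poly)" by (auto simp: prod_list_zero_iff)
  thus ?case using Cons by (simp add: proots_mult proots_linear_factor del: mult_pCons_left)
qed simp

lemma eigenvalues_desc_symmetric: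
  assumes A: "A \<in> carrier_mat n n" and At: "transpose_mat A = A"
  shows "char_poly A = (\<Prod>e\<leftarrow>eigenvalues_desc A. [:- e, 1:])"
    and "length (eigenvalues_desc A) = n"
    and "i \<le> j \<Longrightarrow> j < n \<Longrightarrow> eigenvalues_desc A ! j \<le> eigenvalues_desc A ! i"
proof -
  obtain es where es: "char_poly A = (\<Prod>e\<leftarrow>es. [:- e, 1:])" "length es = n"
    using real_symmetric_char_poly_splits[OF A At] .
  have eq: "eigenvalues_desc A = rev (sort es)"
    unfolding eigenvalues_desc_def es(1) proots_prod_linear by simp
  show "length (eigenvalues_desc A) = n" by (simp add: eq es)
  have "mset (eigenvalues_desc A) = mset es" by (simp add: eq)
  hence "prod_list (map (\<lambda>e. [:- e, 1:]) (eigenvalues_desc A)) = prod_list (map (\<lambda>e. [:- e, 1:]) es)"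
    by (metis mset_map prod_mset_prod_list)
  thus "char_poly A = (\<Prod>e\<leftarrow>eigenvalues_desc A. [:- e, 1:])" by (simp add: es)
  show "eigenvalues_desc A ! j \<le> eigenvalues_desc A ! i" if "i \<le> j" "j < n"
    unfolding eq using that es by (simp add: rev_nth sorted_nth_mono)
qed

section \<open>The eigenvalue conditions as conditions on the distance form\<close>

definition qform :: "'a set \<Rightarrow> ('a \<Rightarrow> 'a \<Rightarrow> nat) \<Rightarrow> ('a \<Rightarrow> real) \<Rightarrow> real" where
  "qform V d x = (\<Sum>u\<in>V. \<Sum>v\<in>V. real (d u v) * x u * x v)"

definition lam3_cond :: "'a set \<Rightarrow> ('a \<Rightarrow> 'a \<Rightarrow> nat) \<Rightarrow> bool" where
  "lam3_cond V d \<longleftrightarrow> (\<exists>p q. \<forall>x. (\<Sum>v\<in>V. p v * x v) = 0 \<longrightarrow> (\<Sum>v\<in>V. q v * x v) = 0 \<longrightarrow>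
     qform V d x + (\<Sum>v\<in>V. (x v)\<^sup>2) \<le> 0)"

definition lam_penult_cond :: "'a set \<Rightarrow> ('a \<Rightarrow> 'a \<Rightarrow> nat) \<Rightarrow> bool" where
  "lam_penult_cond V d \<longleftrightarrow> (\<exists>p. \<forall>x. (\<Sum>v\<in>V. p v * x v) = 0 \<longrightarrow>
     qform V d x + 2 * (\<Sum>v\<in>V. (x v)\<^sup>2) \<ge> 0)"

text \<open>Moves the min-max criterion from indices to vertices, so that the order of
  \<open>vs\<close> disappears from the conditions. Lists are indexed from 0: eigenvalue 3 is entry
  2 and needs two functionals, eigenvalue \<open>n - 1\<close> is entry \<open>n - 2\<close> and
  needs one.\<close>

lemma dist_eigenvalue_conds:
  assumes dist: "distinct vs" and n: "length vs = n" "n \<ge> 3"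
    and sym: "\<And>u v. u \<in> set vs \<Longrightarrow> v \<in> set vs \<Longrightarrow> gdist G u v = gdist G v u"
  shows "dist_eigenvalue G vs 3 \<le> - 1 \<longleftrightarrow> lam3_cond (set vs) (gdist G)"
    and "dist_eigenvalue G vs (n - 1) \<ge> - 2 \<longleftrightarrow> lam_penult_cond (set vs) (gdist G)"
proof -
  let ?A = "distance_matrix G vs"
  have A: "?A \<in> carrier_mat n n" by (simp add: distance_matrix_def n)
  have At: "transpose_mat ?A = ?A"
    by (intro eq_matI) (auto simp: distance_matrix_def intro!: sym)
  note ev = eigenvalues_desc_symmetric[OF A At]
  obtain u :: "nat \<Rightarrow> nat \<Rightarrow> real" where u:
    "\<And>x. (\<Sum>i<n. (\<Sum>r<n. u r i * x r)\<^sup>2) = (\<Sum>r<n. (x r)\<^sup>2)"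
    "\<And>x. (\<Sum>r<n. \<Sum>s<n. ?A $$ (r, s) * x r * x s)
       = (\<Sum>i<n. eigenvalues_desc ?A ! i * (\<Sum>r<n. u r i * x r)\<^sup>2)"
    "\<And>y i. i < n \<Longrightarrow> (\<Sum>r<n. u r i * (\<Sum>j<n. u r j * y j)) = y i"
    using symmetric_diagonal_form[OF A At ev(1)] by blast
  have bij: "bij_betw ((!) vs) {..<n} (set vs)" using dist n by (auto intro: bij_betw_nth)
  have sumV: "(\<Sum>v\<in>set vs. g v) = (\<Sum>r<n. g (vs ! r))" for g :: "_ \<Rightarrow> real"
    using sum.reindex_bij_betw[OF bij, of g] by simp
  have form: "(\<Sum>r<n. \<Sum>s<n. ?A $$ (r, s) * x (vs ! r) * x (vs ! s)) = qform (set vs) (gdist G) x" for x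
    unfolding qform_def sumV by (intro sum.cong refl) (simp add: distance_matrix_def n)
  define idx where "idx = the_inv_into {..<n} ((!) vs)"
  have idx: "idx (vs ! r) = r" if "r < n" for r
    unfolding idx_def using bij that by (intro the_inv_into_f_f) (auto simp: bij_betw_def)
  \<comment> \<open>Since \<open>vs\<close> is distinct, every vector on the indices below
    \<open>n\<close> comes from a vector on vertices; only these values enter
    \<open>P\<close>.\<close>
  have ext: "(\<forall>x :: _ \<Rightarrow> real. P (\<lambda>r. x (vs ! r))) \<longleftrightarrow> (\<forall>x. P x)"
    if P: "\<And>x y. (\<And>r. r < n \<Longrightarrow> x r = y r) \<Longrightarrow> P x = P y" for P
  proof
    assume a: "\<forall>x :: _ \<Rightarrow> real. P (\<lambda>r. x (vs ! r))"
    show "\<forall>x. P x"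
    proof
      fix x have "P (\<lambda>r. x (idx (vs ! r)))" using a by auto
      moreover have "P (\<lambda>r. x (idx (vs ! r))) = P x" by (rule P) (simp add: idx)
      ultimately show "P x" by simp
    qed
  qed auto
  have "eigenvalues_desc ?A ! 2 \<le> - 1 \<longleftrightarrow> (\<exists>p::nat \<Rightarrow> nat \<Rightarrow> real. \<forall>x.
    (\<forall>j<2. (\<Sum>r<n. p j r * x r) = 0) \<longrightarrow>
      (\<Sum>r<n. \<Sum>s<n. ?A $$ (r, s) * x r * x s) \<le> - 1 * (\<Sum>r<n. (x r)\<^sup>2))"
    by (rule kth_eigenvalue_le_iff[OF u]) (use n ev(3) in auto)
  also have "\<dots> \<longleftrightarrow> (\<exists>p::nat \<Rightarrow> nat \<Rightarrow> real. \<forall>x :: _ \<Rightarrow> real.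
    (\<forall>j<2::nat. (\<Sum>r<n. p j r * x (vs ! r)) = 0) \<longrightarrow>
      (\<Sum>r<n. \<Sum>s<n. ?A $$ (r, s) * x (vs ! r) * x (vs ! s)) \<le> - 1 * (\<Sum>r<n. (x (vs ! r))\<^sup>2))"
    by (intro ex_cong1 ext[symmetric, where P = "\<lambda>x. (\<forall>j<2. (\<Sum>r<n. _ j r * x r) = 0) \<longrightarrow>
      (\<Sum>r<n. \<Sum>s<n. ?A $$ (r, s) * x r * x s) \<le> - 1 * (\<Sum>r<n. (x r)\<^sup>2)"]) simp
  also have "\<dots> \<longleftrightarrow> lam3_cond (set vs) (gdist G)"
    unfolding form lam3_cond_def
  proof safe
    fix p :: "nat \<Rightarrow> nat \<Rightarrow> real"
    assume a: "\<forall>x. (\<forall>j<2::nat. (\<Sum>r<n. p j r * x (vs ! r)) = 0) \<longrightarrow>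
      qform (set vs) (gdist G) x \<le> - 1 * (\<Sum>r<n. (x (vs ! r))\<^sup>2)"
    show "\<exists>p q. \<forall>x. (\<Sum>v\<in>set vs. p v * x v) = 0 \<longrightarrow> (\<Sum>v\<in>set vs. q v * x v) = 0 \<longrightarrow>
      qform (set vs) (gdist G) x + (\<Sum>v\<in>set vs. (x v)\<^sup>2) \<le> 0"
    proof (rule exI[of _ "\<lambda>v. p 0 (idx v)"], rule exI[of _ "\<lambda>v. p 1 (idx v)"], intro allI impI)
      fix x :: "_ \<Rightarrow> real"
      assume "(\<Sum>v\<in>set vs. p 0 (idx v) * x v) = 0" "(\<Sum>v\<in>set vs. p 1 (idx v) * x v) = 0"
      hence "\<forall>j<2. (\<Sum>r<n. p j r * x (vs ! r)) = 0"
        by (auto simp: sumV idx less_2_cases_iff)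
      thus "qform (set vs) (gdist G) x + (\<Sum>v\<in>set vs. (x v)\<^sup>2) \<le> 0"
        using a[rule_format, of x] by (simp add: sumV)
    qed
  next
    fix p q :: "_ \<Rightarrow> real"
    assume a: "\<forall>x. (\<Sum>v\<in>set vs. p v * x v) = 0 \<longrightarrow> (\<Sum>v\<in>set vs. q v * x v) = 0 \<longrightarrow>
      qform (set vs) (gdist G) x + (\<Sum>v\<in>set vs. (x v)\<^sup>2) \<le> 0"
    show "\<exists>p. \<forall>x. (\<forall>j<2::nat. (\<Sum>r<n. p j r * x (vs ! r)) = 0) \<longrightarrow>
      qform (set vs) (gdist G) x \<le> - 1 * (\<Sum>r<n. (x (vs ! r))\<^sup>2)"
    proof (rule exI[of _ "\<lambda>j r. if j = 0 then p (vs ! r) else q (vs ! r)"], intro allI impI)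
      fix x :: "_ \<Rightarrow> real"
      assume b: "\<forall>j<2::nat. (\<Sum>r<n. (if j = 0 then p (vs ! r) else q (vs ! r)) * x (vs ! r)) = 0"
      show "qform (set vs) (gdist G) x \<le> - 1 * (\<Sum>r<n. (x (vs ! r))\<^sup>2)"
        using a[rule_format, of x] b[rule_format, of 0] b[rule_format, of 1] by (simp add: sumV)
    qed
  qed
  finally show "dist_eigenvalue G vs 3 \<le> - 1 \<longleftrightarrow> lam3_cond (set vs) (gdist G)"
    by (simp add: dist_eigenvalue_def)
  have "- 2 \<le> eigenvalues_desc ?A ! (n - Suc 1) \<longleftrightarrow> (\<exists>p::nat \<Rightarrow> nat \<Rightarrow> real. \<forall>x.
    (\<forall>j<1. (\<Sum>r<n. p j r * x r) = 0) \<longrightarrow>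
      - 2 * (\<Sum>r<n. (x r)\<^sup>2) \<le> (\<Sum>r<n. \<Sum>s<n. ?A $$ (r, s) * x r * x s))"
    by (rule kth_eigenvalue_ge_iff[OF u]) (use n ev(3) in auto)
  also have "\<dots> \<longleftrightarrow> (\<exists>p::nat \<Rightarrow> nat \<Rightarrow> real. \<forall>x :: _ \<Rightarrow> real.
    (\<forall>j<1::nat. (\<Sum>r<n. p j r * x (vs ! r)) = 0) \<longrightarrow>
      - 2 * (\<Sum>r<n. (x (vs ! r))\<^sup>2) \<le> (\<Sum>r<n. \<Sum>s<n. ?A $$ (r, s) * x (vs ! r) * x (vs ! s)))"
    by (intro ex_cong1 ext[symmetric, where P = "\<lambda>x. (\<forall>j<1. (\<Sum>r<n. _ j r * x r) = 0) \<longrightarrow>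
      - 2 * (\<Sum>r<n. (x r)\<^sup>2) \<le> (\<Sum>r<n. \<Sum>s<n. ?A $$ (r, s) * x r * x s)"]) simp
  also have "\<dots> \<longleftrightarrow> lam_penult_cond (set vs) (gdist G)"
    unfolding form lam_penult_cond_def
  proof safe
    fix p :: "nat \<Rightarrow> nat \<Rightarrow> real"
    assume a: "\<forall>x. (\<forall>j<1::nat. (\<Sum>r<n. p j r * x (vs ! r)) = 0) \<longrightarrow>
      - 2 * (\<Sum>r<n. (x (vs ! r))\<^sup>2) \<le> qform (set vs) (gdist G) x"
    show "\<exists>p. \<forall>x. (\<Sum>v\<in>set vs. p v * x v) = 0 \<longrightarrow>
      0 \<le> qform (set vs) (gdist G) x + 2 * (\<Sum>v\<in>set vs. (x v)\<^sup>2)"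
    proof (rule exI[of _ "\<lambda>v. p 0 (idx v)"], intro allI impI)
      fix x :: "_ \<Rightarrow> real"
      assume "(\<Sum>v\<in>set vs. p 0 (idx v) * x v) = 0"
      hence "\<forall>j<1. (\<Sum>r<n. p j r * x (vs ! r)) = 0" by (simp add: sumV idx)
      thus "0 \<le> qform (set vs) (gdist G) x + 2 * (\<Sum>v\<in>set vs. (x v)\<^sup>2)"
        using a[rule_format, of x] by (simp add: sumV)
    qed
  next
    fix p :: "_ \<Rightarrow> real"
    assume a: "\<forall>x. (\<Sum>v\<in>set vs. p v * x v) = 0 \<longrightarrow>
      0 \<le> qform (set vs) (gdist G) x + 2 * (\<Sum>v\<in>set vs. (x v)\<^sup>2)"
    show "\<exists>p. \<forall>x. (\<forall>j<1::nat. (\<Sum>r<n. p j r * x (vs ! r)) = 0) \<longrightarrow>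
      - 2 * (\<Sum>r<n. (x (vs ! r))\<^sup>2) \<le> qform (set vs) (gdist G) x"
    proof (rule exI[of _ "\<lambda>j r. p (vs ! r)"], intro allI impI)
      fix x :: "_ \<Rightarrow> real"
      assume b: "\<forall>j<1::nat. (\<Sum>r<n. p (vs ! r) * x (vs ! r)) = 0"
      show "- 2 * (\<Sum>r<n. (x (vs ! r))\<^sup>2) \<le> qform (set vs) (gdist G) x"
        using a[rule_format, of x] b[rule_format, of 0] by (simp add: sumV)
    qed
  qed
  finally show "dist_eigenvalue G vs (n - 1) \<ge> - 2 \<longleftrightarrow> lam_penult_cond (set vs) (gdist G)"
    by (simp add: dist_eigenvalue_def numeral_2_eq_2 diff_diff_eq)
qed

section \<open>Forbidden submatrices\<close>

text \<open>The polarized form of the distance matrix plus \<open>t\<close> times the identity.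
  Mixed values are needed because subspaces are tested through Gram matrices.\<close>

definition shifted_form :: "real \<Rightarrow> 'a set \<Rightarrow> ('a \<Rightarrow> 'a \<Rightarrow> nat) \<Rightarrow> ('a \<Rightarrow> real) \<Rightarrow> ('a \<Rightarrow> real) \<Rightarrow> real" where
  "shifted_form t V d x y = (\<Sum>u\<in>V. \<Sum>v\<in>V. real (d u v) * x u * y v) + t * (\<Sum>v\<in>V. x v * y v)"

lemma shifted_form_add_left:
  "shifted_form t V d (\<lambda>v. x v + y v) z = shifted_form t V d x z + shifted_form t V d y z"
  by (simp add: shifted_form_def algebra_simps sum.distrib)

lemma shifted_form_add_right:
  "shifted_form t V d z (\<lambda>v. x v + y v) = shifted_form t V d z x + shifted_form t V d z y"
  by (simp add: shifted_form_def algebra_simps sum.distrib)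

lemma shifted_form_scale_left: "shifted_form t V d (\<lambda>v. a * x v) z = a * shifted_form t V d x z"
  by (simp add: shifted_form_def algebra_simps sum_distrib_left)

lemma shifted_form_scale_right: "shifted_form t V d z (\<lambda>v. a * x v) = a * shifted_form t V d z x"
  by (simp add: shifted_form_def algebra_simps sum_distrib_left)

lemmas shifted_form_bilinear = shifted_form_add_left shifted_form_add_right
  shifted_form_scale_left shifted_form_scale_right

lemma shifted_form_commute:
  assumes "\<And>u v. u \<in> V \<Longrightarrow> v \<in> V \<Longrightarrow> d u v = d v u"
  shows "shifted_form t V d x y = shifted_form t V d y x"
proof -
  have "(\<Sum>u\<in>V. \<Sum>v\<in>V. real (d u v) * x u * y v) = (\<Sum>v\<in>V. \<Sum>u\<in>V. real (d u v) * x u * y v)"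
    by (rule sum.swap)
  also have "\<dots> = (\<Sum>v\<in>V. \<Sum>u\<in>V. real (d v u) * y v * x u)"
    by (intro sum.cong refl) (simp add: assms)
  finally show ?thesis by (simp add: shifted_form_def mult.commute)
qed

lemma lam3_cond_iff: "lam3_cond V d \<longleftrightarrow> (\<exists>p q. \<forall>x. (\<Sum>v\<in>V. p v * x v) = 0 \<longrightarrow>
    (\<Sum>v\<in>V. q v * x v) = 0 \<longrightarrow> shifted_form 1 V d x x \<le> 0)"
  by (simp add: lam3_cond_def shifted_form_def qform_def power2_eq_square)

lemma lam_penult_cond_iff: "lam_penult_cond V d \<longleftrightarrow> (\<exists>p. \<forall>x. (\<Sum>v\<in>V. p v * x v) = 0 \<longrightarrow>
    shifted_form 2 V d x x \<ge> 0)"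
  by (simp add: lam_penult_cond_def shifted_form_def qform_def power2_eq_square)

text \<open>Sylvester's criterion with denominators cleared: \<open>g11 * m2\<close> times the form
  is a combination of three squares whose coefficients are positive by the leading minors.\<close>

lemma pos_def3:
  fixes a b c :: real
  assumes "g11 > 0" "g11 * g22 - g12 * g12 > 0"
    and "g11 * (g22 * g33 - g23 * g23) - g12 * (g12 * g33 - g23 * g13) + g13 * (g12 * g23 - g22 * g13) > 0"
    and "a \<noteq> 0 \<or> b \<noteq> 0 \<or> c \<noteq> 0"
  shows "g11 * a\<^sup>2 + g22 * b\<^sup>2 + g33 * c\<^sup>2 + 2 * g12 * a * b + 2 * g13 * a * c + 2 * g23 * b * c > 0"
    (is "?Q > 0")
proof -
  define m2 where "m2 = g11 * g22 - g12 * g12"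
  define m3 where "m3 = g11 * (g22 * g33 - g23 * g23) - g12 * (g12 * g33 - g23 * g13)
    + g13 * (g12 * g23 - g22 * g13)"
  have pos: "m2 > 0" "m3 > 0" using assms by (auto simp: m2_def m3_def)
  let ?L1 = "g11 * a + g12 * b + g13 * c" and ?L2 = "m2 * b + (g11 * g23 - g12 * g13) * c"
  have id: "g11 * m2 * ?Q = m2 * ?L1\<^sup>2 + ?L2\<^sup>2 + g11 * m3 * c\<^sup>2"
    unfolding m2_def m3_def by (simp add: power2_eq_square algebra_simps)
  have "m2 * ?L1\<^sup>2 + ?L2\<^sup>2 + g11 * m3 * c\<^sup>2 > 0"
  proof (cases "c = 0")
    case False
    hence "g11 * m3 * c\<^sup>2 > 0" using pos assms(1) by simp
    thus ?thesis using pos by (simp add: add_nonneg_pos)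
  next
    case c: True
    show ?thesis
    proof (cases "b = 0")
      case False
      hence "?L2\<^sup>2 > 0" using pos c by simp
      thus ?thesis using pos c by (simp add: add_nonneg_pos)
    qed (use c assms pos in simp)
  qed
  hence "g11 * m2 * ?Q > 0" by (simp only: id)
  moreover have "g11 * m2 > 0" using assms(1) pos by simp
  ultimately show ?thesis by (rule zero_less_mult_pos)
qed

text \<open>Some nontrivial combination of \<open>x\<close>, \<open>y\<close>, \<open>z\<close> lies
  in the kernel of both functionals, and the positive definite Gram matrix makes the form positive
  on it. Linear independence is contained in the definiteness.\<close>

lemma not_lam3_condI:
  assumes sym: "\<And>u v. u \<in> V \<Longrightarrow> v \<in> V \<Longrightarrow> d u v = d v u"
    and "shifted_form 1 V d x x = g11" "shifted_form 1 V d x y = g12" "shifted_form 1 V d x z = g13"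
      "shifted_form 1 V d y y = g22" "shifted_form 1 V d y z = g23" "shifted_form 1 V d z z = g33"
    and "g11 > 0" "g11 * g22 - g12 * g12 > 0"
      "g11 * (g22 * g33 - g23 * g23) - g12 * (g12 * g33 - g23 * g13) + g13 * (g12 * g23 - g22 * g13) > 0"
  shows "\<not> lam3_cond V d"
proof
  assume "lam3_cond V d"
  have comm: "shifted_form 1 V d f g = shifted_form 1 V d g f" for f g
    by (rule shifted_form_commute) (rule sym)
  from \<open>lam3_cond V d\<close> obtain p q where pq: "\<And>x. (\<Sum>v\<in>V. p v * x v) = 0 \<Longrightarrow> (\<Sum>v\<in>V. q v * x v) = 0 \<Longrightarrow>
    shifted_form 1 V d x x \<le> 0" unfolding lam3_cond_iff by blast
  define P where "P j f = (\<Sum>v\<in>V. (if j = (0::nat) then p v else q v) * f v)" for j and f :: "'a \<Rightarrow> real"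
  obtain t i where t: "i \<le> (2::nat)" "t i \<noteq> (0::real)"
    "\<And>j. j < 2 \<Longrightarrow> (\<Sum>i\<le>2. P j (if i = 0 then x else if i = 1 then y else z) * t i) = 0"
    by (rule homogeneous_system_nontrivial[of 2
        "\<lambda>j i. P j (if i = 0 then x else if i = 1 then y else z)"]) (rule that)
  define w where "w v = t 0 * x v + (t 1 * y v + t 2 * z v)" for v
  have Pw: "P j w = t 0 * P j x + t 1 * P j y + t 2 * P j z" for j
    by (simp add: P_def w_def algebra_simps sum.distrib sum_distrib_left)
  have "P 0 w = 0" "P 1 w = 0"
    using t(3)[of 0] t(3)[of 1] unfolding Pw by (auto simp: numeral_2_eq_2 algebra_simps)
  hence "shifted_form 1 V d w w \<le> 0" by (intro pq) (simp_all add: P_def)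
  moreover have "shifted_form 1 V d w w = g11 * (t 0)\<^sup>2 + g22 * (t 1)\<^sup>2 + g33 * (t 2)\<^sup>2
      + 2 * g12 * t 0 * t 1 + 2 * g13 * t 0 * t 2 + 2 * g23 * t 1 * t 2"
    unfolding w_def shifted_form_bilinear
      comm[of y x] comm[of z x] comm[of z y] assms(2-7)
    by (simp add: power2_eq_square algebra_simps)
  moreover have "t 0 \<noteq> 0 \<or> t 1 \<noteq> 0 \<or> t 2 \<noteq> 0"
    using t(1,2) by (auto simp: numeral_2_eq_2 le_Suc_eq)
  ultimately show False using pos_def3[OF assms(8-10), of "t 0" "t 1" "t 2"] by linarith
qed

text \<open>The dimension count for one functional and a two-dimensional space on which the form is
  negative.\<close>

lemma not_lam_penult_condI:
  assumes sym: "\<And>u v. u \<in> V \<Longrightarrow> v \<in> V \<Longrightarrow> d u v = d v u"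
    and "shifted_form 2 V d x x = g11" "shifted_form 2 V d x y = g12" "shifted_form 2 V d y y = g22"
    and neg: "g11 < 0" "g11 * g22 - g12 * g12 > 0"
  shows "\<not> lam_penult_cond V d"
proof
  assume "lam_penult_cond V d"
  have comm: "shifted_form 2 V d y x = shifted_form 2 V d x y"
    by (rule shifted_form_commute) (rule sym)
  from \<open>lam_penult_cond V d\<close> obtain p where p: "\<And>x. (\<Sum>v\<in>V. p v * x v) = 0 \<Longrightarrow> shifted_form 2 V d x x \<ge> 0"
    unfolding lam_penult_cond_iff by blast
  define P where "P f = (\<Sum>v\<in>V. p v * f v)" for f :: "'a \<Rightarrow> real"
  obtain t i where t: "i \<le> (1::nat)" "t i \<noteq> (0::real)"
    "\<And>j. j < (1::nat) \<Longrightarrow> (\<Sum>i\<le>1. P (if i = 0 then x else y) * t i) = 0"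
    by (rule homogeneous_system_nontrivial[of 1 "\<lambda>j i. P (if i = 0 then x else y)"]) (erule that, assumption, blast)
  define w where "w v = t 0 * x v + t 1 * y v" for v
  have Pw: "P w = t 0 * P x + t 1 * P y"
    by (simp add: P_def w_def algebra_simps sum.distrib sum_distrib_left)
  have "P w = 0" using t(3)[of 0] unfolding Pw by (simp add: algebra_simps)
  hence "shifted_form 2 V d w w \<ge> 0" by (intro p) (simp add: P_def)
  moreover have "shifted_form 2 V d w w = g11 * (t 0)\<^sup>2 + 2 * g12 * t 0 * t 1 + g22 * (t 1)\<^sup>2"
    unfolding w_def shifted_form_bilinear
      comm assms(2-4)
    by (simp add: power2_eq_square algebra_simps)
  \<comment> \<open>Multiplication by \<open>g11 < 0\<close> turns the form into a square plus a
    positive multiple of \<open>(t 1)\<^sup>2\<close>.\<close>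
  ultimately have "g11 * (g11 * (t 0)\<^sup>2 + 2 * g12 * t 0 * t 1 + g22 * (t 1)\<^sup>2) \<le> 0"
    using neg by (simp add: mult_le_0_iff)
  hence le: "(g11 * t 0 + g12 * t 1)\<^sup>2 + (g11 * g22 - g12 * g12) * (t 1)\<^sup>2 \<le> 0"
    by (simp add: power2_eq_square algebra_simps)
  have "(g11 * g22 - g12 * g12) * (t 1)\<^sup>2 \<ge> 0" using neg by simp
  with le have "(g11 * g22 - g12 * g12) * (t 1)\<^sup>2 = 0" "(g11 * t 0 + g12 * t 1)\<^sup>2 = 0"
    using zero_le_power2[of "g11 * t 0 + g12 * t 1"] by linarith+
  hence "t 1 = 0" "t 0 = 0" using neg by auto
  thus False using t(1,2) by (cases i) auto
qed

section \<open>Integer certificates for forbidden distance tables\<close>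

definition dot :: "int list \<Rightarrow> int list \<Rightarrow> int" where
  "dot x y = sum_list (map2 (*) x y)"

text \<open>The value of the shifted form on integer coordinate vectors; staying in the integers
  lets all finite checks run by evaluation.\<close>

definition gram :: "int \<Rightarrow> int list list \<Rightarrow> int list \<Rightarrow> int list \<Rightarrow> int" where
  "gram t M x y = dot x (map (\<lambda>r. dot r y) M) + t * dot x y"

text \<open>
  A certificate is a list of integer vectors: three vectors span a space on which the matrix plus the
  identity is positive definite, two vectors one on which the matrix plus twice the identity is
  negative definite; both are checked by leading principal minors.
\<close>

fun refutes :: "int list list \<Rightarrow> int list list \<Rightarrow> bool" where
  "refutes M [x, y, z] \<longleftrightarrow> length x = length M \<and> length y = length M \<and> length z = length M \<and>
    (let g11 = gram 1 M x x; g12 = gram 1 M x y; g13 = gram 1 M x z;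
         g22 = gram 1 M y y; g23 = gram 1 M y z; g33 = gram 1 M z z
     in g11 > 0 \<and> g11 * g22 - g12 * g12 > 0 \<and>
       g11 * (g22 * g33 - g23 * g23) - g12 * (g12 * g33 - g23 * g13) + g13 * (g12 * g23 - g22 * g13) > 0)"
| "refutes M [x, y] \<longleftrightarrow> length x = length M \<and> length y = length M \<and>
    (let g11 = gram 2 M x x; g12 = gram 2 M x y; g22 = gram 2 M y y
     in g11 < 0 \<and> g11 * g22 - g12 * g12 > 0)"
| "refutes M _ \<longleftrightarrow> False"

definition dist_table :: "('a \<Rightarrow> 'a \<Rightarrow> nat) \<Rightarrow> 'a list \<Rightarrow> int list list" where
  "dist_table d ws = map (\<lambda>u. map (\<lambda>v. int (d u v)) ws) ws"

lemma dot_sum: "length x = length y \<Longrightarrow> dot x y = (\<Sum>i<length x. x ! i * y ! i)"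
  by (simp add: dot_def sum_list_sum_nth atLeast0LessThan)

text \<open>Coordinate vectors on the listed vertices are extended by zero to \<open>V\<close>
  without changing the form. This is the passage to principal submatrices.\<close>

lemma shifted_form_lift:
  assumes V: "finite V" and ws: "distinct ws" "set ws \<subseteq> V"
    and len: "length x = length ws" "length y = length ws"
  defines "lift \<equiv> \<lambda>c v. \<Sum>i<length ws. if ws ! i = v then real_of_int (c ! i) else 0"
  shows "shifted_form (of_int t) V d (lift x) (lift y) = of_int (gram t (dist_table d ws) x y)"
proof -
  let ?m = "length ws"
  have bij: "bij_betw ((!) ws) {..<?m} (set ws)" using ws by (auto intro: bij_betw_nth)
  have out: "lift c v = 0" if "v \<notin> set ws" for c v
    using that unfolding lift_def by (intro sum.neutral) auto
  have lift: "lift c (ws ! i) = c ! i" if "i < ?m" for c i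
  proof -
    have "lift c (ws ! i) = (\<Sum>j<?m. if j = i then real_of_int (c ! j) else 0)"
      unfolding lift_def using ws that by (intro sum.cong refl if_cong) (auto simp: nth_eq_iff_index_eq)
    thus ?thesis using that by simp
  qed
  have sumV: "(\<Sum>v\<in>V. g v * lift c v) = (\<Sum>i<?m. g (ws ! i) * c ! i)" for g c
  proof -
    have "(\<Sum>v\<in>V. g v * lift c v) = (\<Sum>v\<in>set ws. g v * lift c v)"
      using V ws out by (intro sum.mono_neutral_right) auto
    also have "\<dots> = (\<Sum>i<?m. g (ws ! i) * lift c (ws ! i))"
      by (rule sum.reindex_bij_betw[OF bij, symmetric])
    finally show ?thesis by (simp add: lift)
  qed
  have "(\<Sum>u\<in>V. \<Sum>v\<in>V. real (d u v) * lift x u * lift y v)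
      = (\<Sum>u\<in>V. (\<Sum>v\<in>V. real (d u v) * lift y v) * lift x u)"
    by (simp add: sum_distrib_left sum_distrib_right mult_ac)
  also have "\<dots> = (\<Sum>i<?m. (\<Sum>j<?m. real (d (ws ! i) (ws ! j)) * y ! j) * x ! i)"
    by (simp add: sumV)
  also have "\<dots> = of_int (dot x (map (\<lambda>r. dot r y) (dist_table d ws)))"
    by (simp add: dist_table_def dot_sum len mult.commute)
  finally have 1: "(\<Sum>u\<in>V. \<Sum>v\<in>V. real (d u v) * lift x u * lift y v) = \<dots>" .
  have "(\<Sum>v\<in>V. lift x v * lift y v) = of_int (dot x y)"
    by (simp add: sumV dot_sum len lift)
  thus ?thesis by (simp add: shifted_form_def 1 gram_def)
qed

text \<open>A space of definite sign found on a few vertices lifts, by extension by zero, to one on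
  all of \<open>V\<close> and contradicts the corresponding condition.\<close>

lemma refutes_sound:
  assumes V: "finite V" and sym: "\<And>u v. u \<in> V \<Longrightarrow> v \<in> V \<Longrightarrow> d u v = d v u"
    and ok: "lam3_cond V d" "lam_penult_cond V d" and ws: "distinct ws" "set ws \<subseteq> V"
  shows "\<not> refutes (dist_table d ws) cs"
proof
  let ?M = "dist_table d ws"
  define lift where "lift c v = (\<Sum>i<length ws. if ws ! i = v then real_of_int (c ! i) else 0)" for c v
  have len: "length ?M = length ws" by (simp add: dist_table_def)
  note lift = shifted_form_lift[OF V ws, folded lift_def]
  assume "refutes ?M cs"
  then consider x y z where "cs = [x, y, z]" "refutes ?M [x, y, z]"
    | x y where "cs = [x, y]" "refutes ?M [x, y]"
    by (cases "(?M, cs)" rule: refutes.cases) auto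
  thus False
  proof cases
    case 1
    have "\<not> lam3_cond V d"
      by (rule not_lam3_condI[of V d "lift x" _ "lift y" _ "lift z"],
          erule (1) sym, (rule lift[of _ _ 1, simplified]; use 1 len in \<open>simp add: Let_def\<close>)+)
        (use 1(2) in \<open>simp_all add: Let_def flip: of_int_mult of_int_diff of_int_add\<close>)
    thus False using ok by simp
  next
    case 2
    have "\<not> lam_penult_cond V d"
      by (rule not_lam_penult_condI[of V d "lift x" _ "lift y"],
          erule (1) sym, (rule lift[of _ _ 2, simplified]; use 2 len in \<open>simp add: Let_def\<close>)+)
        (use 2(2) in \<open>simp_all add: Let_def flip: of_int_mult of_int_diff of_int_add\<close>)
    thus False using ok by simp
  qed
qed

section \<open>Certificates and distance tables for the three base configurations\<close>

definition path_certs5 :: "int list list list" where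
  "path_certs5 = [
    [[1, 1, 0, - 1, - 1], [1, 0, - 1, - 1, 1]],
    [[0, 1, - 1, 1, 0], [1, - 1, 0, 1, 0], [0, 1, 1, 1, 1]],
    [[1, 0, 0, 1, 0], [0, 1, 1, 0, - 1], [0, 1, - 1, 1, 0]]]"

text \<open>Coordinates follow the order in which the vertices are listed: the base vertices, then
  the further ones. A certificate is not tied to one table; a table is refuted as soon as one member
  of the list works for it.\<close>

definition path_certs6 :: "int list list list" where
  "path_certs6 = [
    [[- 1, 0, 0, 1, 1, - 1], [1, 1, - 1, - 1, 1, - 1]],
    [[0, 0, 0, 1, - 1, - 1], [1, 0, 0, 1, 1, 0], [1, - 1, 1, 0, 0, 0]],
    [[0, 1, - 1, 0, 0, 1], [1, 0, 0, 0, 1, 1], [0, 1, 0, 1, 1, - 1]],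
    [[0, 1, - 1, 1, 0, 0], [1, 0, 1, 0, - 1, 0], [0, 0, 1, 1, 1, 1]],
    [[0, 0, 1, 0, - 1, 1], [0, 1, - 1, 1, 0, 0], [1, - 1, 0, 1, 0, 0]],
    [[0, 1, 0, 0, 1, 0], [0, 0, 1, - 1, 0, - 1], [1, 0, 1, 0, 1, 0]],
    [[- 1, 0, 0, 1, 0, 0], [1, 0, 0, 1, - 1, - 1]],
    [[- 1, - 1, 0, 0, 1, 1], [0, - 1, 0, 1, - 1, 1]],
    [[1, - 1, - 1, - 1, 1, 0], [1, 1, - 1, - 1, - 1, 1]],
    [[0, 1, - 1, 0, - 1, 0], [1, 0, 0, 0, - 1, 1], [0, 1, 0, 1, 1, 1]],
    [[1, 1, - 1, - 1, - 1, 1], [1, 1, - 1, 0, 0, - 1]],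
    [[1, 1, 1, - 1, - 1, - 1], [1, 0, - 1, - 1, 0, 1]],
    [[- 1, 1, 0, 1, - 1, - 1], [1, 1, 0, - 1, - 1, 0]],
    [[1, 1, - 1, - 1, 0, 1], [1, 0, - 1, 0, 1, - 1]],
    [[0, 1, 0, 0, 0, 1], [0, 0, 1, 1, 0, - 1], [0, 1, - 1, 0, - 1, 0]],
    [[- 1, 0, 0, 1, 1, - 1], [1, 0, 1, - 1, 0, - 1]],
    [[0, 0, 0, 1, 1, 1], [0, 1, 0, 0, - 1, 1], [1, 0, 1, 1, 0, 0]],
    [[1, 0, - 1, 0, - 1, 1], [0, 1, - 1, - 1, 1, 1]]]"

definition paw_certs5 :: "int list list list" where
  "paw_certs5 = [
    [[1, 0, 0, 0, 1], [0, 1, 0, 1, 1], [0, 1, - 1, 0, - 1]],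
    [[1, 0, 0, 0, 1], [0, 0, 1, 1, 1], [0, 1, - 1, 0, 1]],
    [[0, 1, 1, - 2, 0], [1, 0, 0, 1, - 2]]]"

definition paw_certs6 :: "int list list list" where
  "paw_certs6 = [
    [[1, 0, 0, 0, 1, 0], [0, 1, 1, 1, 0, 0], [1, 0, 0, 0, - 1, - 1]],
    [[1, 0, 0, 0, 1, 0], [0, 0, 0, 1, 1, - 1], [0, 0, 1, 0, 1, 1]],
    [[0, 0, 1, 1, 0, 0], [1, 0, 0, 0, 1, 0], [0, 0, 0, 1, - 1, 1]],
    [[1, 0, 0, 0, - 2, 1], [0, 1, 1, - 2, - 1, 1]],
    [[1, 0, 0, 0, 1, 0], [0, 0, 0, 1, - 1, - 1], [0, 0, 1, 1, 1, 0]],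
    [[0, 1, 2, - 2, 0, 0], [2, 0, 0, 0, - 1, - 2]],
    [[0, 0, 0, 0, 0, 1], [0, 0, 1, 1, 0, 0], [1, 0, 0, 0, 1, 0]],
    [[0, 1, 1, 0, 0, 1], [1, 0, 0, - 1, 1, 0], [1, 0, - 1, 0, - 1, 0]],
    [[0, 0, 0, 2, - 1, - 1], [0, 1, 1, - 1, 0, - 1]],
    [[0, 1, 1, - 2, 0, 0], [1, 0, 0, 0, 1, - 2]],
    [[0, 0, 0, 1, 1, - 2], [0, 1, 1, - 1, - 1, 0]],
    [[0, 0, 0, 1, - 2, 1], [0, 1, 1, - 1, - 1, 0]]]"

definition cherry_certs5 :: "int list list list" where
  "cherry_certs5 = [
    [[0, 0, 0, 1, 0], [1, 0, 0, 0, 1], [0, 1, 1, 0, 1]],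
    [[0, 1, 1, 0, 0], [1, 0, 0, 0, 1], [0, 0, 1, - 1, 1]],
    [[0, 1, 1, 0, 0], [1, 0, 0, 0, 1], [0, 0, 1, 1, - 1]],
    [[1, 0, 1, - 1, - 1], [0, 2, - 2, 1, - 1]],
    [[1, 0, 0, 0, 0], [0, 0, 0, 1, 1], [0, 1, 1, 0, 1]]]"

text \<open>\<open>p\<close> holds the distances from a new last vertex to the earlier ones; by
  symmetry it fills both the last column and the last row.\<close>

definition extend_table :: "int list list \<Rightarrow> int list \<Rightarrow> int list list" where
  "extend_table M p = map2 (\<lambda>r x. r @ [x]) M p @ [p @ [0]]"

definition triangle_ok :: "int list list \<Rightarrow> int list \<Rightarrow> bool" where
  "triangle_ok M p \<longleftrightarrow> list_all2 (\<lambda>x r. list_all2 (\<lambda>y m. x \<le> y + m \<and> m \<le> x + y) p r) p M"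

text \<open>A profile that violates the triangle inequality cannot occur, so it is discarded without
  a certificate.\<close>

definition excluded :: "int list list list \<Rightarrow> int list list \<Rightarrow> int list \<Rightarrow> bool" where
  "excluded cs M p \<longleftrightarrow> \<not> triangle_ok M p \<or> list_ex (refutes (extend_table M p)) cs"

definition path_table :: "int list list" where
  "path_table = [[0, 1, 2, 3], [1, 0, 1, 2], [2, 1, 0, 1], [3, 2, 1, 0]]"

text \<open>The profile of a twin of base vertex \<open>i\<close>: the distances to the other base
  vertices agree, and \<open>t\<close> tells adjacent twins (1) from nonadjacent ones (2). These two
  types become clique blocks and edgeless blocks.\<close>

definition path_profile :: "int \<Rightarrow> int \<Rightarrow> int list" where
  "path_profile i t = map (\<lambda>j. if j = i then t else \<bar>i - j\<bar>) [0, 1, 2, 3]"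

definition path_positions :: "(int \<times> int) list" where
  "path_positions = [(0, 1), (0, 2), (1, 1), (1, 2), (2, 1), (2, 2), (3, 1), (3, 2)]"

lemma path_table_step1:
  "list_all (\<lambda>p. p \<in> set ([2, 1, 2, 2] # [2, 2, 1, 2] # map (\<lambda>(i, t). path_profile i t) path_positions) \<or>
     excluded path_certs5 path_table p) (product_lists (replicate 4 [1, 2, 3]))"
  by code_simp

text \<open>Twins of the same base vertex have the same type, and this type is their mutual
  distance, so a block is homogeneous. Twins of different base vertices inherit the distance of
  these. The restriction \<open>i \<le> j\<close> uses the symmetry of the pair.\<close>

lemma path_table_step2:
  "list_all (\<lambda>(i, t). list_all (\<lambda>(j, s). i \<le> j \<longrightarrow> list_all (\<lambda>m.
     (if i = j then t = s \<and> m = t else m = j - i) \<or>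
     excluded path_certs6 (extend_table path_table (path_profile i t)) (path_profile j s @ [m]))
     [1, 2, 3]) path_positions) path_positions"
  by code_simp

text \<open>Among the profiles surviving the five-vertex test, the listed ones have entry 1 at one
  end of the path, the last entry in the first claim and the first entry in the second. They are the
  candidates for a common neighbour of an exceptional vertex and that end.\<close>

lemma path_table_no_second_neighbour:
  "list_all (\<lambda>p. excluded path_certs6 (extend_table path_table [2, 1, 2, 2]) (p @ [1]))
     [[2, 1, 1, 1], [2, 1, 2, 1], [3, 2, 1, 1]]"
  "list_all (\<lambda>p. excluded path_certs6 (extend_table path_table [2, 2, 1, 2]) (p @ [1]))
     [[1, 1, 1, 2], [1, 2, 1, 2], [1, 1, 2, 3]]"
  by code_simp+

text \<open>Vertex order: the triangle vertex that carries the pendant edge, the two other triangle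
  vertices, the pendant vertex.\<close>

definition paw_table :: "int list list" where
  "paw_table = [[0, 1, 1, 1], [1, 0, 1, 2], [1, 1, 0, 2], [1, 2, 2, 0]]"

definition paw_positions :: "(int \<times> int) list" where
  "paw_positions = [(0, 1), (0, 2), (1, 1), (2, 1), (2, 2)]"

text \<open>Positions are blocks of a join here, not base vertices: the two outer triangle vertices
  share position 1. \<open>paw_positions\<close> admits only \<open>t = 1\<close> there, so this
  block becomes a clique.\<close>

definition paw_profile :: "int \<Rightarrow> int \<Rightarrow> int list" where
  "paw_profile i t = (if i = 0 then [t, 1, 1, 1] else if i = 1 then [1, t, 1, 2] else [1, 2, 2, t])"

definition join_dist :: "int \<Rightarrow> int \<Rightarrow> int" where
  "join_dist i j = (if i = 0 \<or> j = 0 then 1 else 2)"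

text \<open>The two extra profiles are those of a vertex adjacent to just the two outer triangle
  vertices, and of a vertex adjacent to just the pendant vertex.\<close>

lemma paw_table_step1:
  "list_all (\<lambda>p. p \<in> set ([2, 1, 1, 2] # [2, 2, 2, 1] # map (\<lambda>(i, t). paw_profile i t) paw_positions) \<or>
     excluded paw_certs5 paw_table p) (product_lists (replicate 4 [1, 2]))"
  by code_simp

lemma paw_table_step2:
  "list_all (\<lambda>(i, t). list_all (\<lambda>(j, s). i \<le> j \<longrightarrow> list_all (\<lambda>m.
     (if i = j then t = s \<and> m = t else m = join_dist i j) \<or>
     excluded paw_certs6 (extend_table paw_table (paw_profile i t)) (paw_profile j s @ [m]))
     [1, 2]) paw_positions) paw_positions"
  by code_simp

lemma paw_table_no_second_neighbour:
  "list_all (\<lambda>p. excluded paw_certs6 (extend_table paw_table [2, 1, 1, 2]) (p @ [1]))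
     [[1, 1, 1, 1], [1, 2, 2, 1], [2, 1, 1, 1], [2, 2, 2, 1]]"
  "list_all (\<lambda>p. excluded paw_certs6 (extend_table paw_table [2, 2, 2, 1]) (p @ [1]))
     [[1, 1, 1, 1], [1, 1, 1, 2], [2, 1, 1, 1], [2, 1, 1, 2]]"
  by code_simp+

definition cherry_table :: "int list list" where
  "cherry_table = [[0, 1, 1], [1, 0, 2], [1, 2, 0]]"

text \<open>Each triple consists of the profiles of two further vertices, over the order centre,
  leaf, leaf, and their mutual distance. The triples with distance 1 forbid edges, the two with
  distance 2 force them.\<close>

lemma cherry_table_excluded:
  "list_all (\<lambda>(p, q, m). excluded cherry_certs5 (extend_table cherry_table p) (q @ [m]))
     [([1,1,1], [2,2,2], 1), ([2,1,2], [2,2,2], 1), ([1,1,1], [2,1,2], 1), ([2,1,1], [2,1,2], 1),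
      ([2,2,1], [2,1,2], 1), ([1,1,1], [2,2,1], 1), ([2,1,1], [2,2,1], 1), ([2,1,2], [2,2,1], 1),
      ([1,1,1], [2,1,1], 1), ([1,1,1], [1,1,1], 2), ([1,1,1], [1,2,2], 2)]"
  by code_simp

text \<open>The least distance eigenvalue of the pentagon, about -2.62, is double, so two vectors
  suffice.\<close>

lemma cycle5_refuted:
  "refutes [[0,1,2,2,1], [1,0,1,2,2], [2,1,0,1,2], [2,2,1,0,1], [1,2,2,1,0]]
     [[1, 0, -1, -1, 1], [0, 1, 1, -1, -1]]"
  by code_simp

lemma path5_refuted:
  "refutes [[0,1,2,3,4], [1,0,1,2,3], [2,1,0,1,2], [3,2,1,0,1], [4,3,2,1,0]]
     [[1, 0, 0, 0, 1], [0, 1, 0, -1, 1], [0, 1, -1, 1, 0]]"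
  by code_simp

section \<open>Distances and block graphs\<close>

text \<open>The metric axioms together with \<open>dist_between\<close>, which gives an intermediate
  vertex at every distance along a geodesic, are all that the forbidden submatrix argument uses of a
  connected graph.\<close>

locale dist_space =
  fixes V :: "'a set" and d :: "'a \<Rightarrow> 'a \<Rightarrow> nat"
  assumes fin: "finite V"
    and dist_eq_0: "u \<in> V \<Longrightarrow> v \<in> V \<Longrightarrow> d u v = 0 \<longleftrightarrow> u = v"
    and dist_sym: "u \<in> V \<Longrightarrow> v \<in> V \<Longrightarrow> d u v = d v u"
    and dist_tri: "u \<in> V \<Longrightarrow> v \<in> V \<Longrightarrow> w \<in> V \<Longrightarrow> d u w \<le> d u v + d v w"
    and dist_between: "u \<in> V \<Longrightarrow> v \<in> V \<Longrightarrow> k \<le> d u v \<Longrightarrow> \<exists>w\<in>V. d u w = k \<and> d w v = d u v - k"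

section \<open>The path distance of a connected graph\<close>

lemma (in wf_digraph) length_awalk_to_apath:
  assumes "awalk u p v"
  shows "length (awalk_to_apath p) \<le> length p"
  using assms
proof (induct rule: awalk_to_apath_induct)
  case (path p)
  then have "awalk_to_apath p = p" by (auto simp: awalk_to_apath.simps)
  then show ?case by simp
next
  case (decomp p q r s)
  then have "awalk_to_apath p = awalk_to_apath (q @ s)" by (intro step_awalk_to_apath)
  moreover have "length (q @ s) \<le> length p"
    using awalk_cyc_decomp_has_prop[OF decomp(1,3)] decomp(2) by auto
  ultimately show ?case using decomp(4) by simp
qed

text \<open>Walks can be concatenated and reversed freely, paths need not concatenate to paths.
  Removing cycles makes a walk no longer, so both minima agree.\<close>

lemma (in pair_graph) gdist_least_awalk: "gdist G u v = (LEAST k. \<exists>p. awalk u p v \<and> length p = k)"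
  (is "_ = (LEAST k. ?W k)")
proof -
  let ?A = "\<lambda>k. \<exists>p. apath u p v \<and> length p = k"
  have AW: "?W k" if "?A k" for k using that awalkI_apath by blast
  have WA: "\<exists>j\<le>k. ?A j" if "?W k" for k
    using that apath_awalk_to_apath length_awalk_to_apath by blast
  show ?thesis
  proof (cases "\<exists>k. ?W k")
    case True
    then obtain k where "?W k" by blast
    hence W: "?W (LEAST k. ?W k)" by (rule LeastI)
    obtain j where j: "j \<le> (LEAST k. ?W k)" "?A j" using WA[OF W] by blast
    have "(LEAST k. ?A k) = (LEAST k. ?W k)"
    proof (rule Least_equality)
      show "?A (LEAST k. ?W k)"
        using j Least_le[of ?W j] AW by (metis (no_types, lifting) le_antisym)
      show "(LEAST k. ?W k) \<le> i" if "?A i" for i by (rule Least_le) (rule AW[OF that])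
    qed
    thus ?thesis by (simp add: gdist_def)
  next
    case False
    hence "?A = ?W" using AW by blast
    thus ?thesis by (simp add: gdist_def)
  qed
qed

lemma (in pair_graph) awalk_reverse:
  assumes "awalk u p v" shows "\<exists>q. awalk v q u \<and> length q = length p"
  using assms
proof (induction p arbitrary: u)
  case Nil
  thus ?case by (intro exI[of _ "[]"]) (auto simp: awalk_Nil_iff)
next
  case (Cons e p)
  hence e: "e \<in> parcs G" "fst e = u" and p: "awalk (snd e) p v" by (auto simp: awalk_Cons_iff)
  obtain q where q: "awalk v q (snd e)" "length q = length p" using Cons.IH[OF p] by blast
  have "(snd e, fst e) \<in> parcs G" using e(1) sym_arcs by (auto simp: symmetric_def intro: symD)
  hence "awalk (snd e) [(snd e, u)] u" using e by (auto simp: awalk_Cons_iff awalk_Nil_iff arc_fst_in_verts)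
  with q show ?case by (intro exI[of _ "q @ [(snd e, u)]"]) (auto intro: awalk_appendI)
qed

lemma (in pair_graph) gdist_dist_space:
  assumes "Digraph_Component.connected (with_proj G)"
  shows "dist_space (pverts G) (gdist G)"
    and "u \<in> pverts G \<Longrightarrow> v \<in> pverts G \<Longrightarrow> gdist G u v = 1 \<longleftrightarrow> (u, v) \<in> parcs G"
proof -
  define W where "W k u v \<longleftrightarrow> (\<exists>p. awalk u p v \<and> length p = k)" for k u v
  have d: "gdist G u v = (LEAST k. W k u v)" for u v by (simp add: gdist_least_awalk W_def)
  have W0: "W 0 u v \<longleftrightarrow> u = v \<and> u \<in> pverts G" for u v by (auto simp: W_def awalk_Nil_iff)
  have W1: "W 1 u v \<longleftrightarrow> (u, v) \<in> parcs G" for u v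
  proof -
    have "W 1 u v \<longleftrightarrow> (\<exists>e. awalk u [e] v)" by (auto simp: W_def length_Suc_conv)
    also have "\<dots> \<longleftrightarrow> (u, v) \<in> parcs G"
      by (auto simp: awalk_Cons_iff awalk_Nil_iff dest: in_arcsD2)
    finally show ?thesis .
  qed
  have Wtr: "W k u v \<Longrightarrow> W l v w \<Longrightarrow> W (k + l) u w" for k l u v w
    unfolding W_def by (elim exE conjE, rule_tac x = "p @ pa" in exI) (simp add: awalk_appendI)
  \<comment> \<open>Cutting a walk after \<open>k\<close> arcs; applied to a shortest walk this
    yields the vertex at distance \<open>k\<close>.\<close>
  have Wsplit: "\<exists>w\<in>pverts G. W k u w \<and> W l w v" if W: "W (k + l) u v" for k l u v
  proof -
    obtain p where p: "awalk u p v" "length p = k + l" using W by (auto simp: W_def)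
    have "awalk u (take k p @ drop k p) v" using p by simp
    hence a: "awalk u (take k p) (awlast u (take k p))" "awalk (awlast u (take k p)) (drop k p) v"
      unfolding awalk_append_iff by auto
    have "W k u (awlast u (take k p))"
      unfolding W_def by (rule exI[of _ "take k p"], rule conjI, rule a(1)) (simp add: p(2))
    moreover have "W l (awlast u (take k p)) v"
      unfolding W_def by (rule exI[of _ "drop k p"], rule conjI, rule a(2)) (simp add: p(2))
    ultimately show ?thesis using awalk_last_in_verts[OF a(1)] by blast
  qed
  have Wsym: "W k u v \<Longrightarrow> W k v u" for k u v unfolding W_def using awalk_reverse[of u _ v] by blast
  have ex: "\<exists>k. W k u v" if "u \<in> pverts G" "v \<in> pverts G" for u v
  proof -
    have "strongly_connected (with_proj G)"
      using assms by (intro symmetric_connected_imp_strongly_connected) (use sym_arcs in auto)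
    hence "u \<rightarrow>\<^sup>*\<^bsub>with_proj G\<^esub> v" using that by (auto simp: strongly_connected_def)
    thus ?thesis by (auto simp: W_def reachable_awalk)
  qed
  have Wd: "W (gdist G u v) u v" if uv: "u \<in> pverts G" "v \<in> pverts G" for u v
  proof -
    obtain k where "W k u v" using ex[OF uv] by blast
    thus ?thesis unfolding d by (rule LeastI)
  qed
  have dle: "gdist G u v \<le> k" if "W k u v" for k u v unfolding d using that by (rule Least_le)
  have d0: "gdist G u v = 0 \<longleftrightarrow> u = v" if "u \<in> pverts G" "v \<in> pverts G" for u v
    using Wd[OF that] dle[of 0 u v] W0 that by auto
  show "dist_space (pverts G) (gdist G)"
  proof
    show "finite (pverts G)" by (rule pair_finite_verts)
    show "gdist G u v = 0 \<longleftrightarrow> u = v" if "u \<in> pverts G" "v \<in> pverts G" for u v by (rule d0[OF that])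
    show "gdist G u v = gdist G v u" if "u \<in> pverts G" "v \<in> pverts G" for u v
      using dle[OF Wsym[OF Wd[OF that]]] dle[OF Wsym[OF Wd[OF that(2,1)]]] by simp
    show "gdist G u w \<le> gdist G u v + gdist G v w"
      if "u \<in> pverts G" "v \<in> pverts G" "w \<in> pverts G" for u v w
      using Wtr[OF Wd[OF that(1,2)] Wd[OF that(2,3)]] by (rule dle)
    show "\<exists>w\<in>pverts G. gdist G u w = k \<and> gdist G w v = gdist G u v - k"
      if "u \<in> pverts G" "v \<in> pverts G" "k \<le> gdist G u v" for u v k
    proof -
      have "W (k + (gdist G u v - k)) u v" using Wd[OF that(1,2)] that(3) by simp
      then obtain w where w: "w \<in> pverts G" "W k u w" "W (gdist G u v - k) w v" using Wsplit by blast
      have "gdist G u v \<le> gdist G u w + gdist G w v"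
        using Wtr[OF Wd[OF that(1) w(1)] Wd[OF w(1) that(2)]] by (rule dle)
      with dle[OF w(2)] dle[OF w(3)] that(3) have "gdist G u w = k \<and> gdist G w v = gdist G u v - k"
        by linarith
      with w(1) show ?thesis by blast
    qed
  qed
  show "gdist G u v = 1 \<longleftrightarrow> (u, v) \<in> parcs G" if uv: "u \<in> pverts G" "v \<in> pverts G"
  proof
    assume "(u, v) \<in> parcs G"
    hence "gdist G u v \<le> 1" "u \<noteq> v" using dle[of 1 u v] W1 no_loops' by auto
    thus "gdist G u v = 1" using d0[OF uv] by linarith
  qed (use Wd[OF uv] W1 in simp)
qed

lemma diam_le_iff:
  assumes "finite (pverts G)" and "pverts G \<noteq> {}"
  shows "diam G \<le> k \<longleftrightarrow> (\<forall>u\<in>pverts G. \<forall>v\<in>pverts G. gdist G u v \<le> k)"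
proof -
  have eq: "{gdist G u v | u v. u \<in> pverts G \<and> v \<in> pverts G} =
      (\<lambda>(u, v). gdist G u v) ` (pverts G \<times> pverts G)" by auto
  show ?thesis unfolding diam_def eq using assms by (subst Max_le_iff) auto
qed

text \<open>
  Blocks may be empty, so that joins of two graphs and complete graphs are instances of the
  three-block scheme.
\<close>

definition block_graph :: "nat \<Rightarrow> (nat \<Rightarrow> nat \<Rightarrow> bool) \<Rightarrow> (nat \<Rightarrow> bool) \<Rightarrow> (nat \<Rightarrow> nat) \<Rightarrow>
    'a pair_pre_digraph \<Rightarrow> ('a \<Rightarrow> nat) \<Rightarrow> bool" where
  "block_graph k adj clique sz G f \<longleftrightarrow> finite (pverts G) \<and> f ` pverts G \<subseteq> {..<k} \<and>
     (\<forall>i<k. card {v \<in> pverts G. f v = i} = sz i) \<and>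
     parcs G \<subseteq> pverts G \<times> pverts G \<and>
     (\<forall>u\<in>pverts G. \<forall>v\<in>pverts G. (u, v) \<in> parcs G \<longleftrightarrow>
        u \<noteq> v \<and> (if f u = f v then clique (f u) else adj (f u) (f v)))"

text \<open>\<open>digraph_iso\<close> works with separate maps on vertices and arcs. Arcs are pairs
  here, so the arc map is determined by the vertex map.\<close>

lemma digraph_iso_with_proj_iff:
  assumes "wf_digraph (with_proj G)"
  shows "G \<cong>\<^sub>G H \<longleftrightarrow> (\<exists>h. bij_betw h (pverts G) (pverts H) \<and> parcs H = map_prod h h ` parcs G)"
proof
  assume "G \<cong>\<^sub>G H"
  then obtain i where i: "pre_digraph.digraph_isomorphism (with_proj G) i"
    and H: "with_proj H = app_iso i (with_proj G)" unfolding digraph_iso_def by blast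
  let ?h = "iso_verts i"
  have V: "pverts H = ?h ` pverts G" and A: "parcs H = iso_arcs i ` parcs G"
    and t: "iso_tail i = fst" and hd: "iso_head i = snd"
    using arg_cong[OF H, of verts] arg_cong[OF H, of arcs]
      arg_cong[OF H, of tail] arg_cong[OF H, of head] by auto
  have "iso_arcs i a = map_prod ?h ?h a" if "a \<in> parcs G" for a
    using that i t hd unfolding pre_digraph.digraph_isomorphism_def by (auto simp: prod_eq_iff)
  hence "parcs H = map_prod ?h ?h ` parcs G" unfolding A by (intro image_cong) auto
  moreover have "bij_betw ?h (pverts G) (pverts H)"
    using i V unfolding pre_digraph.digraph_isomorphism_def by (auto simp: bij_betw_def)
  ultimately show "\<exists>h. bij_betw h (pverts G) (pverts H) \<and> parcs H = map_prod h h ` parcs G" by blast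
next
  assume "\<exists>h. bij_betw h (pverts G) (pverts H) \<and> parcs H = map_prod h h ` parcs G"
  then obtain h where h: "bij_betw h (pverts G) (pverts H)" "parcs H = map_prod h h ` parcs G" by blast
  let ?i = "\<lparr>iso_verts = h, iso_arcs = map_prod h h, iso_head = snd, iso_tail = fst\<rparr>"
  have sub: "parcs G \<subseteq> pverts G \<times> pverts G"
    using wf_digraph.tail_in_verts[OF assms] wf_digraph.head_in_verts[OF assms] by fastforce
  have "inj_on (map_prod h h) (parcs G)"
    using h(1) sub by (intro inj_on_subset[OF map_prod_inj_on]) (auto simp: bij_betw_def)
  hence "pre_digraph.digraph_isomorphism (with_proj G) ?i"
    using assms h(1) unfolding pre_digraph.digraph_isomorphism_def by (auto simp: bij_betw_def)
  moreover have "with_proj H = app_iso ?i (with_proj G)"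
    using h by (auto simp: app_iso_def with_proj_def bij_betw_def)
  ultimately show "G \<cong>\<^sub>G H" unfolding digraph_iso_def by blast
qed

text \<open>Block sizes, block types and the adjacency of blocks determine a graph up to
  isomorphism. Being isomorphic to a standard graph thereby becomes the existence of a labelling of
  \<open>G\<close> itself.\<close>

lemma block_graph_iso_iff:
  assumes G: "wf_digraph (with_proj G)" and H: "block_graph k adj clique sz H g"
  shows "G \<cong>\<^sub>G H \<longleftrightarrow> (\<exists>f. block_graph k adj clique sz G f)"
proof
  assume "G \<cong>\<^sub>G H"
  then obtain h where h: "bij_betw h (pverts G) (pverts H)" "parcs H = map_prod h h ` parcs G"
    unfolding digraph_iso_with_proj_iff[OF G] by blast
  have sub: "parcs G \<subseteq> pverts G \<times> pverts G"
    using wf_digraph.tail_in_verts[OF G] wf_digraph.head_in_verts[OF G] by fastforce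
  have arc: "(h u, h v) \<in> parcs H \<longleftrightarrow> (u, v) \<in> parcs G" if "u \<in> pverts G" "v \<in> pverts G" for u v
  proof -
    have "(h u, h v) \<in> parcs H \<longleftrightarrow> (\<exists>(x, y)\<in>parcs G. h x = h u \<and> h y = h v)"
      unfolding h(2) by force
    also have "\<dots> \<longleftrightarrow> (\<exists>(x, y)\<in>parcs G. x = u \<and> y = v)"
      using that sub h(1) unfolding bij_betw_def inj_on_def by (intro bex_cong refl) auto
    finally show ?thesis by auto
  qed
  have card: "card {v \<in> pverts G. g (h v) = i} = card {w \<in> pverts H. g w = i}" for i
    using h(1) by (intro bij_betw_same_card[of h]) (auto simp: bij_betw_def inj_on_def)
  have mem: "h u \<in> pverts H" if "u \<in> pverts G" for u using h(1) that by (auto simp: bij_betw_def)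
  have inj: "h u = h v \<longleftrightarrow> u = v" if "u \<in> pverts G" "v \<in> pverts G" for u v
    using h(1) that by (auto simp: bij_betw_def inj_on_def)
  have fin: "finite (pverts G)" using H h(1) bij_betw_finite by (auto simp: block_graph_def)
  have adj: "(x, y) \<in> parcs H \<longleftrightarrow> x \<noteq> y \<and> (if g x = g y then clique (g x) else adj (g x) (g y))"
    if "x \<in> pverts H" "y \<in> pverts H" for x y using H that unfolding block_graph_def by blast
  have "block_graph k adj clique sz G (g \<circ> h)"
    unfolding block_graph_def
  proof (intro conjI ballI allI impI)
    show "(g \<circ> h) ` pverts G \<subseteq> {..<k}" using H mem by (auto simp: block_graph_def)
    show "card {v \<in> pverts G. (g \<circ> h) v = i} = sz i" if "i < k" for i
      using H that card by (simp add: block_graph_def)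
    show "(u, v) \<in> parcs G \<longleftrightarrow> u \<noteq> v \<and>
        (if (g \<circ> h) u = (g \<circ> h) v then clique ((g \<circ> h) u) else adj ((g \<circ> h) u) ((g \<circ> h) v))"
      if "u \<in> pverts G" "v \<in> pverts G" for u v
      unfolding o_apply arc[OF that, symmetric] adj[OF mem[OF that(1)] mem[OF that(2)]] inj[OF that] ..
  qed (rule fin, rule sub)
  thus "\<exists>f. block_graph k adj clique sz G f" by blast
next
  assume "\<exists>f. block_graph k adj clique sz G f"
  then obtain f where f: "block_graph k adj clique sz G f" by blast
  have "\<forall>i. \<exists>b. i < k \<longrightarrow> bij_betw b {v \<in> pverts G. f v = i} {w \<in> pverts H. g w = i}"
  proof
    fix i show "\<exists>b. i < k \<longrightarrow> bij_betw b {v \<in> pverts G. f v = i} {w \<in> pverts H. g w = i}"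
    proof (cases "i < k")
      case True
      hence "\<exists>b. bij_betw b {v \<in> pverts G. f v = i} {w \<in> pverts H. g w = i}"
        using f H by (intro finite_same_card_bij) (auto simp: block_graph_def)
      thus ?thesis by blast
    qed simp
  qed
  from choice[OF this] obtain b where
    b: "\<And>i. i < k \<Longrightarrow> bij_betw (b i) {v \<in> pverts G. f v = i} {w \<in> pverts H. g w = i}" by blast
  \<comment> \<open>Bijections between blocks of equal label are glued to one map on the
    vertices.\<close>
  define h where "h v = b (f v) v" for v
  have fk: "f v < k" if "v \<in> pverts G" for v using f that by (auto simp: block_graph_def)
  have gk: "g v < k" if "v \<in> pverts H" for v using H that by (auto simp: block_graph_def)
  have hv: "h v \<in> pverts H" "g (h v) = f v" if "v \<in> pverts G" for v
    using b[OF fk[OF that]] that by (auto simp: h_def bij_betw_def)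
  have inj: "inj_on h (pverts G)"
  proof (rule inj_onI)
    fix u v assume uv: "u \<in> pverts G" "v \<in> pverts G" "h u = h v"
    hence "f u = f v" using hv(2) by metis
    thus "u = v" using uv b[OF fk[OF uv(1)]] by (auto simp: h_def bij_betw_def inj_on_def)
  qed
  have surj: "w \<in> h ` pverts G" if w: "w \<in> pverts H" for w
  proof -
    have "w \<in> b (g w) ` {v \<in> pverts G. f v = g w}" using b[OF gk[OF w]] w by (auto simp: bij_betw_def)
    then obtain v where v: "w = b (g w) v" "v \<in> pverts G" "f v = g w" by auto
    have "w = h v" using v(1) by (simp add: h_def v(3))
    with v(2) show ?thesis by blast
  qed
  have bij: "bij_betw h (pverts G) (pverts H)" using inj surj hv by (auto simp: bij_betw_def)
  have arc: "(h u, h v) \<in> parcs H \<longleftrightarrow> (u, v) \<in> parcs G" if uv: "u \<in> pverts G" "v \<in> pverts G" for u v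
  proof -
    have "h u = h v \<longleftrightarrow> u = v" using inj uv by (auto simp: inj_on_def)
    thus ?thesis using f H hv[OF uv(1)] hv[OF uv(2)] uv unfolding block_graph_def by auto
  qed
  have "parcs H = map_prod h h ` parcs G"
  proof
    show "map_prod h h ` parcs G \<subseteq> parcs H"
    proof
      fix e assume "e \<in> map_prod h h ` parcs G"
      then obtain u v where uv: "(u, v) \<in> parcs G" "e = (h u, h v)" by auto
      have "parcs G \<subseteq> pverts G \<times> pverts G" using f by (simp add: block_graph_def)
      hence "u \<in> pverts G" "v \<in> pverts G" using uv(1) by auto
      thus "e \<in> parcs H" using arc uv by blast
    qed
    show "parcs H \<subseteq> map_prod h h ` parcs G"
    proof
      fix e assume e: "e \<in> parcs H"
      hence "fst e \<in> pverts H" "snd e \<in> pverts H" using H unfolding block_graph_def by auto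
      then obtain u v where "u \<in> pverts G" "v \<in> pverts G" "e = (h u, h v)"
        using surj by (metis imageE prod.collapse)
      thus "e \<in> map_prod h h ` parcs G" using arc e by (auto intro!: image_eqI[of _ _ "(u, v)"])
    qed
  qed
  with bij show "G \<cong>\<^sub>G H" unfolding digraph_iso_with_proj_iff[OF G] by blast
qed

section \<open>Diameter three\<close>

definition block_dist :: "nat \<Rightarrow> (nat \<Rightarrow> nat \<Rightarrow> nat) \<Rightarrow> (nat \<Rightarrow> bool) \<Rightarrow>
    'a set \<Rightarrow> ('a \<Rightarrow> 'a \<Rightarrow> nat) \<Rightarrow> ('a \<Rightarrow> nat) \<Rightarrow> bool" where
  "block_dist k m clique V d f \<longleftrightarrow> f ` V \<subseteq> {..<k} \<and> (\<forall>u\<in>V. \<forall>v\<in>V. u \<noteq> v \<longrightarrow>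
     d u v = (if f u = f v then if clique (f u) then 1 else 2 else m (f u) (f v)))"

locale good_dist_space = dist_space +
  assumes lam3: "lam3_cond V d" and lam_penult: "lam_penult_cond V d"

definition path_dist :: "nat \<Rightarrow> nat \<Rightarrow> nat" where
  "path_dist i j = (if i \<le> j then j - i else i - j)"

lemma path_table_pair:
  assumes "(i, t) \<in> set path_positions" "(j, s) \<in> set path_positions" "i \<le> j" "m \<in> {1, 2, 3}"
    and "\<not> excluded path_certs6 (extend_table path_table (path_profile i t)) (path_profile j s @ [m])"
  shows "if i = j then t = s \<and> m = t else m = j - i"
proof -
  have "\<forall>p\<in>set path_positions. \<forall>q\<in>set path_positions. fst p \<le> fst q \<longrightarrow> (\<forall>m\<in>set [1, 2, 3].
     (if fst p = fst q then snd p = snd q \<and> m = snd p else m = fst q - fst p) \<or>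
     excluded path_certs6 (extend_table path_table (path_profile (fst p) (snd p)))
       (path_profile (fst q) (snd q) @ [m]))"
    using path_table_step2 by (simp only: list_all_iff case_prod_unfold)
  from bspec[OF bspec[OF this assms(1)] assms(2)] show ?thesis
    using assms(3-5) by auto
qed

context good_dist_space begin

abbreviation profile :: "'a list \<Rightarrow> 'a \<Rightarrow> int list" where
  "profile ws w \<equiv> map (\<lambda>v. int (d w v)) ws"

lemma dist_table_snoc:
  assumes "w \<in> V" "set ws \<subseteq> V"
  shows "dist_table d (ws @ [w]) = extend_table (dist_table d ws) (profile ws w)"
proof -
  have "map (\<lambda>u. map (\<lambda>v. int (d u v)) ws @ [int (d u w)]) ws =
      map2 (\<lambda>r x. r @ [x]) (map (\<lambda>u. map (\<lambda>v. int (d u v)) ws) ws) (map (\<lambda>v. int (d w v)) ws)"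
    using assms by (intro nth_equalityI) (auto simp: dist_sym subset_iff)
  thus ?thesis using assms dist_eq_0[of w w] by (simp add: dist_table_def extend_table_def)
qed

lemma not_excluded:
  assumes "distinct (ws @ [w])" "set (ws @ [w]) \<subseteq> V"
  shows "\<not> excluded cs (dist_table d ws) (profile ws w)"
proof -
  have "d w u \<le> d w v + d u v" "d u v \<le> d w u + d w v" if "u \<in> set ws" "v \<in> set ws" for u v
    using that assms dist_tri[of w v u] dist_tri[of u w v] dist_sym[of u v] dist_sym[of u w]
    by (auto simp: subset_iff)
  hence "triangle_ok (dist_table d ws) (profile ws w)"
    by (auto simp: triangle_ok_def dist_table_def list_all2_map1 list_all2_map2 list_all2_same
        simp flip: of_nat_add)
  moreover have "\<not> refutes (extend_table (dist_table d ws) (profile ws w)) c" for c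
    using refutes_sound[OF fin dist_sym lam3 lam_penult assms, of c] dist_table_snoc[of w ws] assms
    by auto
  ultimately show ?thesis by (auto simp: excluded_def list_ex_iff)
qed

lemma not_refutes:
  assumes "distinct ws" "set ws \<subseteq> V"
  shows "\<not> refutes (dist_table d ws) c"
  using refutes_sound[OF fin dist_sym lam3 lam_penult assms] by auto

text \<open>Turns information on pairs into a global block structure. \<open>b i\<close> represents
  block \<open>i\<close>, and \<open>pos w i\<close> says that \<open>w\<close> looks like a twin of
  \<open>b i\<close>. A label is chosen among the positions of \<open>w\<close>; the pair hypothesis
  then gives each block one type and fixes all mutual distances.\<close>

lemma block_dist_of_bases:
  fixes k :: nat and m :: "nat \<Rightarrow> nat \<Rightarrow> nat" and b :: "nat \<Rightarrow> 'a" and pos :: "'a \<Rightarrow> nat \<Rightarrow> bool"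
  assumes pos_dist: "\<And>w i. pos w i \<Longrightarrow>
      (d w (b i) = 1 \<or> d w (b i) = 2) \<and> (\<forall>j<k. j \<noteq> i \<longrightarrow> d w (b j) = m i j)"
    and bV: "\<And>i. i < k \<Longrightarrow> b i \<in> V" and m_sym: "\<And>i j. m i j = m j i"
    and m_pos: "\<And>i j. i < k \<Longrightarrow> j < k \<Longrightarrow> i \<noteq> j \<Longrightarrow> m i j \<noteq> 0"
    and bases: "\<And>i j. i < k \<Longrightarrow> j < k \<Longrightarrow> i \<noteq> j \<Longrightarrow> d (b i) (b j) = m i j"
    and positions: "\<And>w. w \<in> V \<Longrightarrow> w \<notin> b ` {..<k} \<Longrightarrow> \<exists>i<k. pos w i"
    and pairs: "\<And>w w' i j. w \<in> V \<Longrightarrow> w' \<in> V \<Longrightarrow> w \<notin> b ` {..<k} \<Longrightarrow> w' \<notin> b ` {..<k} \<Longrightarrow> w \<noteq> w' \<Longrightarrow>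
      i \<le> j \<Longrightarrow> j < k \<Longrightarrow> pos w i \<Longrightarrow> pos w' j \<Longrightarrow>
      (if i = j then d w' (b i) = d w (b i) \<and> d w w' = d w (b i) else d w w' = m i j)"
  shows "\<exists>f clique. block_dist k m clique V d f \<and> (\<forall>i<k. f (b i) = i)"
proof -
  have inj: "b i = b j \<longleftrightarrow> i = j" if "i < k" "j < k" for i j
    using bases[OF that] m_pos[OF that] dist_eq_0[OF bV[OF that(1)] bV[OF that(2)]] by metis
  define loc where "loc w i \<longleftrightarrow> i < k \<and> (w = b i \<or> w \<notin> b ` {..<k} \<and> pos w i)" for w i
  define f where "f w = (SOME i. loc w i)" for w
  \<comment> \<open>The type is read off the vertices other than \<open>b i\<close>; a block
    consisting of \<open>b i\<close> alone counts as a clique.\<close>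
  define clique where "clique i \<longleftrightarrow> (\<forall>w\<in>V. f w = i \<longrightarrow> w \<noteq> b i \<longrightarrow> d w (b i) = 1)" for i
  have f: "loc w (f w)" if "w \<in> V" for w
  proof -
    have "\<exists>i. loc w i" using positions[OF that] by (auto simp: loc_def)
    thus ?thesis unfolding f_def by (rule someI_ex)
  qed
  have fb: "f (b i) = i" if "i < k" for i
    using f[OF bV[OF that]] inj[OF that] that by (auto simp: loc_def)
  have nb: "pos w (f w)" "w \<notin> b ` {..<k}" if "w \<in> V" "w \<noteq> b (f w)" for w
    using f[OF that(1)] that(2) by (auto simp: loc_def)
  have fk: "f w < k" if "w \<in> V" for w using f[OF that] by (simp add: loc_def)
  \<comment> \<open>The pair hypothesis is ordered by position, so the ordered case is proved here
    and symmetry of distance and \<open>m\<close> gives the other one.\<close>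
  have main: "(f w = f w' \<longrightarrow> d w w' = (if clique (f w) then 1 else 2)) \<and>
      (f w \<noteq> f w' \<longrightarrow> d w w' = m (f w) (f w'))"
    if w: "w \<in> V" "w' \<in> V" "w \<noteq> w'" and le: "f w \<le> f w'" for w w'
  proof (cases "w = b (f w) \<or> w' = b (f w')")
    case False
    note F = False
    note n = nb[OF w(1)] nb[OF w(2)]
    have p: "if f w = f w' then d w' (b (f w)) = d w (b (f w)) \<and> d w w' = d w (b (f w))
        else d w w' = m (f w) (f w')"
      using False n w le fk by (intro pairs) auto
    have "clique (f w) \<longleftrightarrow> d w (b (f w)) = 1"
    proof
      assume "d w (b (f w)) = 1"
      show "clique (f w)" unfolding clique_def
      proof (intro ballI impI)
        fix u assume u: "u \<in> V" "f u = f w" "u \<noteq> b (f w)"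
        show "d u (b (f w)) = 1"
        proof (cases "u = w")
          case uw: False
          thus ?thesis using pairs[of w u "f w" "f w"] u nb[of u] n F w fk \<open>d w (b (f w)) = 1\<close>
            by auto
        qed (use \<open>d w (b (f w)) = 1\<close> in simp)
      qed
    qed (use False w in \<open>auto simp: clique_def\<close>)
    moreover have "d w (b (f w)) = 1 \<or> d w (b (f w)) = 2" using pos_dist[OF n(1)] F by auto
    ultimately show ?thesis using p by (auto split: if_splits)
  next
    case True
    have *: "(f u = f v \<longrightarrow> d u v = (if clique (f u) then 1 else 2)) \<and>
      (f u \<noteq> f v \<longrightarrow> d u v = m (f u) (f v))" if b: "u = b (f u)" and uv: "u \<in> V" "v \<in> V" "u \<noteq> v" for u v
    proof (cases "v = b (f v)")
      case True
      thus ?thesis using b uv bases[of "f u" "f v"] fk by metis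
    next
      case False
      note n = nb[OF uv(2) False]
      have duv: "d u v = d v (b (f u))" using b uv dist_sym by metis
      show ?thesis
      proof (intro conjI impI)
        assume eq: "f u = f v"
        show "d u v = (if clique (f u) then 1 else 2)"
        proof (cases "d v (b (f v)) = 1")
          case True
          have "clique (f u)" unfolding clique_def
          proof (intro ballI impI)
            fix x assume x: "x \<in> V" "f x = f u" "x \<noteq> b (f u)"
            show "d x (b (f u)) = 1"
            proof (cases "x = v")
              case False
              thus ?thesis using pairs[of v x "f v" "f v"] x nb[of x] n uv fk eq True by auto
            qed (use True eq in simp)
          qed
          thus ?thesis using True duv eq by simp
        next
          case False
          hence "\<not> clique (f u)" using uv n fk eq \<open>v \<noteq> b (f v)\<close> by (auto simp: clique_def)
          thus ?thesis using False duv eq pos_dist[OF n(1)] by auto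
        qed
      next
        assume "f u \<noteq> f v"
        thus "d u v = m (f u) (f v)" using pos_dist[OF n(1)] duv fk[OF uv(1)] m_sym by auto
      qed
    qed
    from True show ?thesis
    proof
      assume "w' = b (f w')"
      from *[OF this w(2,1)] w show ?thesis using dist_sym[of w w'] m_sym[of "f w" "f w'"] by auto
    qed (use *[OF _ w] in auto)
  qed
  have "d u v = (if f u = f v then if clique (f u) then 1 else 2 else m (f u) (f v))"
    if uv: "u \<in> V" "v \<in> V" "u \<noteq> v" for u v
  proof (cases "f u \<le> f v")
    case True
    thus ?thesis using main[OF uv] by auto
  next
    case False
    thus ?thesis using main[of v u] uv dist_sym[of u v] m_sym[of "f u" "f v"] by auto
  qed
  hence "block_dist k m clique V d f" unfolding block_dist_def using fk by auto
  with fb show ?thesis by blast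
qed

text \<open>A geodesic of length 4 carries the distance table of the path with five vertices, which
  violates the condition on the third eigenvalue.\<close>

lemma diameter_le_3:
  assumes uv: "u \<in> V" "v \<in> V"
  shows "d u v \<le> 3"
proof (rule ccontr)
  assume "\<not> d u v \<le> 3"
  then obtain e where e: "e \<in> V" "d u e = 4" using dist_between[OF uv, of 4] by auto
  obtain c where c: "c \<in> V" "d u c = 3" "d c e = 1" using dist_between[of u e 3] uv e by auto
  obtain b where b: "b \<in> V" "d u b = 2" "d b c = 1" using dist_between[of u c 2] uv c by auto
  obtain a where a: "a \<in> V" "d u a = 1" "d a b = 1" using dist_between[of u b 1] uv b by auto
  note S = uv(1) a(1) b(1) c(1) e(1)
  have dd: "d a c = 2" "d a e = 3" "d b e = 2"
    using dist_tri[of u a c] dist_tri[of a b c] dist_tri[of u a e] dist_tri[of a c e]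
      dist_tri[of u b e] dist_tri[of b c e] S a b c e by auto
  have z: "d x x = 0" if "x \<in> V" for x using dist_eq_0[of x x] that by simp
  have dist: "distinct [u, a, b, c, e]" using S a b c e dd z by auto
  have tab: "dist_table d [u, a, b, c, e] =
      [[0,1,2,3,4], [1,0,1,2,3], [2,1,0,1,2], [3,2,1,0,1], [4,3,2,1,0]]"
    using S a b c e dd z by (simp add: dist_table_def dist_sym[of a u] dist_sym[of b u] dist_sym[of c u]
      dist_sym[of e u] dist_sym[of b a] dist_sym[of c a] dist_sym[of e a] dist_sym[of c b]
      dist_sym[of e b] dist_sym[of e c])
  have "\<not> refutes (dist_table d [u, a, b, c, e]) cs" for cs by (rule not_refutes[OF dist]) (use S in simp)
  thus False unfolding tab using path5_refuted by blast
qed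

lemma path_position:
  fixes b :: "nat \<Rightarrow> 'a"
  assumes bV: "\<And>i. i < 4 \<Longrightarrow> b i \<in> V"
    and bd: "\<And>i j. i < 4 \<Longrightarrow> j < 4 \<Longrightarrow> d (b i) (b j) = path_dist i j"
  defines "B \<equiv> [b 0, b 1, b 2, b 3]"
  shows "dist_table d B = path_table" and "set B \<subseteq> V" and "distinct B"
    and "w \<in> V \<Longrightarrow> w \<notin> set B \<Longrightarrow> \<exists>(i, t)\<in>set path_positions. profile B w = path_profile i t"
proof -
  show tab: "dist_table d B = path_table"
    by (simp add: B_def dist_table_def bd path_dist_def path_table_def)
  show BV: "set B \<subseteq> V" using bV by (auto simp: B_def)
  have "b i \<noteq> b j" if "i < 4" "j < 4" "i \<noteq> j" for i j
    using bd[OF that(1,2)] bd[OF that(1,1)] that(3) by (auto simp: path_dist_def split: if_splits)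
  thus dist: "distinct B" by (simp add: B_def)
  have prof: "profile B w \<in> set ([2, 1, 2, 2] # [2, 2, 1, 2] # map (\<lambda>(i, t). path_profile i t) path_positions)"
    if w: "w \<in> V" "w \<notin> set B" for w
  proof -
    have "int (d w v) \<in> {1, 2, 3}" if "v \<in> set B" for v
      using diameter_le_3[of w v] dist_eq_0[of w v] w that BV by (auto simp: subset_iff)
    from this[of "b 0"] this[of "b 1"] this[of "b 2"] this[of "b 3"]
    have "profile B w \<in> set (product_lists (replicate 4 [1, 2, 3]))"
      unfolding product_lists_set B_def by (simp add: numeral_eq_Suc)
    moreover have "\<not> excluded path_certs5 path_table (profile B w)"
      unfolding tab[symmetric] by (rule not_excluded) (use w BV dist in auto)
    ultimately show ?thesis using path_table_step1 unfolding list_all_iff by blast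
  qed
  \<comment> \<open>An exceptional \<open>w\<close> is at distance 2 from the end \<open>b i\<close>
    of the base path, but no base vertex is adjacent to both. Their common neighbour
    \<open>u\<close> is therefore a sixth vertex, and the table of the six vertices is
    refuted.\<close>
  have no: "profile B w \<noteq> r"
    if w: "w \<in> V" "w \<notin> set B" and r: "r ! i = 2" "i < 4" "(i = 3 \<and> r = [2, 1, 2, 2]) \<or> (i = 0 \<and> r = [2, 2, 1, 2])"
    for w i r
  proof
    assume p: "profile B w = r"
    have Bi: "B ! i = b i" using r(3) by (auto simp: B_def)
    have len: "i < length B" using r(2) by (simp add: B_def)
    have "profile B w ! i = int (d w (b i))" unfolding nth_map[OF len] Bi ..
    hence "d w (b i) = 2" using p r by simp
    then obtain u where u: "u \<in> V" "d w u = 1" "d u (b i) = 1"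
      using dist_between[OF w(1) bV[OF r(2)], of 1] by auto
    have "u \<noteq> w" using u dist_eq_0[of w w] w by auto
    have "u \<notin> set B"
    proof
      assume "u \<in> set B"
      hence "u \<in> b ` {0, 1, 2, 3}" by (auto simp: B_def)
      then obtain j where "j \<in> {0, 1, 2, 3}" and uj: "u = b j" by blast
      hence j: "j < 4" "u = b j" by auto
      have "d (b j) (b i) = 1" using u j by simp
      hence "path_dist j i = 1" using bd j r(2) by simp
      moreover have "profile B w ! j = 1"
        using u j by (auto simp: B_def less_Suc_eq numeral_eq_Suc)
      ultimately show False using p r j by (auto simp: path_dist_def less_Suc_eq numeral_eq_Suc split: if_splits)
    qed
    have "\<not> excluded path_certs6 (dist_table d (B @ [w])) (profile (B @ [w]) u)"
      using w u BV dist \<open>u \<notin> set B\<close> \<open>u \<noteq> w\<close> by (intro not_excluded) auto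
    hence ne: "\<not> excluded path_certs6 (extend_table path_table r) (profile B u @ [1])"
      using dist_table_snoc[OF w(1) BV] tab p u dist_sym[of u w] w by simp
    have "profile B u ! i = 1" unfolding nth_map[OF len] Bi using u(3) by simp
    moreover have "profile B u \<in> set ([2, 1, 2, 2] # [2, 2, 1, 2] # map (\<lambda>(i, t). path_profile i t) path_positions)"
      by (rule prof[OF u(1) \<open>u \<notin> set B\<close>])
    ultimately have "profile B u \<in> set (if i = 3 then [[2, 1, 1, 1], [2, 1, 2, 1], [3, 2, 1, 1]]
        else [[1, 1, 1, 2], [1, 2, 1, 2], [1, 1, 2, 3]])"
      using r(3) by (auto simp: path_positions_def path_profile_def)
    thus False using ne r(3) path_table_no_second_neighbour unfolding list_all_iff by auto
  qed
  show "\<exists>(i, t)\<in>set path_positions. profile B w = path_profile i t" if w: "w \<in> V" "w \<notin> set B"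
    using prof[OF w] no[OF w, of "[2, 1, 2, 2]" 3] no[OF w, of "[2, 2, 1, 2]" 0] by auto
qed

text \<open>The base is a geodesic of length 3 with one vertex in each block; hence all four blocks
  are nonempty.\<close>

lemma path_block_dist:
  assumes "u \<in> V" "v \<in> V" "d u v = 3"
  shows "\<exists>f clique. block_dist 4 path_dist clique V d f \<and> {..<4} \<subseteq> f ` V"
proof -
  obtain c where c: "c \<in> V" "d u c = 2" "d c v = 1" using dist_between[of u v 2] assms by auto
  obtain a where a: "a \<in> V" "d u a = 1" "d a c = 1" using dist_between[of u c 1] assms c by auto
  have av: "d a v = 2"
    using dist_tri[of u a v] dist_tri[of a c v] assms a c by auto
  define b where "b i = [u, a, c, v] ! i" for i
  have bV: "b i \<in> V" if "i < 4" for i using that assms a c by (auto simp: b_def less_Suc_eq numeral_eq_Suc)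
  have le: "d (b i) (b j) = path_dist i j" if "i < 4" "j < 4" for i j
  proof -
    have "d (b i) (b j) = path_dist i j" if "i < 4" "j < 4" "i \<le> j" for i j
      using that assms a c av dist_eq_0
      by (auto simp: b_def path_dist_def less_Suc_eq numeral_eq_Suc)
    from this[of i j] this[of j i] show ?thesis
      using that dist_sym[of "b i" "b j"] bV by (cases "i \<le> j") (auto simp: path_dist_def)
  qed
  define B where "B = [b 0, b 1, b 2, b 3]"
  note P = path_position[OF bV le, folded B_def]
  have Bset: "b ` {..<4} = set B" by (auto simp: B_def less_Suc_eq numeral_eq_Suc lessThan_Suc)
  let ?pos = "\<lambda>w i. (d w (b i) = 1 \<or> d w (b i) = 2) \<and> (\<forall>j<4. j \<noteq> i \<longrightarrow> d w (b j) = path_dist i j)"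
  have prof: "profile B w = path_profile (int i) (int (d w (b i))) \<and>
      (int i, int (d w (b i))) \<in> set path_positions" if "?pos w i" "i < 4" for w i
    using that by (auto simp: B_def path_profile_def path_positions_def path_dist_def less_Suc_eq numeral_eq_Suc)
  have "\<exists>f clique. block_dist 4 path_dist clique V d f \<and> (\<forall>i<4. f (b i) = i)"
  proof (rule block_dist_of_bases[where b = b and pos = ?pos, OF _ bV])
    show "path_dist i j = path_dist j i" for i j by (simp add: path_dist_def)
    show "path_dist i j \<noteq> 0" if "i \<noteq> j" for i j using that by (simp add: path_dist_def)
    show "d (b i) (b j) = path_dist i j" if "i < 4" "j < 4" for i j by (rule le[OF that])
    show "\<exists>i<4. ?pos w i" if w: "w \<in> V" "w \<notin> b ` {..<4}" for w
    proof -
      obtain i t where it: "(i, t) \<in> set path_positions" "profile B w = path_profile i t"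
        using P(4)[of w] w Bset by auto
      show ?thesis
        by (rule exI[of _ "nat i"])
          (use it in \<open>auto simp: B_def path_profile_def path_positions_def path_dist_def less_Suc_eq numeral_eq_Suc\<close>)
    qed
    show "if i = j then d w' (b i) = d w (b i) \<and> d w w' = d w (b i) else d w w' = path_dist i j"
      if w: "w \<in> V" "w' \<in> V" "w \<notin> b ` {..<4}" "w' \<notin> b ` {..<4}" "w \<noteq> w'"
        and ij: "i \<le> j" "j < 4" and pos: "?pos w i" "?pos w' j" for w w' i j
    proof -
      have "\<not> excluded path_certs6 (dist_table d (B @ [w])) (profile (B @ [w]) w')"
        using w P(2,3) Bset by (intro not_excluded) auto
      hence ne: "\<not> excluded path_certs6 (extend_table path_table (profile B w)) (profile B w' @ [int (d w' w)])"
        using dist_table_snoc[OF w(1) P(2)] P(1) by simp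
      have "int (d w' w) \<in> set [1, 2, 3]"
        using diameter_le_3[OF w(2,1)] dist_eq_0[OF w(2,1)] w(5) by auto
      hence "if int i = int j then int (d w (b i)) = int (d w' (b j)) \<and> int (d w' w) = int (d w (b i))
          else int (d w' w) = int j - int i"
        using prof[OF pos(1)] prof[OF pos(2)] ij ne by (intro path_table_pair) auto
      thus ?thesis using ij dist_sym[OF w(1,2)] by (auto simp: path_dist_def split: if_splits)
    qed
  qed
  then obtain f clique where "block_dist 4 path_dist clique V d f" "\<forall>i<4. f (b i) = i" by blast
  moreover have "{..<4} \<subseteq> f ` V"
    using calculation(2) bV by (metis image_eqI lessThan_iff subsetI)
  ultimately show ?thesis by blast
qed

end

section \<open>Diameter two\<close>

definition star_dist :: "nat \<Rightarrow> nat \<Rightarrow> nat" where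
  "star_dist i j = (if i = 0 \<or> j = 0 then 1 else 2)"

lemma paw_table_pair:
  assumes "(i, t) \<in> set paw_positions" "(j, s) \<in> set paw_positions" "i \<le> j" "m \<in> {1, 2}"
    and "\<not> excluded paw_certs6 (extend_table paw_table (paw_profile i t)) (paw_profile j s @ [m])"
  shows "if i = j then t = s \<and> m = t else m = join_dist i j"
proof -
  have "\<forall>p\<in>set paw_positions. \<forall>q\<in>set paw_positions. fst p \<le> fst q \<longrightarrow> (\<forall>m\<in>set [1, 2].
     (if fst p = fst q then snd p = snd q \<and> m = snd p else m = join_dist (fst p) (fst q)) \<or>
     excluded paw_certs6 (extend_table paw_table (paw_profile (fst p) (snd p)))
       (paw_profile (fst q) (snd q) @ [m]))"
    using paw_table_step2 by (simp only: list_all_iff case_prod_unfold)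
  from bspec[OF bspec[OF this assms(1)] assms(2)] show ?thesis
    using assms(3-5) by auto
qed

context good_dist_space begin

definition paw :: "'a \<Rightarrow> 'a \<Rightarrow> 'a \<Rightarrow> 'a \<Rightarrow> bool" where
  "paw x y y' z \<longleftrightarrow> d x y = 1 \<and> d x y' = 1 \<and> d x z = 1 \<and> d y y' = 1 \<and> d y z = 2 \<and> d y' z = 2"

context
  assumes diam2: "\<And>u v. u \<in> V \<Longrightarrow> v \<in> V \<Longrightarrow> d u v \<le> 2"
begin

lemma dist_1_or_2: "u \<in> V \<Longrightarrow> v \<in> V \<Longrightarrow> u \<noteq> v \<Longrightarrow> d u v = 1 \<or> d u v = 2"
  using diam2[of u v] dist_eq_0[of u v] by linarith

lemma common_neighbour:
  assumes "u \<in> V" "v \<in> V" "d u v = 2"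
  obtains w where "w \<in> V" "d u w = 1" "d w v = 1"
  using dist_between[OF assms(1,2), of 1] assms(3) by auto

lemma not_excluded2:
  assumes "distinct B" "set B \<subseteq> V" "w \<in> V" "u \<in> V" "w \<notin> set B" "u \<notin> set B" "w \<noteq> u"
  shows "\<not> excluded cs (extend_table (dist_table d B) (profile B w)) (profile B u @ [int (d u w)])"
  using not_excluded[of "B @ [w]" u cs] dist_table_snoc[of w B] assms by auto

lemma paw_position:
  assumes V: "x \<in> V" "y \<in> V" "y' \<in> V" "z \<in> V" and paw: "paw x y y' z"
  defines "B \<equiv> [x, y, y', z]"
  shows "dist_table d B = paw_table" and "set B \<subseteq> V" and "distinct B"
    and "w \<in> V \<Longrightarrow> w \<notin> set B \<Longrightarrow> \<exists>(i, t)\<in>set paw_positions. profile B w = paw_profile i t"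
proof -
  note p = paw[unfolded paw_def]
  have z: "d v v = 0" if "v \<in> V" for v using dist_eq_0[of v v] that by simp
  show tab: "dist_table d B = paw_table"
    using V p z by (simp add: B_def dist_table_def paw_table_def dist_sym[of y x] dist_sym[of y' x]
      dist_sym[of z x] dist_sym[of y' y] dist_sym[of z y] dist_sym[of z y'])
  show BV: "set B \<subseteq> V" using V by (simp add: B_def)
  show dist: "distinct B" using V p z by (auto simp: B_def)
  have prof: "profile B w \<in> set ([2, 1, 1, 2] # [2, 2, 2, 1] # map (\<lambda>(i, t). paw_profile i t) paw_positions)"
    if w: "w \<in> V" "w \<notin> set B" for w
  proof -
    have "int (d w v) \<in> {1, 2}" if "v \<in> set B" for v
      using dist_1_or_2[of w v] w that BV by (auto simp: subset_iff)
    from this[of x] this[of y] this[of y'] this[of z]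
    have "profile B w \<in> set (product_lists (replicate 4 [1, 2]))"
      unfolding product_lists_set B_def by (simp add: numeral_eq_Suc)
    moreover have "\<not> excluded paw_certs5 paw_table (profile B w)"
      unfolding tab[symmetric] by (rule not_excluded) (use w BV dist in auto)
    ultimately show ?thesis using paw_table_step1 unfolding list_all_iff by blast
  qed
  have ex2: "\<not> excluded paw_certs6 (extend_table paw_table (profile B w)) (profile B u @ [1])"
    if "w \<in> V" "u \<in> V" "w \<notin> set B" "u \<notin> set B" "d w u = 1" for w u
  proof -
    have "w \<noteq> u" using that z[of w] by auto
    thus ?thesis using not_excluded2[OF dist BV that(1-4)] tab that dist_sym[of u w] by simp
  qed
  \<comment> \<open>\<open>w\<close> is adjacent to \<open>y\<close> and \<open>y'\<close> but not
    to \<open>x\<close>, the only base neighbour of \<open>z\<close>; a common neighbour with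
    \<open>z\<close> lies outside the base.\<close>
  have no1: "profile B w \<noteq> [2, 1, 1, 2]" if w: "w \<in> V" "w \<notin> set B" for w
  proof
    assume pw: "profile B w = [2, 1, 1, 2]"
    hence dw: "d w x = 2" "d w z = 2" by (simp_all add: B_def)
    obtain u where u: "u \<in> V" "d w u = 1" "d u z = 1" using common_neighbour[OF w(1) V(4) dw(2)] .
    have uB: "u \<notin> set B" using u dw p z V by (auto simp: B_def)
    have "profile B u \<in> set [[1, 1, 1, 1], [1, 2, 2, 1], [2, 1, 1, 1], [2, 2, 2, 1]]"
      using prof[OF u(1) uB] u(3) by (auto simp: B_def paw_positions_def paw_profile_def)
    thus False using ex2[OF w(1) u(1) w(2) uB u(2)] pw paw_table_no_second_neighbour(1)
      unfolding list_all_iff by auto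
  qed
  \<comment> \<open>The only base neighbour of \<open>w\<close> is \<open>z\<close>, which is not
    adjacent to \<open>y\<close>; again a common neighbour lies outside the base.\<close>
  have no2: "profile B w \<noteq> [2, 2, 2, 1]" if w: "w \<in> V" "w \<notin> set B" for w
  proof
    assume pw: "profile B w = [2, 2, 2, 1]"
    hence dw: "d w x = 2" "d w y = 2" "d w y' = 2" by (simp_all add: B_def)
    obtain u where u: "u \<in> V" "d w u = 1" "d u y = 1" using common_neighbour[OF w(1) V(2) dw(2)] .
    have uB: "u \<notin> set B" using u dw p z V dist_sym[of z y] by (auto simp: B_def)
    have "profile B u \<in> set [[1, 1, 1, 1], [1, 1, 1, 2], [2, 1, 1, 1], [2, 1, 1, 2]]"
      using prof[OF u(1) uB] u(3) by (auto simp: B_def paw_positions_def paw_profile_def)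
    thus False using ex2[OF w(1) u(1) w(2) uB u(2)] pw paw_table_no_second_neighbour(2)
      unfolding list_all_iff by auto
  qed
  show "\<exists>(i, t)\<in>set paw_positions. profile B w = paw_profile i t" if w: "w \<in> V" "w \<notin> set B"
    using prof[OF w] no1[OF w] no2[OF w] by auto
qed

text \<open>The blocks are represented by \<open>x\<close>, \<open>y\<close>, \<open>z\<close>. The
  vertex \<open>y'\<close> is treated as a further vertex in the block of \<open>y\<close>; being
  adjacent to \<open>y\<close>, it makes this block a clique.\<close>

lemma paw_block_dist:
  assumes V: "x \<in> V" "y \<in> V" "y' \<in> V" "z \<in> V" and paw: "paw x y y' z"
  shows "\<exists>f clique. block_dist 3 star_dist clique V d f \<and> clique 1 \<and>
    f x = 0 \<and> f y = 1 \<and> f y' = 1 \<and> f z = 2"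
proof -
  note p = paw[unfolded paw_def]
  define B where "B = [x, y, y', z]"
  note P = paw_position[OF V paw, folded B_def]
  define b where "b i = [x, y, z] ! i" for i
  have lt3: "i < 3 \<longleftrightarrow> i = 0 \<or> i = 1 \<or> i = (2::nat)" for i by auto
  have b: "b 0 = x" "b 1 = y" "b (Suc 0) = y" "b 2 = z" by (simp_all add: b_def)
  have bV: "b i \<in> V" if "i < 3" for i using that V by (auto simp: b lt3)
  have Bset: "set B = insert y' (b ` {..<3})" 
  proof -
    have "{..<3} = {0, 1, 2::nat}" by auto
    thus ?thesis by (auto simp: B_def b)
  qed
  \<comment> \<open>\<open>y'\<close> belongs to the distance table but represents no block, so its
    position 1 is put in by hand.\<close>
  define pos where "pos w i \<longleftrightarrow> w = y' \<and> i = 1 \<or>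
    w \<in> V \<and> w \<notin> set B \<and> (\<exists>t. (int i, t) \<in> set paw_positions \<and> profile B w = paw_profile (int i) t)" for w i
  have y'_b: "y' \<notin> b ` {..<3}" using P(3) by (auto simp: B_def b lt3)
  have "\<exists>f clique. block_dist 3 star_dist clique V d f \<and> (\<forall>i<3. f (b i) = i)"
  proof (rule block_dist_of_bases[where b = b and pos = pos])
    show "(d w (b i) = 1 \<or> d w (b i) = 2) \<and> (\<forall>j<3. j \<noteq> i \<longrightarrow> d w (b j) = star_dist i j)"
      if "pos w i" for w i
      using that p V dist_sym[of y' x] dist_sym[of y' y]
      by (auto simp: pos_def paw_positions_def paw_profile_def B_def b lt3 star_dist_def)
    show "star_dist i j = star_dist j i" for i j by (auto simp: star_dist_def)
    show "star_dist i j \<noteq> 0" for i j by (auto simp: star_dist_def)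
    show "d (b i) (b j) = star_dist i j" if "i < 3" "j < 3" "i \<noteq> j" for i j
      using that p V dist_sym[of y x] dist_sym[of z x] dist_sym[of z y]
      by (auto simp: lt3 b star_dist_def)
    show "\<exists>i<3. pos w i" if w: "w \<in> V" "w \<notin> b ` {..<3}" for w
    proof (cases "w = y'")
      case False
      then obtain i t where it: "(i, t) \<in> set paw_positions" "profile B w = paw_profile i t"
        using P(4)[OF w(1)] w(2) Bset by auto
      hence "0 \<le> i" "i < 3" by (auto simp: paw_positions_def)
      thus ?thesis using it False w Bset by (intro exI[of _ "nat i"]) (auto simp: pos_def)
    qed (intro exI[of _ 1], simp add: pos_def)
    show "if i = j then d w' (b i) = d w (b i) \<and> d w w' = d w (b i) else d w w' = star_dist i j"
      if w: "w \<in> V" "w' \<in> V" "w \<notin> b ` {..<3}" "w' \<notin> b ` {..<3}" "w \<noteq> w'"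
        and ij: "i \<le> j" "j < 3" and pos: "pos w i" "pos w' j" for w w' i j
    proof -
      consider "w = y'" | "w' = y'" | "w \<notin> set B" "w' \<notin> set B" using w Bset by auto
      thus ?thesis
      proof cases
        case 1
        thus ?thesis using pos w ij p V P(3) dist_sym[of y' w'] dist_sym[of y' y]
          by (auto simp: pos_def paw_positions_def paw_profile_def B_def b star_dist_def)
      next
        case 2
        thus ?thesis using pos w ij p V P(3) dist_sym[of y' y]
          by (auto simp: pos_def paw_positions_def paw_profile_def B_def b star_dist_def)
      next
        case 3
        obtain t s where ts: "(int i, t) \<in> set paw_positions" "profile B w = paw_profile (int i) t"
          "(int j, s) \<in> set paw_positions" "profile B w' = paw_profile (int j) s"
          using pos 3 by (auto simp: pos_def B_def)
        have "int (d w' w) \<in> {1, 2}" using dist_1_or_2[OF w(2,1)] w(5) by auto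
        moreover have "\<not> excluded paw_certs6 (extend_table paw_table (paw_profile (int i) t))
            (paw_profile (int j) s @ [int (d w' w)])"
          using not_excluded2[OF P(3,2) w(1,2) 3 w(5), of paw_certs6] P(1) ts by simp
        ultimately have "if int i = int j then t = s \<and> int (d w' w) = t
            else int (d w' w) = join_dist (int i) (int j)"
          using ts ij by (intro paw_table_pair) auto
        moreover have "int (d w (b i)) = t" "int (d w' (b j)) = s"
          using ts by (auto simp: B_def paw_profile_def paw_positions_def b)
        ultimately show ?thesis using dist_sym[OF w(1,2)]
          by (auto simp: join_dist_def star_dist_def split: if_splits)
      qed
    qed
  qed (rule bV)
  then obtain f clique where f: "block_dist 3 star_dist clique V d f" "\<forall>i<3. f (b i) = i" by blast
  have fb: "f x = 0" "f y = 1" "f z = 2"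
    using f(2)[rule_format, of 0] f(2)[rule_format, of 1] f(2)[rule_format, of 2] by (simp_all add: b)
  have fy': "f y' < 3" using f(1) V by (auto simp: block_dist_def)
  have ne: "y \<noteq> y'" "y' \<noteq> z" using P(3) by (auto simp: B_def)
  have f1: "f y' = 1"
    using f(1) V p fb fy' ne unfolding block_dist_def lt3 by (auto simp: star_dist_def split: if_splits)
  moreover have "clique 1"
    using f(1) V p fb f1 ne unfolding block_dist_def by (metis numeral_eq_one_iff semiring_norm(85))
  ultimately show ?thesis using f fb by blast
qed

text \<open>The two blocks are that of the centre \<open>x\<close> and the edgeless block of the
  leaves \<open>y\<close> and \<open>z\<close>. Absence of \<open>paw\<close> complements the
  certificates: where these leave an adjacency open, a triangle with a pendant edge decides
  it.\<close>

lemma pawfree_block_dist: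
  assumes nopaw: "\<And>x y y' z. x \<in> V \<Longrightarrow> y \<in> V \<Longrightarrow> y' \<in> V \<Longrightarrow> z \<in> V \<Longrightarrow> \<not> paw x y y' z"
    and V: "x \<in> V" "y \<in> V" "z \<in> V" and xyz: "d x y = 1" "d x z = 1" "d y z = 2"
  shows "\<exists>f clique. block_dist 2 star_dist clique V d f \<and> \<not> clique 1 \<and> f x = 0 \<and> f y = 1"
proof -
  define B where "B = [x, y, z]"
  have z0: "d v v = 0" if "v \<in> V" for v using dist_eq_0[of v v] that by simp
  have sym: "d y x = 1" "d z x = 1" "d z y = 2" using xyz V dist_sym by auto
  have tab: "dist_table d B = cherry_table"
    using V xyz sym z0 by (simp add: B_def dist_table_def cherry_table_def)
  have BV: "set B \<subseteq> V" using V by (simp add: B_def)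
  have dist: "distinct B" using V xyz z0 by (auto simp: B_def)
  have prof2: "d w x \<in> {1, 2} \<and> d w y \<in> {1, 2} \<and> d w z \<in> {1, 2}" if "w \<in> V" "w \<notin> set B" for w
    using dist_1_or_2[of w x] dist_1_or_2[of w y] dist_1_or_2[of w z] that V by (auto simp: B_def)
  have ex: "d u w \<noteq> m" if "w \<in> V" "u \<in> V" "w \<notin> set B" "u \<notin> set B" "w \<noteq> u"
      "([int (d w x), int (d w y), int (d w z)], [int (d u x), int (d u y), int (d u z)], int m) \<in>
        {([1,1,1], [2,2,2], 1), ([2,1,2], [2,2,2], 1), ([1,1,1], [2,1,2], 1), ([2,1,1], [2,1,2], 1),
        ([2,2,1], [2,1,2], 1), ([1,1,1], [2,2,1], 1), ([2,1,1], [2,2,1], 1), ([2,1,2], [2,2,1], 1),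
        ([1,1,1], [2,1,1], 1), ([1,1,1], [1,1,1], 2), ([1,1,1], [1,2,2], 2)}" for w u m
  proof
    assume "d u w = m"
    hence "\<not> excluded cherry_certs5 (extend_table cherry_table (profile B w)) (profile B u @ [int m])"
      using not_excluded2[OF dist BV that(1-5), of cherry_certs5] tab by simp
    thus False using cherry_table_excluded that(6) unfolding list_all_iff B_def by force
  qed
  define P where "P w a b c \<longleftrightarrow> w \<in> V \<and> w \<notin> set B \<and> d w x = a \<and> d w y = b \<and> d w z = c" for w a b c
  \<comment> \<open>A vertex adjacent to the centre and to exactly one leaf forms a triangle with
    them, and the other leaf is pendant.\<close>
  have n112: "\<not> P w 1 1 2" "\<not> P w 1 2 1" for w
    using nopaw[of x w y z] nopaw[of x w z y] V xyz sym dist_sym[of w x]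
    by (auto simp: P_def paw_def)
  have cases: "P w 1 1 1 \<or> P w 2 1 1 \<or> P w 1 2 2 \<or> P w 2 1 2 \<or> P w 2 2 1 \<or> P w 2 2 2"
    if "w \<in> V" "w \<notin> set B" for w
    using prof2[OF that] n112[of w] that by (auto simp: P_def)
  have exP: "d w u \<noteq> 1" if "P w a b c" "P u a' b' c'"
      "([int a, int b, int c], [int a', int b', int c']) \<in>
        {([1,1,1], [2,2,2]), ([2,1,2], [2,2,2]), ([1,1,1], [2,1,2]), ([2,1,1], [2,1,2]),
        ([2,2,1], [2,1,2]), ([1,1,1], [2,2,1]), ([2,1,1], [2,2,1]), ([2,1,2], [2,2,1]),
        ([1,1,1], [2,1,1])}" for w u a b c a' b' c'
  proof -
    have "w \<noteq> u" using that by (auto simp: P_def)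
    hence "d u w \<noteq> 1" by (rule ex[rotated 4]) (use that in \<open>auto simp: P_def\<close>)
    thus ?thesis using that dist_sym[of u w] by (simp add: P_def)
  qed
  \<comment> \<open>Such a \<open>w\<close> has a common neighbour with the leaf \<open>z\<close>,
    but every profile left for that neighbour forbids its edge to \<open>w\<close>.\<close>
  have n212: "\<not> P w 2 1 2" for w
  proof
    assume w: "P w 2 1 2"
    then obtain u where u: "u \<in> V" "d w u = 1" "d u z = 1"
      using common_neighbour[of w z] V by (auto simp: P_def)
    have uB: "u \<notin> set B" using u w sym z0 V xyz by (auto simp: P_def B_def)
    have "d u w = 1" using u w dist_sym by (auto simp: P_def)
    moreover have "P u 1 1 1 \<or> P u 2 1 1 \<or> P u 2 2 1"
      using cases[OF u(1) uB] u(3) by (auto simp: P_def)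
    ultimately show False using exP[of u _ _ _ w 2 1 2] w by auto
  qed
  have n221: "\<not> P w 2 2 1" for w
  proof
    assume w: "P w 2 2 1"
    then obtain u where u: "u \<in> V" "d w u = 1" "d u y = 1"
      using common_neighbour[of w y] V by (auto simp: P_def)
    have uB: "u \<notin> set B" using u w sym z0 V xyz by (auto simp: P_def B_def)
    have "d u w = 1" using u w dist_sym by (auto simp: P_def)
    moreover have "P u 1 1 1 \<or> P u 2 1 1"
      using cases[OF u(1) uB] u(3) n212[of u] by (auto simp: P_def)
    ultimately show False using exP[of u _ _ _ w 2 2 1] w by auto
  qed
  \<comment> \<open>\<open>w\<close> has no base neighbour. Take a common neighbour \<open>u\<close>
    with \<open>x\<close> and \<open>v\<close> with \<open>y\<close>. If \<open>u\<close> and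
    \<open>v\<close> are adjacent, \<open>u\<close>, \<open>v\<close>, \<open>w\<close> is a
    triangle with pendant vertex \<open>x\<close>; otherwise \<open>x\<close>, \<open>y\<close>,
    \<open>v\<close>, \<open>w\<close>, \<open>u\<close> is a pentagon.\<close>
  have n222: "\<not> P w 2 2 2" for w
  proof
    assume w: "P w 2 2 2"
    hence wV: "w \<in> V" by (simp add: P_def)
    obtain u where u: "u \<in> V" "d w u = 1" "d u x = 1"
      using common_neighbour[of w x] V w by (auto simp: P_def)
    have uB: "u \<notin> set B" using u w sym z0 V xyz by (auto simp: P_def B_def)
    have uw: "d u w = 1" using u w dist_sym by (auto simp: P_def)
    have "P u 1 1 1 \<or> P u 1 2 2" using cases[OF u(1) uB] u(3) by (auto simp: P_def)
    hence Pu: "P u 1 2 2" using exP[of u _ _ _ w 2 2 2] w uw by auto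
    obtain v where v: "v \<in> V" "d w v = 1" "d v y = 1"
      using common_neighbour[of w y] V w by (auto simp: P_def)
    have vB: "v \<notin> set B" using v w sym z0 V xyz by (auto simp: P_def B_def)
    have vw: "d v w = 1" using v w dist_sym by (auto simp: P_def)
    have "P v 1 1 1 \<or> P v 2 1 1" using cases[OF v(1) vB] v(3) n212[of v] by (auto simp: P_def)
    hence Pv: "P v 2 1 1" using exP[of v _ _ _ w 2 2 2] w vw by auto
    have "u \<noteq> v" using Pu Pv by (auto simp: P_def)
    with dist_1_or_2[OF u(1) v(1)] consider "d u v = 1" | "d u v = 2" by auto
    thus False
    proof cases
      case 1
      have "paw u v w x" using 1 uw vw Pu Pv w by (simp add: paw_def P_def)
      thus False using nopaw u v wV V by blast
    next
      case 2
      have dist5: "distinct [x, y, v, w, u]"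
        using uB vB w V dist \<open>u \<noteq> v\<close> u v z0 by (auto simp: P_def B_def)
      have tab5: "dist_table d [x, y, v, w, u] =
          [[0,1,2,2,1], [1,0,1,2,2], [2,1,0,1,2], [2,2,1,0,1], [1,2,2,1,0]]"
        using xyz sym Pu Pv w vw uw 2 z0 V u v wV dist_sym[of x v] dist_sym[of x w] dist_sym[of x u]
          dist_sym[of y v] dist_sym[of y w] dist_sym[of y u] dist_sym[of v u]
        by (simp add: dist_table_def P_def)
      have "\<not> refutes (dist_table d [x, y, v, w, u]) cs" for cs
        by (rule not_refutes[OF dist5]) (use V u v wV in simp)
      thus False unfolding tab5 using cycle5_refuted by blast
    qed
  qed
  have P3: "P w 1 1 1 \<or> P w 2 1 1 \<or> P w 1 2 2" if "w \<in> V" "w \<notin> set B" for w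
    using cases[OF that] n212 n221 n222 by blast
  define b where "b i = [x, y] ! i" for i
  have lt2: "i < 2 \<longleftrightarrow> i = 0 \<or> i = (1::nat)" for i by auto
  have b: "b 0 = x" "b 1 = y" "b (Suc 0) = y" by (simp_all add: b_def)
  have Bset: "set B = insert z (b ` {..<2})" 
  proof -
    have "{..<2} = {0, 1::nat}" by auto
    thus ?thesis by (auto simp: B_def b)
  qed
  define pos where "pos w i \<longleftrightarrow> w = z \<and> i = 1 \<or> i = 0 \<and> (P w 1 1 1 \<or> P w 2 1 1) \<or> i = 1 \<and> P w 1 2 2"
    for w and i :: nat
  have "\<exists>f clique. block_dist 2 star_dist clique V d f \<and> (\<forall>i<2. f (b i) = i)"
  proof (rule block_dist_of_bases[where b = b and pos = pos])
    show "(d w (b i) = 1 \<or> d w (b i) = 2) \<and> (\<forall>j<2. j \<noteq> i \<longrightarrow> d w (b j) = star_dist i j)"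
      if "pos w i" for w i
      using that sym by (auto simp: pos_def P_def b lt2 star_dist_def)
    show "b i \<in> V" if "i < 2" for i using that V by (auto simp: b lt2)
    show "star_dist i j = star_dist j i" for i j by (auto simp: star_dist_def)
    show "star_dist i j \<noteq> 0" for i j by (auto simp: star_dist_def)
    show "d (b i) (b j) = star_dist i j" if "i < 2" "j < 2" "i \<noteq> j" for i j
      using that xyz sym by (auto simp: lt2 b star_dist_def)
    show "\<exists>i<2. pos w i" if w: "w \<in> V" "w \<notin> b ` {..<2}" for w
      using P3[OF w(1)] w Bset unfolding pos_def lt2 by blast
    show "if i = j then d w' (b i) = d w (b i) \<and> d w w' = d w (b i) else d w w' = star_dist i j"
      if w: "w \<in> V" "w' \<in> V" "w \<notin> b ` {..<2}" "w' \<notin> b ` {..<2}" "w \<noteq> w'"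
        and ij: "i \<le> j" "j < 2" and pos: "pos w i" "pos w' j" for w w' i j
    proof -
      have dw: "d w w' = 1 \<or> d w w' = 2" "d w' w = d w w'" using dist_1_or_2 dist_sym w by auto
      have e2: "d w w' \<noteq> 2" if "P w 1 1 1" "P w' 1 1 1 \<or> P w' 1 2 2"
        using ex[of w w' 2] that w dw(2) by (auto simp: P_def)
      \<comment> \<open>K, E and Z stand for the profiles 111, 211 and 122. K and E lie in the block
        of the centre, adjacent or not adjacent to \<open>x\<close>; Z lies in the block of the
        leaves. The leaf \<open>z\<close> is treated apart, as it represents no block.\<close>
      consider (z1) "w = z" | (z2) "w' = z" | (KK) "P w 1 1 1" "P w' 1 1 1"
        | (KE) "P w 1 1 1" "P w' 2 1 1" | (EK) "P w 2 1 1" "P w' 1 1 1"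
        | (EE) "P w 2 1 1" "P w' 2 1 1" | (KZ) "P w 1 1 1" "P w' 1 2 2"
        | (EZ) "P w 2 1 1" "P w' 1 2 2" | (ZZ) "P w 1 2 2" "P w' 1 2 2"
        using pos ij unfolding pos_def by auto
      thus ?thesis
      proof cases
        case z1
        have "z \<notin> set B \<longleftrightarrow> False" by (simp add: B_def)
        with z1 show ?thesis using pos ij w sym dist_sym[of z w'] V
          by (auto simp: pos_def P_def b)
      next
        case z2
        have "z \<notin> set B \<longleftrightarrow> False" by (simp add: B_def)
        with z2 show ?thesis using pos ij w sym
          by (auto simp: pos_def P_def b star_dist_def)
      next
        case KK
        thus ?thesis using e2 dw pos ij by (auto simp: pos_def P_def b B_def)
      next
        case KE
        \<comment> \<open>The triangle \<open>y\<close>, \<open>w\<close>, \<open>x\<close> with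
          pendant vertex \<open>w'\<close> shows that the block of the centre cannot mix both
          types.\<close>
        hence "d w w' \<noteq> 1" using exP[of w _ _ _ w' 2 1 1] by auto
        moreover have "d y w = 1" "d y w' = 1" using KE V dist_sym[of y w] dist_sym[of y w'] by (auto simp: P_def)
        ultimately have "paw y w x w'" using KE dw sym dist_sym[of x w'] V by (auto simp: paw_def P_def)
        thus ?thesis using nopaw w V by blast
      next
        case EK
        hence "d w' w \<noteq> 1" using exP[of w' _ _ _ w 2 1 1] by auto
        moreover have "d y w = 1" "d y w' = 1" using EK V dist_sym[of y w] dist_sym[of y w'] by (auto simp: P_def)
        ultimately have "paw y w' x w" using EK dw sym dist_sym[of x w] V by (auto simp: paw_def P_def)
        thus ?thesis using nopaw w V by blast
      next
        case EE
        have "d y w = 1" "d y w' = 1" using EE V dist_sym[of y w] dist_sym[of y w'] by (auto simp: P_def)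
        hence "d w w' = 1 \<Longrightarrow> paw y w w' x" using EE sym by (auto simp: paw_def P_def)
        hence "d w w' = 2" using nopaw w V dw by blast
        thus ?thesis using EE pos ij by (auto simp: pos_def P_def b B_def)
      next
        case KZ
        thus ?thesis using e2 dw pos ij by (auto simp: pos_def P_def b B_def star_dist_def)
      next
        case EZ
        \<comment> \<open>If the two were not adjacent they would have a common neighbour, and each
          of its possible profiles gives a forbidden table or a triangle with a pendant
          edge.\<close>
        have "d w w' = 1"
        proof (rule ccontr)
          assume "d w w' \<noteq> 1"
          hence "d w w' = 2" using dw by simp
          then obtain u where u: "u \<in> V" "d w u = 1" "d u w' = 1" using common_neighbour w by blast
          have uB: "u \<notin> set B"
            using u EZ V dist_sym[of w' y] dist_sym[of w' z] by (auto simp: P_def B_def)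
          have uw: "d u w = 1" using u w dist_sym by auto
          from P3[OF u(1) uB] consider "P u 1 1 1" | "P u 2 1 1" | "P u 1 2 2" by blast
          thus False
          proof cases
            case 1
            thus False using exP[of u _ _ _ w 2 1 1] EZ uw by auto
          next
            case 2
            have "d y w = 1" "d y u = 1" using EZ 2 V dist_sym[of y w] dist_sym[of y u] by (auto simp: P_def)
            hence "paw y w u x" using EZ 2 u sym by (auto simp: paw_def P_def)
            thus False using nopaw w u V by blast
          next
            case 3
            have "d x w' = 1" "d x u = 1" using EZ 3 V dist_sym[of x w'] dist_sym[of x u] by (auto simp: P_def)
            hence "paw x u w' y" using EZ 3 u xyz by (auto simp: paw_def P_def)
            thus False using nopaw w u V by blast
          qed
        qed
        thus ?thesis using EZ pos ij by (auto simp: pos_def P_def b B_def star_dist_def)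
      next
        case ZZ
        have "d x w = 1" "d x w' = 1" using ZZ V dist_sym[of x w] dist_sym[of x w'] by (auto simp: P_def)
        hence "d w w' = 1 \<Longrightarrow> paw x w w' y" using ZZ xyz by (auto simp: paw_def P_def)
        hence "d w w' = 2" using nopaw w V dw by blast
        thus ?thesis using ZZ pos ij by (auto simp: pos_def P_def b B_def)
      qed
    qed
  qed
  then obtain f clique where f: "block_dist 2 star_dist clique V d f" "\<forall>i<2. f (b i) = i" by blast
  have fb: "f x = 0" "f y = 1"
    using f(2)[rule_format, of 0] f(2)[rule_format, of 1] by (simp_all add: b)
  have "f z < 2" using f(1) V by (auto simp: block_dist_def)
  moreover have ne: "z \<noteq> y" using dist by (auto simp: B_def)
  ultimately have fz: "f z = 1"
    using f(1) V sym fb unfolding block_dist_def lt2 by (auto simp: star_dist_def split: if_splits)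
  have "\<not> clique 1" using f(1) V sym fb fz ne unfolding block_dist_def by auto
  with f fb show ?thesis by blast
qed

end

end

section \<open>Quadratic forms in the block sums\<close>

text \<open>\<open>s i\<close> plays the role of the sum of a vector over block \<open>i\<close>.
  Sizes enter only through the diagonal \<open>c\<close>, so monotonicity in \<open>c\<close>
  compares graphs with different sizes.\<close>

definition bform :: "nat \<Rightarrow> (nat \<Rightarrow> real) \<Rightarrow> (nat \<Rightarrow> nat \<Rightarrow> nat) \<Rightarrow> (nat \<Rightarrow> real) \<Rightarrow> real" where
  "bform k c m s = (\<Sum>i<k. \<Sum>j<k. (if i = j then c i else real (m i j)) * s i * s j)"

definition bcond3 :: "nat \<Rightarrow> (nat \<Rightarrow> real) \<Rightarrow> (nat \<Rightarrow> nat \<Rightarrow> nat) \<Rightarrow> bool" where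
  "bcond3 k c m \<longleftrightarrow> (\<exists>p q. \<forall>s. (\<Sum>i<k. p i * s i) = 0 \<longrightarrow> (\<Sum>i<k. q i * s i) = 0 \<longrightarrow> bform k c m s \<le> 0)"

definition bcond2 :: "nat \<Rightarrow> (nat \<Rightarrow> real) \<Rightarrow> (nat \<Rightarrow> nat \<Rightarrow> nat) \<Rightarrow> bool" where
  "bcond2 k c m \<longleftrightarrow> (\<exists>p. \<forall>s. (\<Sum>i<k. p i * s i) = 0 \<longrightarrow> bform k c m s \<ge> 0)"

lemma bform_diag: "bform k (\<lambda>i. c i + e i) m s = bform k c m s + (\<Sum>i<k. e i * (s i)\<^sup>2)"
proof -
  have "bform k (\<lambda>i. c i + e i) m s =
      (\<Sum>i<k. \<Sum>j<k. (if i = j then c i else real (m i j)) * s i * s j + (if i = j then e i * s i * s j else 0))"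
    unfolding bform_def by (intro sum.cong refl) (simp add: algebra_simps)
  also have "\<dots> = bform k c m s + (\<Sum>i<k. \<Sum>j<k. if i = j then e i * s i * s j else 0)"
    by (simp add: bform_def sum.distrib)
  also have "(\<Sum>i<k. \<Sum>j<k. if i = j then e i * s i * s j else 0) = (\<Sum>i<k. e i * (s i)\<^sup>2)"
    by (intro sum.cong refl) (simp add: power2_eq_square)
  finally show ?thesis .
qed

lemma bform_mono:
  assumes "\<And>i. i < k \<Longrightarrow> c i \<le> c' i"
  shows "bform k c m s \<le> bform k c' m s"
proof -
  have "bform k c' m s = bform k c m s + (\<Sum>i<k. (c' i - c i) * (s i)\<^sup>2)"
    using bform_diag[of k c "\<lambda>i. c' i - c i" m s] by simp
  moreover have "(\<Sum>i<k. (c' i - c i) * (s i)\<^sup>2) \<ge> 0" using assms by (intro sum_nonneg) auto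
  ultimately show ?thesis by linarith
qed

text \<open>A smaller diagonal lowers the form, so the same functionals work. Checking extremal
  diagonals therefore settles whole families of sizes.\<close>

lemma bcond3_antimono:
  assumes "bcond3 k c' m" and "\<And>i. i < k \<Longrightarrow> c i \<le> c' i"
  shows "bcond3 k c m"
  using assms(1) bform_mono[of k c c' m] assms(2) unfolding bcond3_def by (meson order_trans)

lemma bcond2_mono:
  assumes "bcond2 k c m" and "\<And>i. i < k \<Longrightarrow> c i \<le> c' i"
  shows "bcond2 k c' m"
  using assms(1) bform_mono[of k c c' m] assms(2) unfolding bcond2_def by (meson order_trans)

text \<open>The squared deviations from the mean \<open>a\<close> have a nonnegative sum. For an
  empty \<open>B\<close> the left-hand side is 0.\<close>

lemma sum_power2_ge_mean:
  fixes x :: "'a \<Rightarrow> real"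
  assumes "finite B"
  shows "(\<Sum>v\<in>B. x v)\<^sup>2 / card B \<le> (\<Sum>v\<in>B. (x v)\<^sup>2)"
proof (cases "card B = 0")
  case False
  define a where "a = (\<Sum>v\<in>B. x v) / card B"
  have s: "(\<Sum>v\<in>B. x v) = card B * a" using False by (simp add: a_def)
  have "0 \<le> (\<Sum>v\<in>B. (x v - a)\<^sup>2)" by (intro sum_nonneg) auto
  also have "\<dots> = (\<Sum>v\<in>B. (x v)\<^sup>2) - 2 * a * (\<Sum>v\<in>B. x v) + card B * a\<^sup>2"
  proof -
    have "(x v - a)\<^sup>2 = (x v)\<^sup>2 - 2 * a * x v + a\<^sup>2" for v
      by (simp add: power2_eq_square algebra_simps)
    thus ?thesis by (simp add: sum.distrib sum_subtractf sum_distrib_left)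
  qed
  also have "\<dots> = (\<Sum>v\<in>B. (x v)\<^sup>2) - card B * a\<^sup>2"
    unfolding s by (simp add: power2_eq_square)
  finally show ?thesis unfolding s using False by (simp add: power2_eq_square mult_ac)
qed (simp add: sum_nonneg)

lemma sum_blocks:
  fixes g :: "nat \<Rightarrow> real"
  assumes "finite V" "f ` V \<subseteq> {..<k}"
  shows "(\<Sum>v\<in>V. g (f v) * x v) = (\<Sum>i<k. g i * (\<Sum>v\<in>{v\<in>V. f v = i}. x v))"
proof -
  have "(\<Sum>v\<in>V. g (f v) * x v) = (\<Sum>i<k. \<Sum>v\<in>{v\<in>V. f v = i}. g (f v) * x v)"
    using assms by (intro sum.group[symmetric]) auto
  also have "\<dots> = (\<Sum>i<k. g i * (\<Sum>v\<in>{v\<in>V. f v = i}. x v))"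
    unfolding sum_distrib_left by (intro sum.cong refl) auto
  finally show ?thesis .
qed

context dist_space begin

text \<open>Inside block \<open>i\<close> the distance is \<open>c i\<close> off the diagonal and 0
  on it. Filling the diagonal with \<open>c i\<close> makes the distance form depend on block sums
  only; what is left over is the multiple \<open>t - c i\<close> of a sum of squares.\<close>

lemma shifted_form_blocks:
  assumes blk: "block_dist k m clique V d f"
  defines "c \<equiv> \<lambda>i. if clique i then 1 else 2 :: real"
  defines "S \<equiv> \<lambda>x i. \<Sum>v\<in>{v\<in>V. f v = i}. x v :: real"
  shows "shifted_form t V d x x =
    bform k c m (S x) + (\<Sum>i<k. (t - c i) * S (\<lambda>v. (x v)\<^sup>2) i)"
proof -
  have fk: "f ` V \<subseteq> {..<k}" using blk by (simp add: block_dist_def)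
  note sb = sum_blocks[OF fin fk]
  define M where "M i j = (if i = j then c i else real (m i j))" for i j
  have duv: "real (d u v) = M (f u) (f v) - (if u = v then c (f u) else 0)" if "u \<in> V" "v \<in> V" for u v
    using blk that dist_eq_0[of u v] unfolding block_dist_def by (auto simp: M_def c_def)
  have "(\<Sum>u\<in>V. \<Sum>v\<in>V. real (d u v) * x u * x v) =
      (\<Sum>u\<in>V. \<Sum>v\<in>V. M (f u) (f v) * x u * x v - (if u = v then c (f u) * x u * x v else 0))"
    by (intro sum.cong refl) (simp add: duv algebra_simps)
  also have "\<dots> = (\<Sum>u\<in>V. \<Sum>v\<in>V. M (f u) (f v) * x u * x v) - (\<Sum>u\<in>V. c (f u) * (x u)\<^sup>2)"
    using fin by (simp add: sum_subtractf power2_eq_square mult.assoc)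
  also have "(\<Sum>u\<in>V. \<Sum>v\<in>V. M (f u) (f v) * x u * x v) =
      (\<Sum>u\<in>V. (\<Sum>v\<in>V. M (f u) (f v) * x v) * x u)"
    by (simp add: sum_distrib_left sum_distrib_right mult_ac)
  also have "\<dots> = (\<Sum>u\<in>V. (\<Sum>j<k. M (f u) j * S x j) * x u)"
    unfolding sb S_def ..
  also have "\<dots> = (\<Sum>i<k. (\<Sum>j<k. M i j * S x j) * S x i)"
    using sb[of "\<lambda>i. \<Sum>j<k. M i j * S x j" x] by (simp add: S_def)
  also have "\<dots> = bform k c m (S x)"
    unfolding bform_def M_def sum_distrib_right by (intro sum.cong refl) (simp add: mult_ac)
  finally have 1: "(\<Sum>u\<in>V. \<Sum>v\<in>V. real (d u v) * x u * x v)
      = bform k c m (S x) - (\<Sum>u\<in>V. c (f u) * (x u)\<^sup>2)" .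
  have "(\<Sum>i<k. (t - c i) * S (\<lambda>v. (x v)\<^sup>2) i) = (\<Sum>u\<in>V. (t - c (f u)) * (x u)\<^sup>2)"
    using sb[of "\<lambda>i. t - c i" "\<lambda>v. (x v)\<^sup>2"] by (simp add: S_def)
  also have "\<dots> = t * (\<Sum>u\<in>V. x u * x u) - (\<Sum>u\<in>V. c (f u) * (x u)\<^sup>2)"
    by (simp add: algebra_simps sum_subtractf sum_distrib_left power2_eq_square)
  finally show ?thesis by (simp add: shifted_form_def 1)
qed

text \<open>For \<open>t = 1\<close> the factors \<open>t - c i\<close> are 0 or -1, for
  \<open>t = 2\<close> they are 1 or 0. In both cases Cauchy-Schwarz bounds the sum of squares in
  the direction needed, and this produces the entries \<open>2 - 1 / n i\<close> and
  \<open>1 + 1 / n i\<close>. For an empty block \<open>1 / n i\<close> is 0, as are the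
  sums.\<close>

lemma
  assumes blk: "block_dist k m clique V d f"
  defines "n \<equiv> \<lambda>i. real (card {v\<in>V. f v = i})"
  shows lam3_cond_of_blocks: "bcond3 k (\<lambda>i. if clique i then 1 else 2 - 1 / n i) m \<Longrightarrow> lam3_cond V d"
    and lam_penult_cond_of_blocks: "bcond2 k (\<lambda>i. if clique i then 1 + 1 / n i else 2) m \<Longrightarrow> lam_penult_cond V d"
proof -
  define S where "S x i = (\<Sum>v\<in>{v\<in>V. f v = i}. x v)" for x :: "'a \<Rightarrow> real" and i
  define c where "c i = (if clique i then 1 else 2 :: real)" for i
  have fk: "f ` V \<subseteq> {..<k}" using blk by (simp add: block_dist_def)
  note form = shifted_form_blocks[OF blk, folded S_def c_def]
  have pS: "(\<Sum>v\<in>V. p (f v) * x v) = (\<Sum>i<k. p i * S x i)" for p x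
    unfolding S_def by (rule sum_blocks[OF fin fk])
  have le: "(S x i)\<^sup>2 / n i \<le> S (\<lambda>v. (x v)\<^sup>2) i" for x i
    unfolding S_def n_def using fin by (intro sum_power2_ge_mean) auto
  show "lam3_cond V d" if "bcond3 k (\<lambda>i. if clique i then 1 else 2 - 1 / n i) m"
  proof -
    obtain p q where pq: "\<And>s. (\<Sum>i<k. p i * s i) = 0 \<Longrightarrow> (\<Sum>i<k. q i * s i) = 0 \<Longrightarrow>
        bform k (\<lambda>i. if clique i then 1 else 2 - 1 / n i) m s \<le> 0"
      using \<open>bcond3 _ _ _\<close> unfolding bcond3_def by blast
    show ?thesis unfolding lam3_cond_iff
    proof (rule exI[of _ "\<lambda>v. p (f v)"], rule exI[of _ "\<lambda>v. q (f v)"], intro allI impI)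
      fix x assume "(\<Sum>v\<in>V. p (f v) * x v) = 0" "(\<Sum>v\<in>V. q (f v) * x v) = 0"
      hence "bform k (\<lambda>i. if clique i then 1 else 2 - 1 / n i) m (S x) \<le> 0" unfolding pS by (rule pq)
      moreover have "(\<lambda>i. if clique i then 1 else 2 - 1 / n i) = (\<lambda>i. c i + (if clique i then 0 else - 1 / n i))"
        by (auto simp: c_def)
      ultimately have "bform k c m (S x) + (\<Sum>i<k. (if clique i then 0 else - 1 / n i) * (S x i)\<^sup>2) \<le> 0"
        by (simp only: bform_diag)
      moreover have "(\<Sum>i<k. (1 - c i) * S (\<lambda>v. (x v)\<^sup>2) i) \<le> (\<Sum>i<k. (if clique i then 0 else - 1 / n i) * (S x i)\<^sup>2)"
        using le by (intro sum_mono) (auto simp: c_def)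
      ultimately show "shifted_form 1 V d x x \<le> 0" unfolding form by linarith
    qed
  qed
  show "lam_penult_cond V d" if "bcond2 k (\<lambda>i. if clique i then 1 + 1 / n i else 2) m"
  proof -
    obtain p where p: "\<And>s. (\<Sum>i<k. p i * s i) = 0 \<Longrightarrow>
        bform k (\<lambda>i. if clique i then 1 + 1 / n i else 2) m s \<ge> 0"
      using \<open>bcond2 _ _ _\<close> unfolding bcond2_def by blast
    show ?thesis unfolding lam_penult_cond_iff
    proof (rule exI[of _ "\<lambda>v. p (f v)"], intro allI impI)
      fix x assume "(\<Sum>v\<in>V. p (f v) * x v) = 0"
      hence "bform k (\<lambda>i. if clique i then 1 + 1 / n i else 2) m (S x) \<ge> 0" unfolding pS by (rule p)
      moreover have "(\<lambda>i. if clique i then 1 + 1 / n i else 2) = (\<lambda>i. c i + (if clique i then 1 / n i else 0))"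
        by (auto simp: c_def)
      ultimately have "bform k c m (S x) + (\<Sum>i<k. (if clique i then 1 / n i else 0) * (S x i)\<^sup>2) \<ge> 0"
        by (simp only: bform_diag)
      moreover have "(\<Sum>i<k. (2 - c i) * S (\<lambda>v. (x v)\<^sup>2) i) \<ge> (\<Sum>i<k. (if clique i then 1 / n i else 0) * (S x i)\<^sup>2)"
        using le by (intro sum_mono) (auto simp: c_def)
      ultimately show "shifted_form 2 V d x x \<ge> 0" unfolding form by linarith
    qed
  qed
qed

text \<open>The converse tests vectors constant on blocks, for which Cauchy-Schwarz is an equality.
  Nonempty blocks make all block sums attainable, and a functional on vertices becomes one on block
  sums by averaging over blocks.\<close>

lemma
  assumes blk: "block_dist k m clique V d f" and ne: "{..<k} \<subseteq> f ` V"
  defines "n \<equiv> \<lambda>i. real (card {v\<in>V. f v = i})"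
  shows blocks_of_lam3_cond: "lam3_cond V d \<Longrightarrow> bcond3 k (\<lambda>i. if clique i then 1 else 2 - 1 / n i) m"
    and blocks_of_lam_penult_cond: "lam_penult_cond V d \<Longrightarrow> bcond2 k (\<lambda>i. if clique i then 1 + 1 / n i else 2) m"
proof -
  define S where "S x i = (\<Sum>v\<in>{v\<in>V. f v = i}. x v)" for x :: "'a \<Rightarrow> real" and i
  define c where "c i = (if clique i then 1 else 2 :: real)" for i
  have fk: "f ` V \<subseteq> {..<k}" using blk by (simp add: block_dist_def)
  note form = shifted_form_blocks[OF blk, folded S_def c_def]
  have n: "n i > 0" if "i < k" for i
    using that ne fin unfolding n_def by (auto simp: card_gt_0_iff)
  define lift where "lift s v = s (f v) / n (f v)" for s v
  have S1: "S (lift s) i = s i" if "i < k" for s i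
  proof -
    have "S (lift s) i = (\<Sum>v\<in>{v\<in>V. f v = i}. s i / n i)" unfolding S_def lift_def by (intro sum.cong) auto
    thus ?thesis using n[OF that] by (simp add: n_def)
  qed
  have S2: "S (\<lambda>v. (lift s v)\<^sup>2) i = (s i)\<^sup>2 / n i" if "i < k" for s i
  proof -
    have "S (\<lambda>v. (lift s v)\<^sup>2) i = (\<Sum>v\<in>{v\<in>V. f v = i}. (s i / n i)\<^sup>2)"
      unfolding S_def lift_def by (intro sum.cong) auto
    thus ?thesis using n[OF that] by (simp add: n_def power2_eq_square)
  qed
  have val: "shifted_form t V d (lift s) (lift s) = bform k (\<lambda>i. c i + (t - c i) / n i) m s" for t s
  proof -
    have "bform k c m (S (lift s)) = bform k c m s" unfolding bform_def by (intro sum.cong refl) (simp add: S1)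
    moreover have "(\<Sum>i<k. (t - c i) * S (\<lambda>v. (lift s v)\<^sup>2) i) = (\<Sum>i<k. (t - c i) / n i * (s i)\<^sup>2)"
      by (intro sum.cong refl) (simp add: S2)
    ultimately show ?thesis by (simp only: form bform_diag)
  qed
  have pl: "(\<Sum>v\<in>V. p v * lift s v) = (\<Sum>i<k. (S p i / n i) * s i)" for p s
  proof -
    have "(\<Sum>v\<in>V. p v * lift s v) = (\<Sum>v\<in>V. (\<lambda>i. s i / n i) (f v) * p v)" by (simp add: lift_def mult_ac)
    also have "\<dots> = (\<Sum>i<k. s i / n i * S p i)" unfolding S_def by (rule sum_blocks[OF fin fk])
    finally show ?thesis by (simp add: mult_ac)
  qed
  have c1: "(\<lambda>i. c i + (1 - c i) / n i) = (\<lambda>i. if clique i then 1 else 2 - 1 / n i)"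
    "(\<lambda>i. c i + (2 - c i) / n i) = (\<lambda>i. if clique i then 1 + 1 / n i else 2)"
    by (auto simp: c_def)
  show "bcond3 k (\<lambda>i. if clique i then 1 else 2 - 1 / n i) m" if "lam3_cond V d"
  proof -
    obtain p q where pq: "\<And>x. (\<Sum>v\<in>V. p v * x v) = 0 \<Longrightarrow> (\<Sum>v\<in>V. q v * x v) = 0 \<Longrightarrow>
        shifted_form 1 V d x x \<le> 0" using \<open>lam3_cond V d\<close> unfolding lam3_cond_iff by blast
    show ?thesis unfolding bcond3_def
      by (rule exI[of _ "\<lambda>i. S p i / n i"], rule exI[of _ "\<lambda>i. S q i / n i"])
        (use pq[unfolded pl, where x = "lift _", unfolded pl val c1] in blast)
  qed
  show "bcond2 k (\<lambda>i. if clique i then 1 + 1 / n i else 2) m" if "lam_penult_cond V d"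
  proof -
    obtain p where p: "\<And>x. (\<Sum>v\<in>V. p v * x v) = 0 \<Longrightarrow> shifted_form 2 V d x x \<ge> 0"
      using \<open>lam_penult_cond V d\<close> unfolding lam_penult_cond_iff by blast
    show ?thesis unfolding bcond2_def
      by (rule exI[of _ "\<lambda>i. S p i / n i"]) (use p[where x = "lift _", unfolded pl val c1] in blast)
  qed
qed

end

section \<open>The reduced forms for four blocks along a path and three blocks in a star\<close>

lemma bform_path: "bform 4 c path_dist s = c 0 * (s 0)\<^sup>2 + c 1 * (s 1)\<^sup>2 + c 2 * (s 2)\<^sup>2 + c 3 * (s 3)\<^sup>2
    + 2 * s 0 * s 1 + 4 * s 0 * s 2 + 6 * s 0 * s 3 + 2 * s 1 * s 2 + 4 * s 1 * s 3 + 2 * s 2 * s 3"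
  by (simp add: bform_def path_dist_def numeral_eq_Suc power2_eq_square)

lemma bform_star: "bform 3 c star_dist s = c 0 * (s 0)\<^sup>2 + c 1 * (s 1)\<^sup>2 + c 2 * (s 2)\<^sup>2
    + 2 * s 0 * s 1 + 2 * s 0 * s 2 + 4 * s 1 * s 2"
  by (simp add: bform_def star_dist_def numeral_eq_Suc power2_eq_square)

lemma sum_lessThan_4: "(\<Sum>i<4. g i) = g 0 + g 1 + g 2 + g (3::nat)" for g :: "nat \<Rightarrow> real"
  by (simp add: numeral_eq_Suc)

lemma sum_lessThan_3: "(\<Sum>i<3. g i) = g 0 + g 1 + g (2::nat)" for g :: "nat \<Rightarrow> real"
  by (simp add: numeral_eq_Suc)

text \<open>The distances \<open>path_dist\<close> are invariant under
  \<open>i \<mapsto> 3 - i\<close>, so diagonals matter only up to reversal.\<close>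

lemma bcond_path_reverse:
  shows "bcond3 4 (\<lambda>i. c (3 - i)) path_dist \<longleftrightarrow> bcond3 4 c path_dist"
    and "bcond2 4 (\<lambda>i. c (3 - i)) path_dist \<longleftrightarrow> bcond2 4 c path_dist"
proof -
  have rev: "bform 4 (\<lambda>i. c (3 - i)) path_dist s = bform 4 c path_dist (\<lambda>i. s (3 - i))" for c s
    by (simp add: bform_path)
  have lin: "(\<Sum>i<4. p (3 - i) * s i) = (\<Sum>i<4. p i * s (3 - i))" for p s :: "nat \<Rightarrow> real"
    by (simp add: sum_lessThan_4)
  have dir3: "bcond3 4 (\<lambda>i. c (3 - i)) path_dist" if "bcond3 4 c path_dist" for c
  proof -
    obtain p q where pq: "\<And>s. (\<Sum>i<4. p i * s i) = 0 \<Longrightarrow> (\<Sum>i<4. q i * s i) = 0 \<Longrightarrow> bform 4 c path_dist s \<le> 0"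
      using \<open>bcond3 _ _ _\<close> unfolding bcond3_def by blast
    show ?thesis unfolding bcond3_def rev
      by (rule exI[of _ "\<lambda>i. p (3 - i)"], rule exI[of _ "\<lambda>i. q (3 - i)"]) (simp add: lin pq)
  qed
  have dir2: "bcond2 4 (\<lambda>i. c (3 - i)) path_dist" if "bcond2 4 c path_dist" for c
  proof -
    obtain p where p: "\<And>s. (\<Sum>i<4. p i * s i) = 0 \<Longrightarrow> bform 4 c path_dist s \<ge> 0"
      using \<open>bcond2 _ _ _\<close> unfolding bcond2_def by blast
    show ?thesis unfolding bcond2_def rev
      by (rule exI[of _ "\<lambda>i. p (3 - i)"]) (simp add: lin p)
  qed
  have cong: "bform 4 (\<lambda>i. c (3 - (3 - i))) path_dist s = bform 4 c path_dist s" for c s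
    by (simp add: bform_path)
  show "bcond3 4 (\<lambda>i. c (3 - i)) path_dist \<longleftrightarrow> bcond3 4 c path_dist"
    using dir3[of c] dir3[of "\<lambda>i. c (3 - i)"] unfolding bcond3_def cong by blast
  show "bcond2 4 (\<lambda>i. c (3 - i)) path_dist \<longleftrightarrow> bcond2 4 c path_dist"
    using dir2[of c] dir2[of "\<lambda>i. c (3 - i)"] unfolding bcond2_def cong by blast
qed

text \<open>Passes to constants that dominate the diagonal, so that each instance rests on one
  polynomial identity in four variables.\<close>

lemma bcond3_pathI:
  assumes "\<And>s0 s1 s2 s3 :: real. p0 * s0 + p1 * s1 + p2 * s2 + p3 * s3 = 0 \<Longrightarrow>
      q0 * s0 + q1 * s1 + q2 * s2 + q3 * s3 = 0 \<Longrightarrow>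
      c0 * s0\<^sup>2 + c1 * s1\<^sup>2 + c2 * s2\<^sup>2 + c3 * s3\<^sup>2
        + 2 * s0 * s1 + 4 * s0 * s2 + 6 * s0 * s3 + 2 * s1 * s2 + 4 * s1 * s3 + 2 * s2 * s3 \<le> 0"
    and "c 0 \<le> c0" "c 1 \<le> c1" "c 2 \<le> c2" "c 3 \<le> c3"
  shows "bcond3 4 c path_dist"
proof -
  have "bcond3 4 (\<lambda>i. [c0, c1, c2, c3] ! i) path_dist"
    unfolding bcond3_def bform_path sum_lessThan_4
    by (rule exI[of _ "\<lambda>i. [p0, p1, p2, p3] ! i"], rule exI[of _ "\<lambda>i. [q0, q1, q2, q3] ! i"])
      (simp add: assms(1))
  thus ?thesis
    by (rule bcond3_antimono) (use assms(2-) in \<open>auto simp: less_Suc_eq numeral_eq_Suc\<close>)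
qed

lemma bcond2_pathI:
  assumes "\<And>s0 s1 s2 s3 :: real. p0 * s0 + p1 * s1 + p2 * s2 + p3 * s3 = 0 \<Longrightarrow>
      c0 * s0\<^sup>2 + c1 * s1\<^sup>2 + c2 * s2\<^sup>2 + c3 * s3\<^sup>2
        + 2 * s0 * s1 + 4 * s0 * s2 + 6 * s0 * s3 + 2 * s1 * s2 + 4 * s1 * s3 + 2 * s2 * s3 \<ge> 0"
    and "c 0 \<ge> c0" "c 1 \<ge> c1" "c 2 \<ge> c2" "c 3 \<ge> c3"
  shows "bcond2 4 c path_dist"
proof -
  have "bcond2 4 (\<lambda>i. [c0, c1, c2, c3] ! i) path_dist"
    unfolding bcond2_def bform_path sum_lessThan_4
    by (rule exI[of _ "\<lambda>i. [p0, p1, p2, p3] ! i"]) (simp add: assms(1))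
  thus ?thesis
    by (rule bcond2_mono) (use assms(2-) in \<open>auto simp: less_Suc_eq numeral_eq_Suc\<close>)
qed

lemma not_bcond3I:
  assumes F: "\<And>t0 t1 t2. bform k c m (\<lambda>i. t0 * x i + t1 * y i + t2 * z i) \<ge>
      g11 * t0\<^sup>2 + g22 * t1\<^sup>2 + g33 * t2\<^sup>2 + 2 * g12 * t0 * t1 + 2 * g13 * t0 * t2 + 2 * g23 * t1 * t2"
    and "g11 > 0" "g11 * g22 - g12 * g12 > 0"
      "g11 * (g22 * g33 - g23 * g23) - g12 * (g12 * g33 - g23 * g13) + g13 * (g12 * g23 - g22 * g13) > 0"
  shows "\<not> bcond3 k c m"
proof
  assume "bcond3 k c m"
  then obtain p q where pq: "\<And>s. (\<Sum>i<k. p i * s i) = 0 \<Longrightarrow> (\<Sum>i<k. q i * s i) = 0 \<Longrightarrow> bform k c m s \<le> 0"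
    unfolding bcond3_def by blast
  define P where "P j s = (\<Sum>i<k. (if j = (0::nat) then p i else q i) * s i)" for j and s :: "nat \<Rightarrow> real"
  obtain t i where t: "i \<le> (2::nat)" "t i \<noteq> (0::real)"
    "\<And>j. j < 2 \<Longrightarrow> (\<Sum>i\<le>2. P j (if i = 0 then x else if i = 1 then y else z) * t i) = 0"
    by (rule homogeneous_system_nontrivial[of 2
        "\<lambda>j i. P j (if i = 0 then x else if i = 1 then y else z)"]) (rule that)
  let ?w = "\<lambda>i. t 0 * x i + t 1 * y i + t 2 * z i"
  have Pw: "P j ?w = t 0 * P j x + t 1 * P j y + t 2 * P j z" for j
    by (simp add: P_def algebra_simps sum.distrib sum_distrib_left)
  have "P 0 ?w = 0" "P 1 ?w = 0"
    using t(3)[of 0] t(3)[of 1] unfolding Pw by (auto simp: numeral_2_eq_2 algebra_simps)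
  hence "bform k c m ?w \<le> 0" by (intro pq) (simp_all add: P_def)
  moreover have "t 0 \<noteq> 0 \<or> t 1 \<noteq> 0 \<or> t 2 \<noteq> 0"
    using t(1,2) by (auto simp: numeral_2_eq_2 le_Suc_eq)
  ultimately show False
    using pos_def3[OF assms(2-4), of "t 0" "t 1" "t 2"] F[of "t 0" "t 1" "t 2"] by linarith
qed

text \<open>The entry 2 bounds \<open>2 - 1 / a\<close> for every \<open>a\<close>, so this covers
  one edgeless end block of any size. The form is a sum of two squares minus a third, and the two
  positive ones provide the functionals.\<close>

lemma bcond3_path_2111:
  assumes "c 0 \<le> 2" "c 1 \<le> 1" "c 2 \<le> 1" "c 3 \<le> 1" shows "bcond3 4 c path_dist"
proof (rule bcond3_pathI)
  fix s0 s1 s2 s3 :: real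
  assume a: "1 * s0 + 1 * s1 + 1 * s2 + 2 * s3 = 0" and b: "1 * s0 + 0 * s1 + 1 * s2 + 1 * s3 = 0"
  have "2 * s0\<^sup>2 + 1 * s1\<^sup>2 + 1 * s2\<^sup>2 + 1 * s3\<^sup>2
      + 2 * s0 * s1 + 4 * s0 * s2 + 6 * s0 * s3 + 2 * s1 * s2 + 4 * s1 * s3 + 2 * s2 * s3
    = (1 * s0 + 1 * s1 + 1 * s2 + 2 * s3)\<^sup>2 + (1 * s0 + 0 * s1 + 1 * s2 + 1 * s3)\<^sup>2 - (s2 + 2 * s3)\<^sup>2"
    by (simp add: power2_eq_square algebra_simps)
  thus "2 * s0\<^sup>2 + 1 * s1\<^sup>2 + 1 * s2\<^sup>2 + 1 * s3\<^sup>2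
      + 2 * s0 * s1 + 4 * s0 * s2 + 6 * s0 * s3 + 2 * s1 * s2 + 4 * s1 * s3 + 2 * s2 * s3 \<le> 0"
    unfolding a b by simp
qed (use assms in auto)

lemma bcond3_path_1211:
  assumes "c 0 \<le> 1" "c 1 \<le> 2" "c 2 \<le> 1" "c 3 \<le> 1" shows "bcond3 4 c path_dist"
proof (rule bcond3_pathI)
  fix s0 s1 s2 s3 :: real
  assume a: "2 * s0 + 1 * s1 + 1 * s2 + 1 * s3 = 0" and b: "- 1 * s0 + 1 * s1 + 0 * s2 + 1 * s3 = 0"
  have "1 * s0\<^sup>2 + 2 * s1\<^sup>2 + 1 * s2\<^sup>2 + 1 * s3\<^sup>2
      + 2 * s0 * s1 + 4 * s0 * s2 + 6 * s0 * s3 + 2 * s1 * s2 + 4 * s1 * s3 + 2 * s2 * s3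
    = (2 * s0 + 1 * s1 + 1 * s2 + 1 * s3)\<^sup>2 + (- 1 * s0 + 1 * s1 + 0 * s2 + 1 * s3)\<^sup>2 - (s3 - 2 * s0)\<^sup>2"
    by (simp add: power2_eq_square algebra_simps)
  thus "1 * s0\<^sup>2 + 2 * s1\<^sup>2 + 1 * s2\<^sup>2 + 1 * s3\<^sup>2
      + 2 * s0 * s1 + 4 * s0 * s2 + 6 * s0 * s3 + 2 * s1 * s2 + 4 * s1 * s3 + 2 * s2 * s3 \<le> 0"
    unfolding a b by simp
qed (use assms in auto)

text \<open>The entry 3/2 is \<open>2 - 1 / a\<close> at \<open>a = 2\<close>: both end blocks
  edgeless with at most two vertices.\<close>

lemma bcond3_path_ends:
  assumes "c 0 \<le> 3 / 2" "c 1 \<le> 1" "c 2 \<le> 1" "c 3 \<le> 3 / 2" shows "bcond3 4 c path_dist"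
proof (rule bcond3_pathI)
  fix s0 s1 s2 s3 :: real
  assume a: "1 * s0 + 1 * s1 + 1 * s2 + 2 * s3 = 0" and b: "1 * s0 + 0 * s1 + 2 * s2 + 2 * s3 = 0"
  have "3 / 2 * s0\<^sup>2 + 1 * s1\<^sup>2 + 1 * s2\<^sup>2 + 3 / 2 * s3\<^sup>2
      + 2 * s0 * s1 + 4 * s0 * s2 + 6 * s0 * s3 + 2 * s1 * s2 + 4 * s1 * s3 + 2 * s2 * s3
    = (1 * s0 + 1 * s1 + 1 * s2 + 2 * s3)\<^sup>2 + 1 / 2 * (1 * s0 + 0 * s1 + 2 * s2 + 2 * s3)\<^sup>2
      - 2 * (s2 + 3 / 2 * s3)\<^sup>2"
    by (simp add: power2_eq_square algebra_simps)
  thus "3 / 2 * s0\<^sup>2 + 1 * s1\<^sup>2 + 1 * s2\<^sup>2 + 3 / 2 * s3\<^sup>2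
      + 2 * s0 * s1 + 4 * s0 * s2 + 6 * s0 * s3 + 2 * s1 * s2 + 4 * s1 * s3 + 2 * s2 * s3 \<le> 0"
    unfolding a b by simp
qed (use assms in auto)

text \<open>Covers an edgeless end block next to an edgeless inner block, each with at most two
  vertices.\<close>

lemma bcond3_path_left:
  assumes "c 0 \<le> 3 / 2" "c 1 \<le> 3 / 2" "c 2 \<le> 1" "c 3 \<le> 1" shows "bcond3 4 c path_dist"
proof (rule bcond3_pathI)
  fix s0 s1 s2 s3 :: real
  assume a: "2 * s0 + 1 * s1 + 1 * s2 + 1 * s3 = 0" and b: "- 2 * s0 + 1 * s1 + 0 * s2 + 2 * s3 = 0"
  have "3 / 2 * s0\<^sup>2 + 3 / 2 * s1\<^sup>2 + 1 * s2\<^sup>2 + 1 * s3\<^sup>2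
      + 2 * s0 * s1 + 4 * s0 * s2 + 6 * s0 * s3 + 2 * s1 * s2 + 4 * s1 * s3 + 2 * s2 * s3
    = (2 * s0 + 1 * s1 + 1 * s2 + 1 * s3)\<^sup>2 + 1 / 2 * (- 2 * s0 + 1 * s1 + 0 * s2 + 2 * s3)\<^sup>2
      - 2 * (s3 - 3 / 2 * s0)\<^sup>2"
    by (simp add: power2_eq_square algebra_simps)
  thus "3 / 2 * s0\<^sup>2 + 3 / 2 * s1\<^sup>2 + 1 * s2\<^sup>2 + 1 * s3\<^sup>2
      + 2 * s0 * s1 + 4 * s0 * s2 + 6 * s0 * s3 + 2 * s1 * s2 + 4 * s1 * s3 + 2 * s2 * s3 \<le> 0"
    unfolding a b by simp
qed (use assms in auto)

text \<open>The entry 2 is that of an edgeless end block, and 1 bounds every other entry from below.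
  With a single negative square left, the sizes impose no further restriction.\<close>

lemma bcond2_path_2111:
  assumes "c 0 \<ge> 2" "c 1 \<ge> 1" "c 2 \<ge> 1" "c 3 \<ge> 1" shows "bcond2 4 c path_dist"
proof (rule bcond2_pathI)
  fix s0 s1 s2 s3 :: real
  assume a: "0 * s0 + 0 * s1 + 1 * s2 + 2 * s3 = 0"
  have "2 * s0\<^sup>2 + 1 * s1\<^sup>2 + 1 * s2\<^sup>2 + 1 * s3\<^sup>2
      + 2 * s0 * s1 + 4 * s0 * s2 + 6 * s0 * s3 + 2 * s1 * s2 + 4 * s1 * s3 + 2 * s2 * s3
    = (s0 + s1 + s2 + 2 * s3)\<^sup>2 + (s0 + s2 + s3)\<^sup>2 - (0 * s0 + 0 * s1 + 1 * s2 + 2 * s3)\<^sup>2"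
    by (simp add: power2_eq_square algebra_simps)
  thus "2 * s0\<^sup>2 + 1 * s1\<^sup>2 + 1 * s2\<^sup>2 + 1 * s3\<^sup>2
      + 2 * s0 * s1 + 4 * s0 * s2 + 6 * s0 * s3 + 2 * s1 * s2 + 4 * s1 * s3 + 2 * s2 * s3 \<ge> 0"
    unfolding a by simp
qed (use assms in auto)

lemma bcond2_path_1121:
  assumes "c 0 \<ge> 1" "c 1 \<ge> 1" "c 2 \<ge> 2" "c 3 \<ge> 1" shows "bcond2 4 c path_dist"
proof (rule bcond2_pathI)
  fix s0 s1 s2 s3 :: real
  assume a: "1 * s0 + 0 * s1 + 0 * s2 + - 2 * s3 = 0"
  have "1 * s0\<^sup>2 + 1 * s1\<^sup>2 + 2 * s2\<^sup>2 + 1 * s3\<^sup>2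
      + 2 * s0 * s1 + 4 * s0 * s2 + 6 * s0 * s3 + 2 * s1 * s2 + 4 * s1 * s3 + 2 * s2 * s3
    = (s0 + s1 + s2 + 2 * s3)\<^sup>2 + (s0 + s2 - s3)\<^sup>2 - (1 * s0 + 0 * s1 + 0 * s2 + - 2 * s3)\<^sup>2"
    by (simp add: power2_eq_square algebra_simps)
  thus "1 * s0\<^sup>2 + 1 * s1\<^sup>2 + 2 * s2\<^sup>2 + 1 * s3\<^sup>2
      + 2 * s0 * s1 + 4 * s0 * s2 + 6 * s0 * s3 + 2 * s1 * s2 + 4 * s1 * s3 + 2 * s2 * s3 \<ge> 0"
    unfolding a by simp
qed (use assms in auto)

text \<open>The entries 2 cover blocks 0 and 2 of either type and any size, the entry 1 a clique in
  block 1.\<close>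

lemma bcond3_star:
  assumes "c 0 \<le> 2" "c 1 \<le> 1" "c 2 \<le> 2" shows "bcond3 3 c star_dist"
proof (rule bcond3_antimono)
  show "bcond3 3 (\<lambda>i. [2, 1, 2] ! i) star_dist"
    unfolding bcond3_def
  proof (rule exI[of _ "\<lambda>i. [1, 1, 2] ! i"], rule exI[of _ "\<lambda>i. [1, 0, - 1] ! i"], intro allI impI)
    fix s :: "nat \<Rightarrow> real"
    assume "(\<Sum>i<3. [1, 1, 2] ! i * s i) = 0" "(\<Sum>i<3. [1, 0, - 1] ! i * s i) = 0"
    hence a: "s 0 + s 1 + 2 * s 2 = 0" and b: "s 0 - s 2 = 0" by (simp_all add: sum_lessThan_3)
    have "bform 3 (\<lambda>i. [2, 1, 2] ! i) star_dist s = (s 0 + s 1 + 2 * s 2)\<^sup>2 + (s 0 - s 2)\<^sup>2 - 3 * (s 2)\<^sup>2"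
      by (simp add: bform_star power2_eq_square algebra_simps)
    thus "bform 3 (\<lambda>i. [2, 1, 2] ! i) star_dist s \<le> 0" unfolding a b by simp
  qed
qed (use assms in \<open>auto simp: less_Suc_eq numeral_eq_Suc\<close>)

lemma bcond2_star:
  assumes "c 0 \<ge> 1" "c 1 \<ge> 1" "c 2 \<ge> 1" shows "bcond2 3 c star_dist"
proof (rule bcond2_mono)
  show "bcond2 3 (\<lambda>i. [1, 1, 1] ! i) star_dist"
    unfolding bcond2_def
  proof (rule exI[of _ "\<lambda>i. [1, 0, 3] ! i"], intro allI impI)
    fix s :: "nat \<Rightarrow> real"
    assume "(\<Sum>i<3. [1, 0, 3] ! i * s i) = 0"
    hence a: "s 0 + 3 * s 2 = 0" by (simp add: sum_lessThan_3)
    have "bform 3 (\<lambda>i. [1, 1, 1] ! i) star_dist s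
        = (s 0 + s 1 + 2 * s 2)\<^sup>2 + 1 / 3 * (s 0)\<^sup>2 - 1 / 3 * (s 0 + 3 * s 2)\<^sup>2"
      by (simp add: bform_star power2_eq_square algebra_simps)
    thus "bform 3 (\<lambda>i. [1, 1, 1] ! i) star_dist s \<ge> 0" unfolding a by simp
  qed
qed (use assms in \<open>auto simp: less_Suc_eq numeral_eq_Suc\<close>)

text \<open>As \<open>2 - 1 / a\<close> is 1, 3/2, 5/3 for \<open>a\<close> = 1, 2, 3, these
  diagonals are the minimal inadmissible sizes up to reversal: 2113, 2311, 3211, 2121 and 1221. Each
  comes with three vectors and their positive definite Gram matrix.\<close>

lemma not_bcond3_path_minimal:
  shows "\<not> bcond3 4 (\<lambda>i. [3 / 2, 1, 1, 5 / 3] ! i) path_dist"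
    and "\<not> bcond3 4 (\<lambda>i. [3 / 2, 5 / 3, 1, 1] ! i) path_dist"
    and "\<not> bcond3 4 (\<lambda>i. [5 / 3, 3 / 2, 1, 1] ! i) path_dist"
    and "\<not> bcond3 4 (\<lambda>i. [3 / 2, 1, 3 / 2, 1] ! i) path_dist"
    and "\<not> bcond3 4 (\<lambda>i. [1, 3 / 2, 3 / 2, 1] ! i) path_dist"
proof -
  show "\<not> bcond3 4 (\<lambda>i. [3 / 2, 1, 1, 5 / 3] ! i) path_dist"
    by (rule not_bcond3I[where x = "\<lambda>i. [0, 0, 1, - 1] ! i" and y = "\<lambda>i. [0, 1, 0, 1] ! i" and z = "\<lambda>i. [1, 0, 0, 1] ! i"
          and ?g11.0 = "2 / 3" and ?g12.0 = "- 5 / 3" and ?g13.0 = "- 5 / 3" and ?g22.0 = "20 / 3" and ?g23.0 = "23 / 3"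
          and ?g33.0 = "55 / 6"]) (simp_all add: bform_path power2_eq_square algebra_simps)
  show "\<not> bcond3 4 (\<lambda>i. [3 / 2, 5 / 3, 1, 1] ! i) path_dist"
    by (rule not_bcond3I[where x = "\<lambda>i. [0, 1, 0, 0] ! i" and y = "\<lambda>i. [1, 0, 1, 0] ! i" and z = "\<lambda>i. [0, 0, 2, - 1] ! i"
          and ?g11.0 = "5 / 3" and ?g12.0 = 2 and ?g13.0 = 0 and ?g22.0 = "13 / 2" and ?g23.0 = 2
          and ?g33.0 = 1]) (simp_all add: bform_path power2_eq_square algebra_simps)
  show "\<not> bcond3 4 (\<lambda>i. [5 / 3, 3 / 2, 1, 1] ! i) path_dist"
    by (rule not_bcond3I[where x = "\<lambda>i. [0, 1, 0, 1] ! i" and y = "\<lambda>i. [1, 0, 0, 1] ! i" and z = "\<lambda>i. [0, 0, 2, - 1] ! i"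
          and ?g11.0 = "13 / 2" and ?g12.0 = 7 and ?g13.0 = 1 and ?g22.0 = "26 / 3" and ?g23.0 = 2
          and ?g33.0 = 1]) (simp_all add: bform_path power2_eq_square algebra_simps)
  show "\<not> bcond3 4 (\<lambda>i. [3 / 2, 1, 3 / 2, 1] ! i) path_dist"
    by (rule not_bcond3I[where x = "\<lambda>i. [0, 0, 1, - 1] ! i" and y = "\<lambda>i. [0, 1, 0, 1] ! i" and z = "\<lambda>i. [1, 0, 0, 1] ! i"
          and ?g11.0 = "1 / 2" and ?g12.0 = "- 1" and ?g13.0 = "- 1" and ?g22.0 = 6 and ?g23.0 = 7
          and ?g33.0 = "17 / 2"]) (simp_all add: bform_path power2_eq_square algebra_simps)
  show "\<not> bcond3 4 (\<lambda>i. [1, 3 / 2, 3 / 2, 1] ! i) path_dist"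
    by (rule not_bcond3I[where x = "\<lambda>i. [0, 0, 1, 0] ! i" and y = "\<lambda>i. [0, 1, 0, 0] ! i" and z = "\<lambda>i. [1, 0, 0, 1] ! i"
          and ?g11.0 = "3 / 2" and ?g12.0 = 1 and ?g13.0 = 3 and ?g22.0 = "3 / 2" and ?g23.0 = 3
          and ?g33.0 = 8]) (simp_all add: bform_path power2_eq_square algebra_simps)
qed

section \<open>Admissible sizes of the edgeless blocks\<close>

definition path_sizes_ok :: "nat \<Rightarrow> nat \<Rightarrow> nat \<Rightarrow> nat \<Rightarrow> bool" where
  "path_sizes_ok a b c d \<longleftrightarrow>
     b = 1 \<and> c = 1 \<and> (a = 1 \<or> d = 1 \<or> a \<le> 2 \<and> d \<le> 2) \<or>
     c = 1 \<and> d = 1 \<and> (a = 1 \<or> b = 1 \<or> a \<le> 2 \<and> b \<le> 2) \<or>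
     a = 1 \<and> b = 1 \<and> (c = 1 \<or> d = 1 \<or> c \<le> 2 \<and> d \<le> 2)"

text \<open>\<open>e i\<close> is meant as the size of an edgeless block and as 1 for a clique,
  since \<open>2 - 1 / 1\<close> is the entry of a clique. Admissible sizes are dominated, up to
  reversal, by one of four sufficient diagonals; all others dominate a minimal inadmissible
  one.\<close>

lemma bcond3_path_iff:
  fixes e :: "nat \<Rightarrow> nat"
  assumes pos: "\<And>i. i < 4 \<Longrightarrow> e i \<ge> 1"
  shows "bcond3 4 (\<lambda>i. 2 - 1 / real (e i)) path_dist \<longleftrightarrow> path_sizes_ok (e 0) (e 1) (e 2) (e 3)"
proof -
  let ?c = "\<lambda>i. 2 - 1 / real (e i)"
  have c1: "?c i \<le> 1" if "e i = 1" for i using that by simp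
  have c2: "?c i \<le> 2" for i by simp
  have c32: "?c i \<le> 3 / 2" if "e i \<le> 2" "i < 4" for i
    using that pos[of i] by (simp add: field_simps)
  have g2: "3 / 2 \<le> ?c i" if "e i \<ge> 2" for i using that by (simp add: field_simps)
  have g3: "5 / 3 \<le> ?c i" if "e i \<ge> 3" for i using that by (simp add: field_simps)
  have g1: "1 \<le> ?c i" if "i < 4" for i using pos[OF that] by (simp add: field_simps)
  have p: "e 0 \<ge> 1" "e 1 \<ge> 1" "e 2 \<ge> 1" "e 3 \<ge> 1" using pos by auto
  note rev = bcond_path_reverse(1)[of ?c]
  have fail: "\<not> bcond3 4 c path_dist"
    if "\<not> bcond3 4 (\<lambda>i. [c0, c1, c2, c3] ! i) path_dist" "c0 \<le> c 0" "c1 \<le> c 1" "c2 \<le> c 2" "c3 \<le> c 3"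
    for c :: "nat \<Rightarrow> real" and c0 c1 c2 c3
  proof
    assume c: "bcond3 4 c path_dist"
    have "[c0, c1, c2, c3] ! i \<le> c i" if "i < 4" for i
      using that \<open>c0 \<le> c 0\<close> \<open>c1 \<le> c 1\<close> \<open>c2 \<le> c 2\<close> \<open>c3 \<le> c 3\<close> by (auto simp: less_Suc_eq numeral_eq_Suc)
    from bcond3_antimono[OF c this] that(1) show False by blast
  qed
  show ?thesis
  proof
    assume "path_sizes_ok (e 0) (e 1) (e 2) (e 3)"
    then consider "e 1 = 1" "e 2 = 1" "e 3 = 1" | "e 0 = 1" "e 2 = 1" "e 3 = 1"
      | "e 0 = 1" "e 1 = 1" "e 3 = 1" | "e 0 = 1" "e 1 = 1" "e 2 = 1"
      | "e 0 \<le> 2" "e 1 = 1" "e 2 = 1" "e 3 \<le> 2" | "e 0 \<le> 2" "e 1 \<le> 2" "e 2 = 1" "e 3 = 1"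
      | "e 0 = 1" "e 1 = 1" "e 2 \<le> 2" "e 3 \<le> 2"
      unfolding path_sizes_ok_def by blast
    thus "bcond3 4 ?c path_dist"
    proof cases
      case 1 thus ?thesis by (intro bcond3_path_2111 c1 c2)
    next
      case 2 thus ?thesis by (intro bcond3_path_1211 c1 c2)
    next
      case 3 show ?thesis unfolding rev[symmetric] using 3 c2[of 2] by (intro bcond3_path_1211) simp_all
    next
      case 4 show ?thesis unfolding rev[symmetric] using 4 c2[of 3] by (intro bcond3_path_2111) simp_all
    next
      case 5 thus ?thesis by (intro bcond3_path_ends c1 c32) simp_all
    next
      case 6 thus ?thesis by (intro bcond3_path_left c1 c32) simp_all
    next
      case 7 show ?thesis unfolding rev[symmetric] using 7 c32[of 2] c32[of 3]
        by (intro bcond3_path_left) simp_all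
    qed
  next
    assume ok: "bcond3 4 ?c path_dist"
    hence ok': "bcond3 4 (\<lambda>i. ?c (3 - i)) path_dist" unfolding rev .
    show "path_sizes_ok (e 0) (e 1) (e 2) (e 3)"
    proof (rule ccontr)
      assume "\<not> path_sizes_ok (e 0) (e 1) (e 2) (e 3)"
      moreover have t: "e i = 1 \<or> e i = 2 \<or> e i \<ge> 3" if "i < 4" for i using pos[OF that] by linarith
      have "e 0 = 1 \<or> e 0 = 2 \<or> e 0 \<ge> 3" "e 1 = 1 \<or> e 1 = 2 \<or> e 1 \<ge> 3"
        "e 2 = 1 \<or> e 2 = 2 \<or> e 2 \<ge> 3" "e 3 = 1 \<or> e 3 = 2 \<or> e 3 \<ge> 3" by (rule t; simp)+
      \<comment> \<open>The nine alternatives are the five minimal patterns and the reversals of the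
        four that are not symmetric.\<close>
      ultimately have "e 0 \<ge> 2 \<and> e 3 \<ge> 3 \<or> e 0 \<ge> 3 \<and> e 3 \<ge> 2 \<or> e 0 \<ge> 2 \<and> e 1 \<ge> 3 \<or> e 0 \<ge> 3 \<and> e 1 \<ge> 2 \<or>
        e 2 \<ge> 3 \<and> e 3 \<ge> 2 \<or> e 2 \<ge> 2 \<and> e 3 \<ge> 3 \<or> e 0 \<ge> 2 \<and> e 2 \<ge> 2 \<or> e 1 \<ge> 2 \<and> e 3 \<ge> 2 \<or>
        e 1 \<ge> 2 \<and> e 2 \<ge> 2"
        unfolding path_sizes_ok_def by (elim disjE) simp_all
      then consider "e 0 \<ge> 2" "e 3 \<ge> 3" | "e 0 \<ge> 3" "e 3 \<ge> 2" | "e 0 \<ge> 2" "e 1 \<ge> 3" | "e 0 \<ge> 3" "e 1 \<ge> 2"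
        | "e 2 \<ge> 3" "e 3 \<ge> 2" | "e 2 \<ge> 2" "e 3 \<ge> 3" | "e 0 \<ge> 2" "e 2 \<ge> 2" | "e 1 \<ge> 2" "e 3 \<ge> 2"
        | "e 1 \<ge> 2" "e 2 \<ge> 2"
        by blast
      thus False
      proof cases
        case 1
        have "\<not> bcond3 4 ?c path_dist"
          by (rule fail[OF not_bcond3_path_minimal(1)]; intro g1 g2 g3 1) simp_all
        with ok show False by simp
      next
        case 2
        have "\<not> bcond3 4 (\<lambda>i. ?c (3 - i)) path_dist"
          by (rule fail[OF not_bcond3_path_minimal(1)]) (use 2 g1 g2 g3 in simp_all)
        with ok' show False by simp
      next
        case 3
        have "\<not> bcond3 4 ?c path_dist"
          by (rule fail[OF not_bcond3_path_minimal(2)]; intro g1 g2 g3 3) simp_all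
        with ok show False by simp
      next
        case 4
        have "\<not> bcond3 4 ?c path_dist"
          by (rule fail[OF not_bcond3_path_minimal(3)]; intro g1 g2 g3 4) simp_all
        with ok show False by simp
      next
        case 5
        have "\<not> bcond3 4 (\<lambda>i. ?c (3 - i)) path_dist"
          by (rule fail[OF not_bcond3_path_minimal(2)]) (use 5 g1 g2 g3 in simp_all)
        with ok' show False by simp
      next
        case 6
        have "\<not> bcond3 4 (\<lambda>i. ?c (3 - i)) path_dist"
          by (rule fail[OF not_bcond3_path_minimal(3)]) (use 6 g1 g2 g3 in simp_all)
        with ok' show False by simp
      next
        case 7
        have "\<not> bcond3 4 ?c path_dist"
          by (rule fail[OF not_bcond3_path_minimal(4)]; intro g1 g2 g3 7) simp_all
        with ok show False by simp
      next
        case 8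
        have "\<not> bcond3 4 (\<lambda>i. ?c (3 - i)) path_dist"
          by (rule fail[OF not_bcond3_path_minimal(4)]) (use 8 g1 g2 g3 in simp_all)
        with ok' show False by simp
      next
        case 9
        have "\<not> bcond3 4 ?c path_dist"
          by (rule fail[OF not_bcond3_path_minimal(5)]; intro g1 g2 g3 9) simp_all
        with ok show False by simp
      qed
    qed
  qed
qed

definition clique_poly :: "nat \<Rightarrow> nat \<Rightarrow> nat \<Rightarrow> nat \<Rightarrow> int" where
  "clique_poly a b c d = int a + int b + int c + int d - 3 * int a * int c - 8 * int a * int d - 3 * int b * int d
    - int a * int b * int c - int a * int b * int d - int a * int c * int d
    - int b * int c * int d + int a * int b * int c * int d + 1"

text \<open>
  Completing squares in the order of the blocks 0, 1, 3, 2 leaves pivots whose signs are known,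
  except that of the last one, which is opposite to the sign of the determinant.
\<close>

lemma bcond2_path_cliques:
  fixes n :: "nat \<Rightarrow> nat"
  assumes pos: "\<And>i. i < 4 \<Longrightarrow> n i \<ge> 1"
  shows "bcond2 4 (\<lambda>i. 1 + 1 / real (n i)) path_dist \<longleftrightarrow> clique_poly (n 0) (n 1) (n 2) (n 3) \<le> 0"
proof -
  define x y z w where "x = 1 / real (n 0)" and "y = 1 / real (n 1)" and "z = 1 / real (n 2)" and "w = 1 / real (n 3)"
  have r: "0 < x" "x \<le> 1" "0 < y" "y \<le> 1" "0 < z" "z \<le> 1" "0 < w" "w \<le> 1"
    using pos[of 0] pos[of 1] pos[of 2] pos[of 3] by (simp_all add: x_def y_def z_def w_def)
  \<comment> \<open>The determinant of the form with diagonal \<open>1 + x\<close>,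
    \<open>1 + y\<close>, \<open>1 + z\<close>, \<open>1 + w\<close>; multiplication by the four
    sizes turns it into \<open>clique_poly\<close>.\<close>
  define det where "det = 1 - x - y - z - w - 3*y*w - 8*y*z - 3*x*z + y*z*w + x*z*w + x*y*w + x*y*z + x*y*z*w"
  have "of_int (clique_poly (n 0) (n 1) (n 2) (n 3)) = real (n 0) * real (n 1) * real (n 2) * real (n 3) * det"
  proof -
    have nz: "real (n 0) \<noteq> 0" "real (n 1) \<noteq> 0" "real (n 2) \<noteq> 0" "real (n 3) \<noteq> 0"
      using pos[of 0] pos[of 1] pos[of 2] pos[of 3] by auto
    show ?thesis unfolding det_def x_def y_def z_def w_def clique_poly_def
      using nz by (simp add: field_simps)
  qed
  hence "real_of_int (clique_poly (n 0) (n 1) (n 2) (n 3)) \<le> 0 \<longleftrightarrow>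
      real (n 0) * real (n 1) * real (n 2) * real (n 3) * det \<le> 0" by simp
  moreover have "real (n 0) * real (n 1) * real (n 2) * real (n 3) > 0"
    using pos[of 0] pos[of 1] pos[of 2] pos[of 3] by simp
  ultimately have "real_of_int (clique_poly (n 0) (n 1) (n 2) (n 3)) \<le> 0 \<longleftrightarrow> det \<le> 0"
    by (metis mult_le_0_iff not_less order_less_imp_le)
  hence poly: "clique_poly (n 0) (n 1) (n 2) (n 3) \<le> 0 \<longleftrightarrow> det \<le> 0" by simp
  \<comment> \<open>\<open>A\<close> is the first pivot; with denominators cleared, the
    \<open>h\<close> are the coefficients left after eliminating block 0, and the \<open>k\<close>
    those left after eliminating block 1.\<close>
  define A where "A = 1 + x"
  define h11 h12 h13 h22 h23 h33 where "h11 = A * (1 + y) - 1" and "h12 = A - 2" and "h13 = 2 * A - 3"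
    and "h22 = A * (1 + z) - 4" and "h23 = A - 6" and "h33 = A * (1 + w) - 9"
  define k22 k23 k33 where "k22 = h11 * h22 - h12\<^sup>2" and "k23 = h11 * h23 - h12 * h13" and "k33 = h11 * h33 - h13\<^sup>2"
  note defs = A_def h11_def h12_def h13_def h22_def h23_def h33_def k22_def k23_def k33_def
  have Apos: "A > 0" and h11: "h11 > 0" using r by (auto simp: defs algebra_simps add_pos_pos)
  have k33: "k33 < 0"
  proof -
    have k: "k33 = A * ((1 + x) * (y + w + y * w - 3) + 2 - w - 9 * y)"
      by (simp add: defs power2_eq_square algebra_simps)
    have yw: "y * w \<le> 1" using r by (simp add: mult_le_one)
    \<comment> \<open>The factor \<open>y + w + y * w - 3\<close> is at most 0, so
      \<open>1 + x\<close> may be replaced by 1.\<close>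
    have "(1 + x) * (y + w + y * w - 3) \<le> 1 * (y + w + y * w - 3)"
      using r yw by (intro mult_right_mono_neg) auto
    hence "(1 + x) * (y + w + y * w - 3) + 2 - w - 9 * y \<le> y * w - 8 * y - 1" by simp
    moreover have "y * w \<le> y" using r by (simp add: mult_left_le)
    ultimately have "(1 + x) * (y + w + y * w - 3) + 2 - w - 9 * y < 0" using r by linarith
    with Apos show ?thesis unfolding k by (rule mult_pos_neg)
  qed
  have kdet: "k33 * k22 - k23\<^sup>2 = A\<^sup>2 * h11 * det"
    by (simp add: defs det_def power2_eq_square algebra_simps)
  have id: "A * h11 * bform 4 (\<lambda>i. 1 + 1 / real (n i)) path_dist s =
      h11 * (A * s 0 + s 1 + 2 * s 2 + 3 * s 3)\<^sup>2 + (h11 * s 1 + h12 * s 2 + h13 * s 3)\<^sup>2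
      + (k33 * (s 3)\<^sup>2 + 2 * k23 * s 3 * s 2 + k22 * (s 2)\<^sup>2)" for s
    unfolding bform_path x_def[symmetric] y_def[symmetric] z_def[symmetric] w_def[symmetric]
    by (simp add: defs power2_eq_square algebra_simps)
  have Ah: "A * h11 > 0" using Apos h11 by simp
  have tail: "k33 * (k33 * u\<^sup>2 + 2 * k23 * u * v + k22 * v\<^sup>2) = (k33 * u + k23 * v)\<^sup>2 + A\<^sup>2 * h11 * det * v\<^sup>2" for u v
    unfolding kdet[symmetric] by (simp add: power2_eq_square algebra_simps)
  show ?thesis unfolding poly
  proof
    assume det: "det \<le> 0"
    show "bcond2 4 (\<lambda>i. 1 + 1 / real (n i)) path_dist" unfolding bcond2_def
    \<comment> \<open>The functional is the linear form inside the square that belongs to the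
      negative pivot \<open>k33\<close>.\<close>
    proof (rule exI[of _ "\<lambda>i. [0, 0, k23, k33] ! i"], intro allI impI)
      fix s :: "nat \<Rightarrow> real"
      assume "(\<Sum>i<4. [0, 0, k23, k33] ! i * s i) = 0"
      hence z: "k33 * s 3 + k23 * s 2 = 0" by (simp add: sum_lessThan_4 add.commute)
      have "k33 * (k33 * (s 3)\<^sup>2 + 2 * k23 * s 3 * s 2 + k22 * (s 2)\<^sup>2) = A\<^sup>2 * h11 * det * (s 2)\<^sup>2"
        unfolding tail z by simp
      also have "\<dots> \<le> 0" using det h11 by (intro mult_nonpos_nonneg mult_nonneg_nonpos) auto
      finally have K: "k33 * (s 3)\<^sup>2 + 2 * k23 * s 3 * s 2 + k22 * (s 2)\<^sup>2 \<ge> 0"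
        using k33 by (simp add: mult_le_0_iff)
      have "A * h11 * bform 4 (\<lambda>i. 1 + 1 / real (n i)) path_dist s \<ge> 0"
        unfolding id by (rule add_nonneg_nonneg[OF _ K]) (use h11 in simp)
      thus "bform 4 (\<lambda>i. 1 + 1 / real (n i)) path_dist s \<ge> 0" using Ah by (simp add: zero_le_mult_iff)
    qed
  next
    assume "bcond2 4 (\<lambda>i. 1 + 1 / real (n i)) path_dist"
    then obtain p where p: "\<And>s. (\<Sum>i<4. p i * s i) = 0 \<Longrightarrow> bform 4 (\<lambda>i. 1 + 1 / real (n i)) path_dist s \<ge> 0"
      unfolding bcond2_def by blast
    show "det \<le> 0"
    proof (rule ccontr)
      assume "\<not> det \<le> 0"
      hence det: "det > 0" by simp
      \<comment> \<open>The vectors \<open>s u v\<close> form the plane on which the first two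
        squares vanish. For \<open>det > 0\<close> the form is negative definite there, while the
        plane meets the kernel of \<open>p\<close>.\<close>
      define s1 where "s1 u v = - (h12 * v + h13 * u) / h11" for u v
      define s where "s u v = (\<lambda>i. [- (s1 u v + 2 * v + 3 * u) / A, s1 u v, v, u] ! i)" for u v
      have s: "s u v 0 = - (s1 u v + 2 * v + 3 * u) / A" "s u v 1 = s1 u v" "s u v 2 = v" "s u v 3 = u" for u v
        by (simp_all add: s_def)
      have z1: "A * s u v 0 + s u v 1 + 2 * s u v 2 + 3 * s u v 3 = 0" for u v
        using Apos by (simp add: s del: One_nat_def)
      have z2: "h11 * s u v 1 + h12 * s u v 2 + h13 * s u v 3 = 0" for u v
        using h11 by (simp add: s s1_def del: One_nat_def)
      define P where "P u v = (\<Sum>i<4. p i * s u v i)" for u v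
      have P: "P u v = u * P 1 0 + v * P 0 1" for u v
        unfolding P_def sum_lessThan_4 s s1_def using Apos h11 by (simp add: field_simps)
      obtain u v where uv: "u \<noteq> 0 \<or> v \<noteq> 0" "P u v = 0"
      proof (cases "P 1 0 = 0")
        case True
        thus ?thesis using that[of 1 0] P[of 1 0] by simp
      next
        case False
        have "P (- P 0 1) (P 1 0) = 0" by (subst P) simp
        thus ?thesis using that[of "- P 0 1" "P 1 0"] False by simp
      qed
      have "A * h11 * bform 4 (\<lambda>i. 1 + 1 / real (n i)) path_dist (s u v) \<ge> 0"
        using p[of "s u v"] uv(2) Ah unfolding P_def by simp
      hence "k33 * u\<^sup>2 + 2 * k23 * u * v + k22 * v\<^sup>2 \<ge> 0"
        unfolding id z1 z2 by (simp add: s)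
      hence "k33 * (k33 * u\<^sup>2 + 2 * k23 * u * v + k22 * v\<^sup>2) \<le> 0"
        using k33 by (simp add: mult_le_0_iff)
      hence le: "(k33 * u + k23 * v)\<^sup>2 + A\<^sup>2 * h11 * det * v\<^sup>2 \<le> 0" unfolding tail .
      have c: "A\<^sup>2 * h11 * det > 0" using Apos h11 det by simp
      hence "A\<^sup>2 * h11 * det * v\<^sup>2 \<ge> 0" by simp
      hence "(k33 * u + k23 * v)\<^sup>2 = 0" "A\<^sup>2 * h11 * det * v\<^sup>2 = 0"
        using le zero_le_power2[of "k33 * u + k23 * v"] by linarith+
      hence "v = 0" "u = 0" using c k33 by auto
      thus False using uv(1) by simp
    qed
  qed
qed

section \<open>The classification\<close>

definition monochrome :: "bool \<Rightarrow> nat \<Rightarrow> nat pair_pre_digraph" where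
  "monochrome t n = (if t then complete_graph n else edgeless_graph n)"

lemma monochrome_simps:
  "monochrome True n = complete_graph n" "monochrome False n = edgeless_graph n"
  by (simp_all add: monochrome_def)

lemma pverts_monochrome: "pverts (monochrome t n) = {..<n}"
  by (simp add: monochrome_def complete_graph_def graph_complement_def)

lemma parcs_monochrome: "(x, y) \<in> parcs (monochrome t n) \<longleftrightarrow> x < n \<and> y < n \<and> x \<noteq> y \<and> t"
  by (auto simp: monochrome_def complete_graph_def graph_complement_def)

text \<open>A block with at most one vertex contains no pair, so its type can be changed
  freely.\<close>

lemma block_graph_cong:
  assumes "block_graph k adj clique sz G f"
    and "\<And>i. i < k \<Longrightarrow> sz' i = sz i" and "\<And>i. i < k \<Longrightarrow> clique' i = clique i \<or> sz i \<le> 1"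
  shows "block_graph k adj clique' sz' G f"
proof -
  have cl: "clique (f u) = clique' (f u)" if "u \<in> pverts G" "v \<in> pverts G" "u \<noteq> v" "f u = f v" for u v
  proof (rule ccontr)
    assume "clique (f u) \<noteq> clique' (f u)"
    moreover have fu: "f u < k" using assms(1) that by (auto simp: block_graph_def)
    ultimately have "sz (f u) \<le> 1" using assms(3) by blast
    hence "card {w \<in> pverts G. f w = f u} \<le> 1" using assms(1) fu by (simp add: block_graph_def)
    moreover have "{u, v} \<subseteq> {w \<in> pverts G. f w = f u}" "finite {w \<in> pverts G. f w = f u}"
      using that assms(1) by (auto simp: block_graph_def)
    ultimately show False using card_mono[of "{w \<in> pverts G. f w = f u}" "{u, v}"] that(3) by simp
  qed
  have "(u, v) \<in> parcs G \<longleftrightarrow> u \<noteq> v \<and> (if f u = f v then clique' (f u) else adj (f u) (f v))"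
    if uv: "u \<in> pverts G" "v \<in> pverts G" for u v
  proof -
    have "(u, v) \<in> parcs G \<longleftrightarrow> u \<noteq> v \<and> (if f u = f v then clique (f u) else adj (f u) (f v))"
      using assms(1) uv unfolding block_graph_def by blast
    thus ?thesis using cl[OF uv] by auto
  qed
  thus ?thesis using assms(1,2) unfolding block_graph_def by simp
qed

definition star_adj :: "nat \<Rightarrow> nat \<Rightarrow> bool" where
  "star_adj i j \<longleftrightarrow> star_dist i j = 1"

definition path_adj :: "nat \<Rightarrow> nat \<Rightarrow> bool" where
  "path_adj i j \<longleftrightarrow> path_dist i j = 1"

lemma block_graph_P4_product:
  "block_graph 4 path_adj (\<lambda>i. [t0, t1, t2, t3] ! i) (\<lambda>i. [a, b, c, d] ! i)
     (P4_product (monochrome t0 a) (monochrome t1 b) (monochrome t2 c) (monochrome t3 d)) fst"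
proof -
  define T where "T i = [t0, t1, t2, t3] ! i" for i
  define N where "N i = [a, b, c, d] ! i" for i
  let ?H = "\<lambda>i. [monochrome t0 a, monochrome t1 b, monochrome t2 c, monochrome t3 d] ! i"
  have H: "?H i = monochrome (T i) (N i)" if "i < 4" for i
    using that by (auto simp: T_def N_def less_Suc_eq numeral_eq_Suc)
  let ?P = "P4_product (monochrome t0 a) (monochrome t1 b) (monochrome t2 c) (monochrome t3 d)"
  have V: "pverts ?P = (SIGMA i:{..<4}. {..<N i})"
    unfolding P4_product_def gen_lex_product_def path_graph_def pair_pre_digraph.simps
    by (intro Sigma_cong refl) (simp only: H lessThan_iff pverts_monochrome)
  have A: "((i, x), (j, y)) \<in> parcs ?P \<longleftrightarrow> i < 4 \<and> j < 4 \<and> x < N i \<and> y < N j \<and>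
      (i = j \<and> x \<noteq> y \<and> T i \<or> path_adj i j)" for i x j y
  proof -
    have "((i, x), (j, y)) \<in> parcs ?P \<longleftrightarrow> i < 4 \<and> x \<in> pverts (?H i) \<and> j < 4 \<and> y \<in> pverts (?H j) \<and>
        (i = j \<and> (x, y) \<in> parcs (?H i) \<or> j = Suc i \<or> i = Suc j)"
      unfolding P4_product_def gen_lex_product_def path_graph_def by auto
    also have "\<dots> \<longleftrightarrow> i < 4 \<and> j < 4 \<and> x < N i \<and> y < N j \<and> (i = j \<and> x \<noteq> y \<and> T i \<or> j = Suc i \<or> i = Suc j)"
      using H[of i] H[of j]
      by (cases "i < 4 \<and> j < 4") (auto simp only: pverts_monochrome parcs_monochrome lessThan_iff)
    finally show ?thesis by (auto simp: path_adj_def path_dist_def)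
  qed
  have card: "card {v \<in> pverts ?P. fst v = i} = N i" if "i < 4" for i
  proof -
    have "{v \<in> pverts ?P. fst v = i} = Pair i ` {..<N i}" using that by (auto simp: V)
    thus ?thesis by (simp add: card_image inj_on_def)
  qed
  have "\<not> path_adj i i" for i by (simp add: path_adj_def path_dist_def)
  thus ?thesis
    unfolding block_graph_def T_def[symmetric] N_def[symmetric]
    using card by (auto simp: V A)
qed

lemma block_graph_join3:
  "block_graph 3 star_adj (\<lambda>i. [t0, t1, t2] ! i) (\<lambda>i. [a, b, c] ! i)
     (graph_join (monochrome t0 a) (graph_union (monochrome t1 b) (monochrome t2 c)))
     (case_sum (\<lambda>_. 0) (case_sum (\<lambda>_. 1) (\<lambda>_. 2)))"
proof -
  let ?J = "graph_join (monochrome t0 a) (graph_union (monochrome t1 b) (monochrome t2 c))"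
  let ?f = "case_sum (\<lambda>_. 0) (case_sum (\<lambda>_. 1) (\<lambda>_. 2)) :: nat + nat + nat \<Rightarrow> nat"
  have V: "pverts ?J = {..<a} <+> ({..<b} <+> {..<c})"
    by (simp add: graph_join_def graph_union_def pverts_monochrome)
  have "{v \<in> pverts ?J. ?f v = 0} = Inl ` {..<a}" "{v \<in> pverts ?J. ?f v = 1} = Inr ` Inl ` {..<b}"
    "{v \<in> pverts ?J. ?f v = 2} = Inr ` Inr ` {..<c}"
    unfolding V by (auto simp: Plus_def)
  hence "card {v \<in> pverts ?J. ?f v = i} = [a, b, c] ! i" if "i < 3" for i
    using that by (auto simp: less_Suc_eq numeral_eq_Suc card_image)
  moreover have "finite (pverts ?J)" unfolding V by auto
  moreover have "?f ` pverts ?J \<subseteq> {..<3}" unfolding V by auto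
  moreover have "parcs ?J \<subseteq> pverts ?J \<times> pverts ?J"
    unfolding V by (auto simp: graph_join_def graph_union_def pverts_monochrome parcs_monochrome)
  moreover have "(u, v) \<in> parcs ?J \<longleftrightarrow> u \<noteq> v \<and>
      (if ?f u = ?f v then [t0, t1, t2] ! ?f u else star_adj (?f u) (?f v))"
    if "u \<in> pverts ?J" "v \<in> pverts ?J" for u v
    using that unfolding V
    by (auto simp: graph_join_def graph_union_def pverts_monochrome parcs_monochrome star_adj_def star_dist_def)
  ultimately show ?thesis unfolding block_graph_def by blast
qed

text \<open>A join of two graphs uses the labels 0 and 2. The empty block 1 is declared a clique, to
  fit the criterion for three blocks, which wants a clique there.\<close>

lemma block_graph_join2:
  "block_graph 3 star_adj (\<lambda>i. [t0, True, t2] ! i) (\<lambda>i. [a, 0, c] ! i)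
     (graph_join (monochrome t0 a) (monochrome t2 c)) (case_sum (\<lambda>_. 0) (\<lambda>_. 2))"
proof -
  let ?J = "graph_join (monochrome t0 a) (monochrome t2 c)"
  let ?f = "case_sum (\<lambda>_. 0) (\<lambda>_. 2) :: nat + nat \<Rightarrow> nat"
  have V: "pverts ?J = {..<a} <+> {..<c}"
    by (simp add: graph_join_def graph_union_def pverts_monochrome)
  have "{v \<in> pverts ?J. ?f v = 0} = Inl ` {..<a}" "{v \<in> pverts ?J. ?f v = 1} = {}"
    "{v \<in> pverts ?J. ?f v = 2} = Inr ` {..<c}"
    unfolding V by (auto simp: Plus_def)
  hence card: "card {v \<in> pverts ?J. ?f v = 0} = a" "card {v \<in> pverts ?J. ?f v = 1} = 0"
    "card {v \<in> pverts ?J. ?f v = 2} = c" by (simp_all only: card_image[OF inj_Inl] card_image[OF inj_Inr]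
      card_lessThan card.empty)
  have "card {v \<in> pverts ?J. ?f v = i} = [a, 0, c] ! i" if "i < 3" for i
  proof -
    from that consider "i = 0" | "i = 1" | "i = 2" by linarith
    thus ?thesis by cases (simp_all only: card nth_Cons_0 nth_Cons_numeral, simp_all)
  qed
  moreover have "finite (pverts ?J)" unfolding V by auto
  moreover have "?f ` pverts ?J \<subseteq> {..<3}" unfolding V by auto
  moreover have "parcs ?J \<subseteq> pverts ?J \<times> pverts ?J"
    unfolding V by (auto simp: graph_join_def graph_union_def pverts_monochrome parcs_monochrome)
  moreover have "(u, v) \<in> parcs ?J \<longleftrightarrow> u \<noteq> v \<and>
      (if ?f u = ?f v then [t0, True, t2] ! ?f u else star_adj (?f u) (?f v))"
    if "u \<in> pverts ?J" "v \<in> pverts ?J" for u v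
    using that unfolding V
    by (auto simp: graph_join_def graph_union_def pverts_monochrome parcs_monochrome star_adj_def star_dist_def)
  ultimately show ?thesis unfolding block_graph_def by blast
qed

lemma block_graph_complete:
  "block_graph 3 star_adj (\<lambda>_. True) (\<lambda>i. [n, 0, 0] ! i) (complete_graph n) (\<lambda>_. 0)"
  unfolding block_graph_def complete_graph_def
  by (auto simp: less_Suc_eq numeral_eq_Suc)

lemma block_graph_path_reverse:
  assumes "block_graph 4 path_adj clique sz G f"
  shows "block_graph 4 path_adj (\<lambda>i. clique (3 - i)) (\<lambda>i. sz (3 - i)) G (\<lambda>v. 3 - f v)"
proof -
  have f4: "f v < 4" if "v \<in> pverts G" for v using assms that by (auto simp: block_graph_def)
  have "card {v \<in> pverts G. 3 - f v = i} = sz (3 - i)" if "i < 4" for i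
  proof -
    have "{v \<in> pverts G. 3 - f v = i} = {v \<in> pverts G. f v = 3 - i}" using f4 that by fastforce
    thus ?thesis using assms by (simp add: block_graph_def)
  qed
  moreover have "path_adj (3 - f u) (3 - f v) = path_adj (f u) (f v)" "3 - f u = 3 - f v \<longleftrightarrow> f u = f v"
    "3 - (3 - f u) = f u" if "u \<in> pverts G" "v \<in> pverts G" for u v
    using f4[OF that(1)] f4[OF that(2)] by (auto simp: path_adj_def path_dist_def)
  moreover have "(u, v) \<in> parcs G \<longleftrightarrow> u \<noteq> v \<and> (if f u = f v then clique (f u) else path_adj (f u) (f v))"
    if "u \<in> pverts G" "v \<in> pverts G" for u v using assms that unfolding block_graph_def by blast
  moreover have "(\<lambda>v. 3 - f v) ` pverts G \<subseteq> {..<4}" by auto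
  moreover have "finite (pverts G)" "parcs G \<subseteq> pverts G \<times> pverts G"
    using assms by (simp_all add: block_graph_def)
  ultimately show ?thesis unfolding block_graph_def by simp
qed

lemma iso_P4_productI:
  assumes G: "wf_digraph (with_proj G)" and blk: "block_graph 4 path_adj clique sz G f"
    and "clique 0 = t0 \<or> sz 0 \<le> 1" "clique 1 = t1 \<or> sz 1 \<le> 1" "clique 2 = t2 \<or> sz 2 \<le> 1"
      "clique 3 = t3 \<or> sz 3 \<le> 1"
  shows "G \<cong>\<^sub>G P4_product (monochrome t0 (sz 0)) (monochrome t1 (sz 1)) (monochrome t2 (sz 2)) (monochrome t3 (sz 3))"
  unfolding block_graph_iso_iff[OF G block_graph_P4_product]
proof (rule exI, rule block_graph_cong[OF blk])
  fix i :: nat assume "i < 4"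
  then consider "i = 0" | "i = 1" | "i = 2" | "i = 3" by linarith
  hence "[sz 0, sz 1, sz 2, sz 3] ! i = sz i \<and> ([t0, t1, t2, t3] ! i = clique i \<or> sz i \<le> 1)"
    by cases (use assms(3-) in auto)
  thus "[sz 0, sz 1, sz 2, sz 3] ! i = sz i" "[t0, t1, t2, t3] ! i = clique i \<or> sz i \<le> 1" by blast+
qed

lemma iso_join3I:
  assumes G: "wf_digraph (with_proj G)" and blk: "block_graph 3 star_adj clique sz G f"
    and "clique 0 = t0 \<or> sz 0 \<le> 1" "clique 1 = t1 \<or> sz 1 \<le> 1" "clique 2 = t2 \<or> sz 2 \<le> 1"
  shows "G \<cong>\<^sub>G graph_join (monochrome t0 (sz 0)) (graph_union (monochrome t1 (sz 1)) (monochrome t2 (sz 2)))"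
  unfolding block_graph_iso_iff[OF G block_graph_join3]
proof (rule exI, rule block_graph_cong[OF blk])
  fix i :: nat assume "i < 3"
  then consider "i = 0" | "i = 1" | "i = 2" by linarith
  hence "[sz 0, sz 1, sz 2] ! i = sz i \<and> ([t0, t1, t2] ! i = clique i \<or> sz i \<le> 1)"
    by cases (use assms(3-) in auto)
  thus "[sz 0, sz 1, sz 2] ! i = sz i" "[t0, t1, t2] ! i = clique i \<or> sz i \<le> 1" by blast+
qed

lemma iso_join2I:
  assumes G: "wf_digraph (with_proj G)" and blk: "block_graph 3 star_adj clique sz G f"
    and "clique 0 = t0 \<or> sz 0 \<le> 1" "sz 1 = 0" "clique 2 = t2 \<or> sz 2 \<le> 1"
  shows "G \<cong>\<^sub>G graph_join (monochrome t0 (sz 0)) (monochrome t2 (sz 2))"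
  unfolding block_graph_iso_iff[OF G block_graph_join2]
proof (rule exI, rule block_graph_cong[OF blk])
  fix i :: nat assume "i < 3"
  then consider "i = 0" | "i = 1" | "i = 2" by linarith
  hence "[sz 0, 0, sz 2] ! i = sz i \<and> ([t0, True, t2] ! i = clique i \<or> sz i \<le> 1)"
    by cases (use assms(3-) in auto)
  thus "[sz 0, 0, sz 2] ! i = sz i" "[t0, True, t2] ! i = clique i \<or> sz i \<le> 1" by blast+
qed

lemma lam3_diag_le: "(if b then 1 else 2 - 1 / real n) \<le> 2"
  by simp

lemma lam_penult_diag_ge: "1 \<le> (if b then 1 + 1 / real n else 2)"
  by simp

section \<open>Block graphs and the two conditions in a connected graph\<close>

locale connected_graph = pair_graph G for G :: "'a pair_pre_digraph" +
  assumes conn: "Digraph_Component.connected (with_proj G)"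
    and ne: "pverts G \<noteq> {}"
begin

abbreviation "V \<equiv> pverts G"
abbreviation "d \<equiv> gdist G"

sublocale D: dist_space V d by (rule gdist_dist_space(1)[OF conn])

lemma d1: "u \<in> V \<Longrightarrow> v \<in> V \<Longrightarrow> d u v = 1 \<longleftrightarrow> (u, v) \<in> parcs G"
  by (rule gdist_dist_space(2)[OF conn])

lemma wf: "wf_digraph (with_proj G)"
  by unfold_locales

lemma arcs_sub: "parcs G \<subseteq> V \<times> V"
  using in_arcsD1 in_arcsD2 by auto

lemma diam_le: "diam G \<le> k \<longleftrightarrow> (\<forall>u\<in>V. \<forall>v\<in>V. d u v \<le> k)"
  by (rule diam_le_iff[OF pair_finite_verts ne])

lemma block_graph_of_dist:
  assumes blk: "block_dist k m clique V d f"
  shows "block_graph k (\<lambda>i j. m i j = 1) clique (\<lambda>i. card {v \<in> V. f v = i}) G f"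
proof -
  have "(u, v) \<in> parcs G \<longleftrightarrow> u \<noteq> v \<and> (if f u = f v then clique (f u) else m (f u) (f v) = 1)"
    if "u \<in> V" "v \<in> V" for u v
  proof (cases "u = v")
    case True
    thus ?thesis using d1[OF that] D.dist_eq_0[OF that] by simp
  next
    case False
    thus ?thesis using blk that d1[OF that] unfolding block_dist_def by (auto split: if_splits)
  qed
  thus ?thesis using blk arcs_sub pair_finite_verts unfolding block_graph_def block_dist_def by simp
qed

lemma dist_le_2I: "u \<in> V \<Longrightarrow> w \<in> V \<Longrightarrow> v \<in> V \<Longrightarrow> (u, w) \<in> parcs G \<Longrightarrow> (w, v) \<in> parcs G \<Longrightarrow> d u v \<le> 2"
  using D.dist_tri[of u w v] d1[of u w] d1[of w v] by simp

text \<open>With diameter at most 2, adjacency alone determines the distances.\<close>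

lemma star_block_dist:
  assumes blk: "block_graph 3 star_adj clique sz G f" and diam: "diam G \<le> 2"
  shows "block_dist 3 star_dist clique V d f"
proof -
  have "d u v = (if f u = f v then if clique (f u) then 1 else 2 else star_dist (f u) (f v))"
    if "u \<in> V" "v \<in> V" "u \<noteq> v" for u v
  proof -
    have "d u v = 1 \<or> d u v = 2"
      using diam D.dist_eq_0[OF that(1,2)] that unfolding diam_le by (metis One_nat_def le_SucE le_zero_eq numeral_2_eq_2)
    moreover have "d u v = 1 \<longleftrightarrow> (if f u = f v then clique (f u) else star_adj (f u) (f v))"
      using d1[OF that(1,2)] blk that unfolding block_graph_def by blast
    ultimately show ?thesis by (auto simp: star_adj_def star_dist_def split: if_splits)
  qed
  thus ?thesis using blk unfolding block_dist_def block_graph_def by blast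
qed

text \<open>Nonempty blocks supply the intermediate vertices for distance 2. One step changes the
  label by at most 1, so the two end blocks are at distance at least 3, and the diameter gives
  equality.\<close>

lemma path_block_dist:
  assumes blk: "block_graph 4 path_adj clique sz G f" and pos: "\<And>i. i < 4 \<Longrightarrow> sz i \<ge> 1"
    and diam: "diam G \<le> 3"
  shows "block_dist 4 path_dist clique V d f"
proof -
  have f4: "f v < 4" if "v \<in> V" for v using blk that unfolding block_graph_def by blast
  have arc: "(u, v) \<in> parcs G \<longleftrightarrow> u \<noteq> v \<and> (if f u = f v then clique (f u) else path_adj (f u) (f v))"
    if "u \<in> V" "v \<in> V" for u v using blk that unfolding block_graph_def by blast
  have rep: "\<exists>w\<in>V. f w = i" if "i < 4" for i
  proof -
    have "card {v \<in> V. f v = i} \<ge> 1" using blk pos[OF that] that by (simp add: block_graph_def)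
    hence "{v \<in> V. f v = i} \<noteq> {}" by (metis card.empty not_one_le_zero)
    thus ?thesis by blast
  qed
  have padj: "path_adj i j \<longleftrightarrow> j = Suc i \<or> i = Suc j" for i j
    by (auto simp: path_adj_def path_dist_def)
  have "d u v = (if f u = f v then if clique (f u) then 1 else 2 else path_dist (f u) (f v))"
    if uv: "u \<in> V" "v \<in> V" "u \<noteq> v" for u v
  proof -
    note f = f4[OF uv(1)] f4[OF uv(2)]
    have d0: "d u v \<noteq> 0" using D.dist_eq_0 uv by simp
    have d3: "d u v \<le> 3" using diam uv unfolding diam_le by blast
    have two: "d u v = 2" if i: "i < 4" "path_adj (f u) i" "path_adj i (f v)"
      and na: "(u, v) \<notin> parcs G" for i
    proof -
      obtain w where w: "w \<in> V" "f w = i" using rep[OF i(1)] by blast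
      have ne: "f u \<noteq> f w" "f w \<noteq> f v" using i(2,3) unfolding w(2) padj by linarith+
      have "(u, w) \<in> parcs G" unfolding arc[OF uv(1) w(1)] using ne(1) i(2) w(2) by auto
      moreover have "(w, v) \<in> parcs G" unfolding arc[OF w(1) uv(2)] using ne(2) i(3) w(2) by auto
      ultimately have "d u v \<le> 2" using dist_le_2I uv w by blast
      moreover have "d u v \<noteq> 1" using d1 uv na by simp
      ultimately show ?thesis using d0 by linarith
    qed
    show ?thesis
    proof (cases "f u = f v")
      case True
      show ?thesis
      proof (cases "clique (f u)")
        case True
        thus ?thesis using d1[OF uv(1,2)] arc[OF uv(1,2)] uv(3) \<open>f u = f v\<close> by simp
      next
        case False
        \<comment> \<open>Two vertices of an edgeless block have a common neighbour in an adjacent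
          block.\<close>
        have "\<exists>i<4. path_adj (f u) i \<and> path_adj i (f v)"
          unfolding padj using f True
          by (cases "f u = 0") (intro exI[of _ 1], simp, intro exI[of _ "f u - 1"], simp)
        moreover have "(u, v) \<notin> parcs G" unfolding arc[OF uv(1,2)] using True False by simp
        ultimately have "d u v = 2" using two by blast
        thus ?thesis using True False by simp
      qed
    next
      case False
      then consider "path_adj (f u) (f v)" | "f v = f u + 2 \<or> f u = f v + 2" | "f u = 0 \<and> f v = 3 \<or> f u = 3 \<and> f v = 0"
        using f unfolding padj by linarith
      thus ?thesis
      proof cases
        case 1
        hence "d u v = 1" using d1[OF uv(1,2)] arc[OF uv(1,2)] uv(3) False by simp
        thus ?thesis using 1 False by (simp add: path_adj_def)
      next
        case 2
        hence "\<exists>i<4. path_adj (f u) i \<and> path_adj i (f v)"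
          unfolding padj using f by (intro exI[of _ "min (f u) (f v) + 1"]) linarith
        moreover have "\<not> path_adj (f u) (f v)" using 2 unfolding padj by linarith
        hence "(u, v) \<notin> parcs G" unfolding arc[OF uv(1,2)] using False by simp
        ultimately have d2: "d u v = 2" using two by blast
        from 2 have "path_dist (f u) (f v) = 2" by (elim disjE) (simp_all add: path_dist_def)
        thus ?thesis using d2 False by simp
      next
        case 3
        have "d u v \<noteq> 1" unfolding d1[OF uv(1,2)] arc[OF uv(1,2)] padj using 3 by auto
        moreover have "d u v \<noteq> 2"
        proof
          assume "d u v = 2"
          then obtain w where w: "w \<in> V" "d u w = 1" "d w v = 1"
            using D.dist_between[OF uv(1,2), of 1] by auto
          have "(u, w) \<in> parcs G" using w(2) d1[OF uv(1) w(1)] by blast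
          moreover have "(w, v) \<in> parcs G" using w(3) d1[OF w(1) uv(2)] by blast
          ultimately have "f u = f w \<or> path_adj (f u) (f w)" "f w = f v \<or> path_adj (f w) (f v)"
            unfolding arc[OF uv(1) w(1)] arc[OF w(1) uv(2)] by argo+
          thus False using 3 unfolding padj by auto
        qed
        ultimately have "d u v = 3" using d0 d3 by linarith
        thus ?thesis using 3 by (auto simp: path_dist_def)
      qed
    qed
  qed
  thus ?thesis using blk unfolding block_dist_def block_graph_def by blast
qed

lemma star_blocks_good:
  assumes blk: "block_graph 3 star_adj clique sz G f" and "clique 1" and diam: "diam G \<le> 2"
  shows "lam3_cond V d" and "lam_penult_cond V d"
proof -
  note bd = star_block_dist[OF blk diam]
  show "lam3_cond V d"
    using \<open>clique 1\<close>
    by (intro D.lam3_cond_of_blocks[OF bd] bcond3_star lam3_diag_le) (simp only: if_True order_refl)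
  show "lam_penult_cond V d"
    by (intro D.lam_penult_cond_of_blocks[OF bd] bcond2_star lam_penult_diag_ge)
qed

text \<open>The first condition is governed by the sizes of the edgeless blocks, a clique counting
  as 1. For the second, an edgeless block at position 0 or 2 suffices; for four cliques the
  determinant decides.\<close>

lemma path_blocks_good:
  assumes blk: "block_graph 4 path_adj clique sz G f" and pos: "\<And>i. i < 4 \<Longrightarrow> sz i \<ge> 1"
    and diam: "diam G \<le> 3"
    and ok: "path_sizes_ok (if clique 0 then 1 else sz 0) (if clique 1 then 1 else sz 1)
      (if clique 2 then 1 else sz 2) (if clique 3 then 1 else sz 3)"
    and two: "\<not> clique 0 \<or> \<not> clique 2 \<or>
      (\<forall>i<4. clique i) \<and> clique_poly (sz 0) (sz 1) (sz 2) (sz 3) \<le> 0"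
  shows "lam3_cond V d" and "lam_penult_cond V d"
proof -
  note bd = path_block_dist[OF blk pos diam]
  have sz: "card {v \<in> V. f v = i} = sz i" if "i < 4" for i using blk that by (simp add: block_graph_def)
  show "lam3_cond V d"
  proof (rule D.lam3_cond_of_blocks[OF bd])
    have "(if clique i then 1 else sz i) \<ge> 1" if "i < 4" for i using pos[OF that] by simp
    hence "bcond3 4 (\<lambda>i. 2 - 1 / real (if clique i then 1 else sz i)) path_dist"
      using ok by (subst bcond3_path_iff)
    thus "bcond3 4 (\<lambda>i. if clique i then 1 else 2 - 1 / real (card {v \<in> V. f v = i})) path_dist"
    proof (rule bcond3_antimono)
      fix i :: nat assume "i < 4"
      show "(if clique i then 1 else 2 - 1 / real (card {v \<in> V. f v = i})) \<le> 2 - 1 / real (if clique i then 1 else sz i)"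
        unfolding sz[OF \<open>i < 4\<close>] by simp
    qed
  qed
  show "lam_penult_cond V d"
  proof (rule D.lam_penult_cond_of_blocks[OF bd])
    let ?c = "\<lambda>i. if clique i then 1 + 1 / real (card {v \<in> V. f v = i}) else 2"
    consider "\<not> clique 0" | "\<not> clique 2"
      | "\<forall>i<4. clique i" "clique_poly (sz 0) (sz 1) (sz 2) (sz 3) \<le> 0" using two by blast
    thus "bcond2 4 ?c path_dist"
    proof cases
      case 1
      thus ?thesis by (intro bcond2_path_2111 lam_penult_diag_ge) (simp only: if_False order_refl)
    next
      case 2
      thus ?thesis by (intro bcond2_path_1121 lam_penult_diag_ge) (simp only: if_False order_refl)
    next
      case 3
      hence "bcond2 4 (\<lambda>i. 1 + 1 / real (sz i)) path_dist"
        using bcond2_path_cliques[of sz] pos by blast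
      thus ?thesis
      proof (rule bcond2_mono)
        fix i :: nat assume i: "i < 4"
        show "1 + 1 / real (sz i) \<le> ?c i" unfolding sz[OF i] using 3 i by simp
      qed
    qed
  qed
qed

end

context connected_graph begin

text \<open>One-vertex blocks are reread as cliques, and the path is reversed where this brings the
  edgeless blocks into one of the five listed shapes. The hypothesis \<open>poly\<close> is
  conditional because the determinant criterion applies when every block can be read as a
  clique.\<close>

lemma path_block_graph_normal_form:
  assumes blk: "block_graph 4 path_adj clique sz G f" and pos: "\<And>i. i < 4 \<Longrightarrow> sz i \<ge> 1"
    and ok: "path_sizes_ok (if clique 0 then 1 else sz 0) (if clique 1 then 1 else sz 1)
      (if clique 2 then 1 else sz 2) (if clique 3 then 1 else sz 3)"
    and poly: "(\<And>i. i < 4 \<Longrightarrow> clique i \<or> sz i = 1) \<Longrightarrow> clique_poly (sz 0) (sz 1) (sz 2) (sz 3) \<le> 0"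
  obtains a b c d where "a \<ge> 1" "b \<ge> 1" "c \<ge> 1" "d \<ge> 1"
    and "G \<cong>\<^sub>G P4_product (complete_graph a) (complete_graph b) (complete_graph c) (complete_graph d) \<and>
        clique_poly a b c d \<le> 0 \<or>
      G \<cong>\<^sub>G P4_product (edgeless_graph a) (complete_graph b) (complete_graph c) (complete_graph d) \<or>
      G \<cong>\<^sub>G P4_product (complete_graph a) (complete_graph b) (edgeless_graph c) (complete_graph d) \<or>
      G \<cong>\<^sub>G P4_product (edgeless_graph a) (complete_graph b) (complete_graph c) (edgeless_graph d) \<and> a = 2 \<and> d \<le> 2 \<or>
      G \<cong>\<^sub>G P4_product (edgeless_graph a) (edgeless_graph b) (complete_graph c) (complete_graph d) \<and> a = 2 \<and> b \<le> 2"
proof -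
  \<comment> \<open>The effective size, equal to 1 exactly if the block can be read as a
    clique.\<close>
  define e where "e i = (if clique i then 1 else sz i)" for i
  have p: "sz 0 \<ge> 1" "sz 1 \<ge> 1" "sz 2 \<ge> 1" "sz 3 \<ge> 1" by (rule pos, simp)+
  have e1: "clique i \<or> sz i \<le> 1" if "e i = 1" for i using that by (auto simp: e_def split: if_splits)
  have e2: "\<not> clique i" "sz i = e i" if "e i \<noteq> 1" for i using that by (auto simp: e_def split: if_splits)
  note rev = block_graph_path_reverse[OF blk]
  have iso: "G \<cong>\<^sub>G P4_product (monochrome t0 (sz 0)) (monochrome t1 (sz 1)) (monochrome t2 (sz 2)) (monochrome t3 (sz 3))"
    if "\<And>i. i < 4 \<Longrightarrow> e i = 1 \<longleftrightarrow> [t0, t1, t2, t3] ! i" for t0 t1 t2 t3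
  proof -
    have "clique i = [t0, t1, t2, t3] ! i \<or> sz i \<le> 1" if "i < 4" for i
      using e1[of i] e2[of i] \<open>\<And>i. i < 4 \<Longrightarrow> e i = 1 \<longleftrightarrow> [t0, t1, t2, t3] ! i\<close>[OF that] by blast
    from this[of 0] this[of 1] this[of 2] this[of 3] show ?thesis
      by (intro iso_P4_productI[OF wf blk]) simp_all
  qed
  have iso': "G \<cong>\<^sub>G P4_product (monochrome t3 (sz 3)) (monochrome t2 (sz 2)) (monochrome t1 (sz 1)) (monochrome t0 (sz 0))"
    if "\<And>i. i < 4 \<Longrightarrow> e i = 1 \<longleftrightarrow> [t0, t1, t2, t3] ! i" for t0 t1 t2 t3
  proof -
    have "clique i = [t0, t1, t2, t3] ! i \<or> sz i \<le> 1" if "i < 4" for i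
      using e1[of i] e2[of i] \<open>\<And>i. i < 4 \<Longrightarrow> e i = 1 \<longleftrightarrow> [t0, t1, t2, t3] ! i\<close>[OF that] by blast
    from this[of 0] this[of 1] this[of 2] this[of 3] show ?thesis
      using iso_P4_productI[OF wf rev, of t3 t2 t1 t0] by simp
  qed
  have eq: "e i = 1 \<longleftrightarrow> [e 0 = 1, e 1 = 1, e 2 = 1, e 3 = 1] ! i" if "i < 4" for i
  proof -
    from that consider "i = 0" | "i = 1" | "i = 2" | "i = 3" by linarith
    thus ?thesis by cases simp_all
  qed
  note I = iso[OF eq] and I' = iso'[OF eq]
  have "path_sizes_ok (e 0) (e 1) (e 2) (e 3)" using ok by (simp only: e_def)
  hence "e 0 = 1 \<and> e 1 = 1 \<and> e 2 = 1 \<and> e 3 = 1 \<or>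
    e 0 \<noteq> 1 \<and> e 1 = 1 \<and> e 2 = 1 \<and> e 3 = 1 \<or> e 0 = 1 \<and> e 1 \<noteq> 1 \<and> e 2 = 1 \<and> e 3 = 1 \<or>
    e 0 = 1 \<and> e 1 = 1 \<and> e 2 \<noteq> 1 \<and> e 3 = 1 \<or> e 0 = 1 \<and> e 1 = 1 \<and> e 2 = 1 \<and> e 3 \<noteq> 1 \<or>
    e 0 \<noteq> 1 \<and> e 0 \<le> 2 \<and> e 1 = 1 \<and> e 2 = 1 \<and> e 3 \<noteq> 1 \<and> e 3 \<le> 2 \<or>
    e 0 \<noteq> 1 \<and> e 0 \<le> 2 \<and> e 1 \<noteq> 1 \<and> e 1 \<le> 2 \<and> e 2 = 1 \<and> e 3 = 1 \<or>
    e 0 = 1 \<and> e 1 = 1 \<and> e 2 \<noteq> 1 \<and> e 2 \<le> 2 \<and> e 3 \<noteq> 1 \<and> e 3 \<le> 2"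
    unfolding path_sizes_ok_def
    by (cases "e 0 = 1"; cases "e 1 = 1"; cases "e 2 = 1"; cases "e 3 = 1"; simp only: simp_thms)
  then consider "e 0 = 1" "e 1 = 1" "e 2 = 1" "e 3 = 1"
    | "e 0 \<noteq> 1" "e 1 = 1" "e 2 = 1" "e 3 = 1" | "e 0 = 1" "e 1 \<noteq> 1" "e 2 = 1" "e 3 = 1"
    | "e 0 = 1" "e 1 = 1" "e 2 \<noteq> 1" "e 3 = 1" | "e 0 = 1" "e 1 = 1" "e 2 = 1" "e 3 \<noteq> 1"
    | "e 0 \<noteq> 1" "e 0 \<le> 2" "e 1 = 1" "e 2 = 1" "e 3 \<noteq> 1" "e 3 \<le> 2"
    | "e 0 \<noteq> 1" "e 0 \<le> 2" "e 1 \<noteq> 1" "e 1 \<le> 2" "e 2 = 1" "e 3 = 1"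
    | "e 0 = 1" "e 1 = 1" "e 2 \<noteq> 1" "e 2 \<le> 2" "e 3 \<noteq> 1" "e 3 \<le> 2"
    by (elim disjE conjE)
  thus thesis
  proof cases
    case 1
    have "clique i \<or> sz i = 1" if i: "i < 4" for i
    proof -
      from i consider "i = 0" | "i = 1" | "i = 2" | "i = 3" by linarith
      hence "e i = 1" by cases (simp_all only: 1)
      thus ?thesis using e1[of i] pos[OF i] by linarith
    qed
    hence "clique_poly (sz 0) (sz 1) (sz 2) (sz 3) \<le> 0" by (rule poly)
    with I 1 p show thesis by (intro that[of "sz 0" "sz 1" "sz 2" "sz 3"]) (simp_all add: monochrome_simps)
  next
    case 2
    with I p show thesis by (intro that[of "sz 0" "sz 1" "sz 2" "sz 3"]) (simp_all add: monochrome_simps)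
  next
    case 3
    with I' p show thesis by (intro that[of "sz 3" "sz 2" "sz 1" "sz 0"]) (simp_all add: monochrome_simps)
  next
    case 4
    with I p show thesis by (intro that[of "sz 0" "sz 1" "sz 2" "sz 3"]) (simp_all add: monochrome_simps)
  next
    case 5
    with I' p show thesis by (intro that[of "sz 3" "sz 2" "sz 1" "sz 0"]) (simp_all add: monochrome_simps)
  next
    case 6
    have "sz 0 = 2" "sz 3 = 2" using e2[OF 6(1)] e2[OF 6(5)] 6 p by linarith+
    with I 6 p show thesis by (intro that[of "sz 0" "sz 1" "sz 2" "sz 3"]) (simp_all add: monochrome_simps)
  next
    case 7
    have "sz 0 = 2" "sz 1 = 2" using e2[OF 7(1)] e2[OF 7(3)] 7 p by linarith+
    with I 7 p show thesis by (intro that[of "sz 0" "sz 1" "sz 2" "sz 3"]) (simp_all add: monochrome_simps)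
  next
    case 8
    have "sz 2 = 2" "sz 3 = 2" using e2[OF 8(3)] e2[OF 8(5)] 8 p by linarith+
    with I' 8 p show thesis by (intro that[of "sz 3" "sz 2" "sz 1" "sz 0"]) (simp_all add: monochrome_simps)
  qed
qed

lemma diameter_3_classification:
  assumes good: "lam3_cond V d" "lam_penult_cond V d" and uv: "u \<in> V" "v \<in> V" "d u v = 3"
  obtains a b c e where "a \<ge> 1" "b \<ge> 1" "c \<ge> 1" "e \<ge> 1"
    and "G \<cong>\<^sub>G P4_product (complete_graph a) (complete_graph b) (complete_graph c) (complete_graph e) \<and>
        clique_poly a b c e \<le> 0 \<or>
      G \<cong>\<^sub>G P4_product (edgeless_graph a) (complete_graph b) (complete_graph c) (complete_graph e) \<or>
      G \<cong>\<^sub>G P4_product (complete_graph a) (complete_graph b) (edgeless_graph c) (complete_graph e) \<or>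
      G \<cong>\<^sub>G P4_product (edgeless_graph a) (complete_graph b) (complete_graph c) (edgeless_graph e) \<and> a = 2 \<and> e \<le> 2 \<or>
      G \<cong>\<^sub>G P4_product (edgeless_graph a) (edgeless_graph b) (complete_graph c) (complete_graph e) \<and> a = 2 \<and> b \<le> 2"
proof -
  interpret good_dist_space V d by unfold_locales (rule good)+
  obtain f clique where bd: "block_dist 4 path_dist clique V d f" and sur: "{..<4} \<subseteq> f ` V"
    using path_block_dist[OF uv] by blast
  define sz where "sz i = card {w \<in> V. f w = i}" for i
  have pos: "sz i \<ge> 1" if "i < 4" for i
  proof -
    have "{w \<in> V. f w = i} \<noteq> {}" using sur that by blast
    thus ?thesis using pair_finite_verts unfolding sz_def by (simp add: Suc_le_eq card_gt_0_iff)
  qed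
  have blk: "block_graph 4 path_adj clique sz G f"
    using block_graph_of_dist[OF bd] unfolding path_adj_def[abs_def] sz_def[abs_def] .
  have "bcond3 4 (\<lambda>i. 2 - 1 / real (if clique i then 1 else sz i)) path_dist"
    by (rule bcond3_antimono[OF D.blocks_of_lam3_cond[OF bd sur good(1)]]) (simp add: sz_def)
  hence ok: "path_sizes_ok (if clique 0 then 1 else sz 0) (if clique 1 then 1 else sz 1)
      (if clique 2 then 1 else sz 2) (if clique 3 then 1 else sz 3)"
    using bcond3_path_iff[of "\<lambda>i. if clique i then 1 else sz i"] pos by simp
  \<comment> \<open>A single vertex declared edgeless has the entry 2, which is also
    \<open>1 + 1 / 1\<close>; the criterion for four cliques therefore applies to it as
    well.\<close>
  have poly: "clique_poly (sz 0) (sz 1) (sz 2) (sz 3) \<le> 0" if cl: "\<And>i. i < 4 \<Longrightarrow> clique i \<or> sz i = 1"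
  proof -
    have "bcond2 4 (\<lambda>i. 1 + 1 / real (sz i)) path_dist"
    proof (rule bcond2_mono[OF D.blocks_of_lam_penult_cond[OF bd sur good(2)]])
      fix i :: nat assume "i < 4"
      thus "(if clique i then 1 + 1 / real (card {w \<in> V. f w = i}) else 2) \<le> 1 + 1 / real (sz i)"
        using cl[of i] by (auto simp flip: sz_def)
    qed
    thus ?thesis using bcond2_path_cliques[of sz] pos by blast
  qed
  from path_block_graph_normal_form[OF blk pos ok poly] that show thesis by blast
qed

text \<open>Either no two vertices are at distance 2, or there is an induced triangle with a pendant
  edge, which yields three blocks, or there is only an induced path with three vertices, which
  yields two.\<close>

lemma diameter_2_classification:
  assumes good: "lam3_cond V d" "lam_penult_cond V d" and diam: "diam G \<le> 2" and n: "n = card V" "n \<ge> 3"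
  shows "n \<ge> 4 \<and> G \<cong>\<^sub>G complete_graph n
     \<or> (\<exists>a b. a \<ge> 2 \<and> b \<ge> 1 \<and>
          G \<cong>\<^sub>G graph_join (complete_graph a) (edgeless_graph b))
     \<or> (\<exists>a b c. a \<ge> 2 \<and> b \<ge> 2 \<and> c \<ge> 2 \<and>
          G \<cong>\<^sub>G graph_join (complete_graph a) (graph_union (complete_graph b) (complete_graph c)))
     \<or> (\<exists>a b c. a \<ge> 2 \<and> b \<ge> 2 \<and> c \<ge> 1 \<and>
          G \<cong>\<^sub>G graph_join (complete_graph a) (graph_union (complete_graph b) (edgeless_graph c)))
     \<or> (\<exists>a b. a \<ge> 1 \<and> b \<ge> 1 \<and>
          G \<cong>\<^sub>G graph_join (edgeless_graph a) (edgeless_graph b))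
     \<or> (\<exists>a b c. a \<ge> 1 \<and> b \<ge> 2 \<and> c \<ge> 2 \<and>
          G \<cong>\<^sub>G graph_join (edgeless_graph a) (graph_union (complete_graph b) (complete_graph c)))
     \<or> (\<exists>a b c. a \<ge> 1 \<and> c \<ge> 1 \<and> b \<ge> 2 \<and>
          G \<cong>\<^sub>G graph_join (edgeless_graph a) (graph_union (complete_graph b) (edgeless_graph c)))"
proof -
  interpret good_dist_space V d by unfold_locales (rule good)+
  have d2: "d u v \<le> 2" if "u \<in> V" "v \<in> V" for u v using diam that unfolding diam_le by blast
  have star_graph: "block_graph 3 star_adj clique (\<lambda>i. card {w \<in> V. f w = i}) G f"
    if "block_dist 3 star_dist clique V d f" for clique f
    using block_graph_of_dist[OF that] unfolding star_adj_def[abs_def] .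
  have size: "card {w \<in> V. f w = i} \<ge> 1" if "x \<in> V" "f x = i" for x i and f :: "'a \<Rightarrow> nat"
  proof -
    have "{w \<in> V. f w = i} \<noteq> {}" using that by blast
    thus ?thesis using pair_finite_verts by (simp add: Suc_le_eq card_gt_0_iff)
  qed
  consider (complete) "\<forall>u\<in>V. \<forall>v\<in>V. u \<noteq> v \<longrightarrow> d u v = 1"
    | (paw) x y y' z where "x \<in> V" "y \<in> V" "y' \<in> V" "z \<in> V" "paw x y y' z"
    | (pawfree) u v where "u \<in> V" "v \<in> V" "d u v = 2"
        "\<And>x y y' z. x \<in> V \<Longrightarrow> y \<in> V \<Longrightarrow> y' \<in> V \<Longrightarrow> z \<in> V \<Longrightarrow> \<not> paw x y y' z"
  proof (cases "\<exists>x\<in>V. \<exists>y\<in>V. \<exists>y'\<in>V. \<exists>z\<in>V. paw x y y' z")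
    case True
    thus ?thesis using paw by blast
  next
    case nopaw: False
    show ?thesis
    proof (cases "\<exists>u\<in>V. \<exists>v\<in>V. d u v = 2")
      case True
      thus ?thesis using nopaw pawfree by blast
    next
      case False
      have "d u v = 1" if "u \<in> V" "v \<in> V" "u \<noteq> v" for u v
        using dist_1_or_2[OF d2 that] False that(1,2) by blast
      thus ?thesis using complete by blast
    qed
  qed
  thus ?thesis
  proof cases
    case complete
    show ?thesis
    proof (cases "n \<ge> 4")
      case True
      have "block_dist 3 star_dist (\<lambda>_. True) V d (\<lambda>_. 0)"
        unfolding block_dist_def using complete by auto
      from star_graph[OF this]
      have "block_graph 3 star_adj (\<lambda>_. True) (\<lambda>i. [n, 0, 0] ! i) G (\<lambda>_. 0)"
      proof (rule block_graph_cong)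
        fix i :: nat assume "i < 3"
        then consider "i = 0" | "i = 1" | "i = 2" by linarith
        thus "[n, 0, 0] ! i = card {w \<in> V. 0 = i}" by cases (simp_all add: n)
      qed simp
      hence "G \<cong>\<^sub>G complete_graph n" unfolding block_graph_iso_iff[OF wf block_graph_complete] by blast
      thus ?thesis using True by blast
    next
      \<comment> \<open>The complete graph on three vertices is the join of two adjacent vertices
        and one more, since the complete family starts at four vertices.\<close>
      case False
      hence n3: "card V = 3" using n by simp
      obtain x where x: "x \<in> V" using ne by blast
      define f where "f v = (if v = x then 2 else 0 :: nat)" for v
      have "block_dist 3 star_dist (\<lambda>_. True) V d f"
        unfolding block_dist_def using complete by (auto simp: f_def star_dist_def)
      note blk = star_graph[OF this]
      have "{w \<in> V. f w = 0} = V - {x}" "{w \<in> V. f w = 1} = {}" "{w \<in> V. f w = 2} = {x}"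
        using x by (auto simp: f_def)
      hence c: "card {w \<in> V. f w = 0} = 2" "card {w \<in> V. f w = 1} = 0" "card {w \<in> V. f w = 2} = 1"
        using n3 x pair_finite_verts by (simp_all only: card_Diff_singleton card.empty) simp_all
      have "G \<cong>\<^sub>G graph_join (monochrome True 2) (monochrome False 1)"
        using iso_join2I[OF wf blk, of True False] c by simp
      hence "\<exists>a b. a \<ge> 2 \<and> b \<ge> 1 \<and> G \<cong>\<^sub>G graph_join (complete_graph a) (edgeless_graph b)"
        unfolding monochrome_simps by (intro exI[of _ 2] exI[of _ 1] conjI order_refl)
      thus ?thesis by (simp only: simp_thms)
    qed
  next
    case (paw x y y' z)
    obtain f clique where bd: "block_dist 3 star_dist clique V d f" and c1: "clique 1"
      and f: "f x = 0" "f y = 1" "f y' = 1" "f z = 2"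
      using paw_block_dist[OF d2 paw] by blast
    define sz where "sz i = card {w \<in> V. f w = i}" for i
    have blk: "block_graph 3 star_adj clique sz G f"
      using star_graph[OF bd] unfolding sz_def[abs_def] .
    have s0: "sz 0 \<ge> 1" and s2: "sz 2 \<ge> 1" using size[of x f 0, OF paw(1) f(1)] size[of z f 2, OF paw(4) f(4)] by (simp_all add: sz_def)
    have "y \<noteq> y'" using paw(2,5) D.dist_eq_0[of y y'] by (auto simp: paw_def)
    moreover have "card {y, y'} \<le> sz 1"
      unfolding sz_def using pair_finite_verts paw f by (intro card_mono) auto
    ultimately have s1: "sz 1 \<ge> 2" by simp
    \<comment> \<open>A one-vertex block is called edgeless here, because the families ask for at
      least two vertices in these blocks when they are complete.\<close>
    define t0 t2 where "t0 \<longleftrightarrow> clique 0 \<and> sz 0 \<ge> 2" and "t2 \<longleftrightarrow> clique 2 \<and> sz 2 \<ge> 2"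
    have "G \<cong>\<^sub>G graph_join (monochrome t0 (sz 0)) (graph_union (monochrome True (sz 1)) (monochrome t2 (sz 2)))"
      by (rule iso_join3I[OF wf blk]) (use c1 in \<open>auto simp: t0_def t2_def\<close>)
    note J = this
    consider (TT) "t0" "t2" | (TF) "t0" "\<not> t2" | (FT) "\<not> t0" "t2" | (FF) "\<not> t0" "\<not> t2" by argo
    thus ?thesis
    proof cases
      case TT
      have b0: "sz 0 \<ge> 2" using TT by (simp add: t0_def)
      have b2: "sz 2 \<ge> 2" using TT by (simp add: t2_def)
      have "G \<cong>\<^sub>G graph_join (complete_graph (sz 0)) (graph_union (complete_graph (sz 1)) (complete_graph (sz 2)))"
        using J TT by (simp only: monochrome_def if_True if_False)
      hence "\<exists>a b c. a \<ge> 2 \<and> b \<ge> 2 \<and> c \<ge> 2 \<and>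
          G \<cong>\<^sub>G graph_join (complete_graph a) (graph_union (complete_graph b) (complete_graph c))"
        by (intro exI[of _ "sz 0"] exI[of _ "sz 1"] exI[of _ "sz 2"] conjI b0 s1 b2)
      thus ?thesis by (simp only: simp_thms)
    next
      case TF
      have b0: "sz 0 \<ge> 2" using TF by (simp add: t0_def)
      have "G \<cong>\<^sub>G graph_join (complete_graph (sz 0)) (graph_union (complete_graph (sz 1)) (edgeless_graph (sz 2)))"
        using J TF by (simp only: monochrome_def if_True if_False)
      hence "\<exists>a b c. a \<ge> 2 \<and> b \<ge> 2 \<and> c \<ge> 1 \<and>
          G \<cong>\<^sub>G graph_join (complete_graph a) (graph_union (complete_graph b) (edgeless_graph c))"
        by (intro exI[of _ "sz 0"] exI[of _ "sz 1"] exI[of _ "sz 2"] conjI b0 s1 s2)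
      thus ?thesis by (simp only: simp_thms)
    next
      case FT
      have b2: "sz 2 \<ge> 2" using FT by (simp add: t2_def)
      have "G \<cong>\<^sub>G graph_join (edgeless_graph (sz 0)) (graph_union (complete_graph (sz 1)) (complete_graph (sz 2)))"
        using J FT by (simp only: monochrome_def if_True if_False)
      hence "\<exists>a b c. a \<ge> 1 \<and> b \<ge> 2 \<and> c \<ge> 2 \<and>
          G \<cong>\<^sub>G graph_join (edgeless_graph a) (graph_union (complete_graph b) (complete_graph c))"
        by (intro exI[of _ "sz 0"] exI[of _ "sz 1"] exI[of _ "sz 2"] conjI s0 s1 b2)
      thus ?thesis by (simp only: simp_thms)
    next
      case FF
      have "G \<cong>\<^sub>G graph_join (edgeless_graph (sz 0)) (graph_union (complete_graph (sz 1)) (edgeless_graph (sz 2)))"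
        using J FF by (simp only: monochrome_def if_True if_False)
      hence "\<exists>a b c. a \<ge> 1 \<and> c \<ge> 1 \<and> b \<ge> 2 \<and>
          G \<cong>\<^sub>G graph_join (edgeless_graph a) (graph_union (complete_graph b) (edgeless_graph c))"
        by (intro exI[of _ "sz 0"] exI[of _ "sz 1"] exI[of _ "sz 2"] conjI s0 s2 s1)
      thus ?thesis by (simp only: simp_thms)
    qed
  next
    case (pawfree y z)
    obtain x where x: "x \<in> V" "d y x = 1" "d x z = 1" using common_neighbour[OF d2 pawfree(1-3)] by blast
    hence "d x y = 1" using D.dist_sym[OF x(1) pawfree(1)] x(2) by simp
    from pawfree_block_dist[OF d2 pawfree(4) x(1) pawfree(1,2) this x(3) pawfree(3)]
    obtain g clique where bd: "block_dist 2 star_dist clique V d g" and c1: "\<not> clique 1"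
      and g: "g x = 0" "g y = 1" by blast
    \<comment> \<open>Label 1 is renamed to 2, so that block 1 stays empty as in a join of two
      graphs.\<close>
    define f where "f v = (if g v = 1 then 2 else g v)" for v
    have g2: "g v = 0 \<or> g v = 1" if "v \<in> V" for v
    proof -
      have "g v < 2" using bd that unfolding block_dist_def by blast
      thus ?thesis by linarith
    qed
    define cl where "cl i \<longleftrightarrow> i = 0 \<and> clique 0" for i :: nat
    have "block_dist 3 star_dist cl V d f"
      unfolding block_dist_def
    proof (intro conjI ballI impI)
      show "f ` V \<subseteq> {..<3}"
      proof (rule image_subsetI)
        fix v assume "v \<in> V"
        from g2[OF this] show "f v \<in> {..<3}" by (elim disjE) (simp_all add: f_def)
      qed
      fix u v assume uv: "u \<in> V" "v \<in> V" "u \<noteq> v"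
      have duv: "d u v = (if g u = g v then if clique (g u) then 1 else 2 else star_dist (g u) (g v))"
        using bd uv unfolding block_dist_def by blast
      from g2[OF uv(1)] g2[OF uv(2)] c1
      show "d u v = (if f u = f v then if cl (f u) then 1 else 2 else star_dist (f u) (f v))"
        unfolding duv by (elim disjE) (simp_all add: f_def cl_def star_dist_def)
    qed
    note blk = star_graph[OF this]
    have s: "card {w \<in> V. f w = 0} \<ge> 1" "card {w \<in> V. f w = 2} \<ge> 1"
      by (rule size[of x f 0, OF x(1)], simp add: f_def g)
        (rule size[of y f 2, OF pawfree(1)], simp add: f_def g)
    have "{w \<in> V. f w = 1} = {}" using g2 by (auto simp: f_def)
    hence s1: "card {w \<in> V. f w = 1} = 0" by simp
    define t0 where "t0 \<longleftrightarrow> clique 0 \<and> card {w \<in> V. f w = 0} \<ge> 2"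
    have "G \<cong>\<^sub>G graph_join (monochrome t0 (card {w \<in> V. f w = 0})) (monochrome False (card {w \<in> V. f w = 2}))"
      by (rule iso_join2I[OF wf blk]) (use s1 in \<open>auto simp: t0_def cl_def\<close>)
    note J = this
    show ?thesis
    proof (cases t0)
      case True
      hence t: "card {w \<in> V. f w = 0} \<ge> 2" by (simp add: t0_def)
      have "G \<cong>\<^sub>G graph_join (complete_graph (card {w \<in> V. f w = 0})) (edgeless_graph (card {w \<in> V. f w = 2}))"
        using J True by (simp only: monochrome_def if_True if_False)
      hence "\<exists>a b. a \<ge> 2 \<and> b \<ge> 1 \<and> G \<cong>\<^sub>G graph_join (complete_graph a) (edgeless_graph b)"
        by (intro exI[of _ "card {w \<in> V. f w = 0}"] exI[of _ "card {w \<in> V. f w = 2}"] conjI t s)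
      thus ?thesis by (simp only: simp_thms)
    next
      case False
      have "G \<cong>\<^sub>G graph_join (edgeless_graph (card {w \<in> V. f w = 0})) (edgeless_graph (card {w \<in> V. f w = 2}))"
        using J False by (simp only: monochrome_def if_True if_False)
      hence "\<exists>a b. a \<ge> 1 \<and> b \<ge> 1 \<and> G \<cong>\<^sub>G graph_join (edgeless_graph a) (edgeless_graph b)"
        by (intro exI[of _ "card {w \<in> V. f w = 0}"] exI[of _ "card {w \<in> V. f w = 2}"] conjI s)
      thus ?thesis by (simp only: simp_thms)
    qed
  qed
qed

text \<open>All families of diameter at most 2 are star block graphs whose block 1 is a clique,
  possibly empty; this is all that the criterion asks for.\<close>

lemma star_products_good:
  assumes diam: "diam G \<le> 2"
    and iso: "G \<cong>\<^sub>G complete_graph n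
      \<or> G \<cong>\<^sub>G graph_join (monochrome t0 a) (monochrome t2 c)
      \<or> G \<cong>\<^sub>G graph_join (monochrome t0 a) (graph_union (monochrome True b) (monochrome t2 c))"
  shows "lam3_cond V d \<and> lam_penult_cond V d"
proof -
  have "\<exists>clique sz f. block_graph 3 star_adj clique sz G f \<and> clique 1"
    using iso unfolding block_graph_iso_iff[OF wf block_graph_complete]
      block_graph_iso_iff[OF wf block_graph_join2] block_graph_iso_iff[OF wf block_graph_join3]
    by (elim disjE exE) (rule exI, rule exI, rule exI, rule conjI, assumption, simp)+
  thus ?thesis using star_blocks_good diam by blast
qed

lemma path_products_good:
  assumes diam: "diam G \<le> 3"
    and pos: "a \<ge> 1" "b \<ge> 1" "c \<ge> 1" "e \<ge> 1"
    and iso: "G \<cong>\<^sub>G P4_product (monochrome t0 a) (monochrome t1 b) (monochrome t2 c) (monochrome t3 e)"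
    and ok: "path_sizes_ok (if t0 then 1 else a) (if t1 then 1 else b) (if t2 then 1 else c) (if t3 then 1 else e)"
    and two: "\<not> t0 \<or> \<not> t2 \<or> t0 \<and> t1 \<and> t2 \<and> t3 \<and> clique_poly a b c e \<le> 0"
  shows "lam3_cond V d \<and> lam_penult_cond V d"
proof -
  obtain f where blk: "block_graph 4 path_adj (\<lambda>i. [t0, t1, t2, t3] ! i) (\<lambda>i. [a, b, c, e] ! i) G f"
    using iso unfolding block_graph_iso_iff[OF wf block_graph_P4_product] by blast
  have lt4: "i = 0 \<or> i = 1 \<or> i = 2 \<or> i = 3" if "i < 4" for i :: nat using that by linarith
  have p: "[a, b, c, e] ! i \<ge> 1" if "i < 4" for i
    using lt4[OF that] pos by (elim disjE) simp_all
  have all: "\<forall>i<4. [t0, t1, t2, t3] ! i" if t: "t0" "t1" "t2" "t3"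
  proof (intro allI impI)
    fix i :: nat assume "i < 4"
    from lt4[OF this] t show "[t0, t1, t2, t3] ! i" by (elim disjE) simp_all
  qed
  have L: "[a, b, c, e] ! 0 = a" "[a, b, c, e] ! 1 = b" "[a, b, c, e] ! 2 = c" "[a, b, c, e] ! 3 = e"
    "[t0, t1, t2, t3] ! 0 = t0" "[t0, t1, t2, t3] ! 1 = t1" "[t0, t1, t2, t3] ! 2 = t2" "[t0, t1, t2, t3] ! 3 = t3"
    by simp_all
  have t: "\<not> t0 \<or> \<not> t2 \<or> (\<forall>i<4. [t0, t1, t2, t3] ! i) \<and> clique_poly a b c e \<le> 0"
    using two all by blast
  show ?thesis
    using path_blocks_good[OF blk p diam, unfolded L] ok t by blast
qed

section \<open>Both directions of the classification\<close>

lemma block_classification: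
  assumes n: "n = card V" "n \<ge> 3"
  shows "lam3_cond V d \<and> lam_penult_cond V d \<longleftrightarrow>
    (diam G \<le> 2 \<and>
      (n \<ge> 4 \<and> G \<cong>\<^sub>G complete_graph n
     \<or> (\<exists>a b. a \<ge> 2 \<and> b \<ge> 1 \<and>
          G \<cong>\<^sub>G graph_join (complete_graph a) (edgeless_graph b))
     \<or> (\<exists>a b c. a \<ge> 2 \<and> b \<ge> 2 \<and> c \<ge> 2 \<and>
          G \<cong>\<^sub>G graph_join (complete_graph a) (graph_union (complete_graph b) (complete_graph c)))
     \<or> (\<exists>a b c. a \<ge> 2 \<and> b \<ge> 2 \<and> c \<ge> 1 \<and>
          G \<cong>\<^sub>G graph_join (complete_graph a) (graph_union (complete_graph b) (edgeless_graph c)))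
     \<or> (\<exists>a b. a \<ge> 1 \<and> b \<ge> 1 \<and>
          G \<cong>\<^sub>G graph_join (edgeless_graph a) (edgeless_graph b))
     \<or> (\<exists>a b c. a \<ge> 1 \<and> b \<ge> 2 \<and> c \<ge> 2 \<and>
          G \<cong>\<^sub>G graph_join (edgeless_graph a) (graph_union (complete_graph b) (complete_graph c)))
     \<or> (\<exists>a b c. a \<ge> 1 \<and> c \<ge> 1 \<and> b \<ge> 2 \<and>
          G \<cong>\<^sub>G graph_join (edgeless_graph a) (graph_union (complete_graph b) (edgeless_graph c)))))
    \<or>
    (diam G = 3 \<and>
      (\<exists>a b c d :: nat. a \<ge> 1 \<and> b \<ge> 1 \<and> c \<ge> 1 \<and> d \<ge> 1 \<and>
       (G \<cong>\<^sub>G P4_product (edgeless_graph a) (complete_graph b) (edgeless_graph c) (edgeless_graph d) \<and>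
          (a = 1 \<and> c = 1 \<or> a = 1 \<and> c = 2 \<and> d \<le> 2 \<or> a = 1 \<and> c \<ge> 3 \<and> d = 1 \<or>
           a = 2 \<and> c = 1 \<and> d \<le> 2 \<or> a \<ge> 3 \<and> c = 1 \<and> d = 1)
      \<or> G \<cong>\<^sub>G P4_product (edgeless_graph a) (complete_graph b) (complete_graph c) (edgeless_graph d) \<and>
          (a = 1 \<or> a = 2 \<and> d \<le> 2 \<or> a \<ge> 3 \<and> d = 1)
      \<or> G \<cong>\<^sub>G P4_product (edgeless_graph a) (complete_graph b) (edgeless_graph c) (complete_graph d) \<and>
          (a = 1 \<or> a \<ge> 2 \<and> c = 1)
      \<or> G \<cong>\<^sub>G P4_product (edgeless_graph a) (edgeless_graph b) (complete_graph c) (complete_graph d) \<and>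
          (a = 1 \<or> a = 2 \<and> b \<le> 2 \<or> a \<ge> 3 \<and> b = 1)
      \<or> G \<cong>\<^sub>G P4_product (edgeless_graph a) (complete_graph b) (complete_graph c) (complete_graph d)
      \<or> G \<cong>\<^sub>G P4_product (complete_graph a) (complete_graph b) (edgeless_graph c) (complete_graph d)
      \<or> G \<cong>\<^sub>G P4_product (complete_graph a) (complete_graph b) (complete_graph c) (complete_graph d) \<and>
          int a + int b + int c + int d - 3 * int a * int c - 8 * int a * int d - 3 * int b * int d
          - int a * int b * int c - int a * int b * int d - int a * int c * int d
          - int b * int c * int d + int a * int b * int c * int d + 1 \<le> 0)))"
    (is "?good \<longleftrightarrow> diam G \<le> 2 \<and> ?star \<or> diam G = 3 \<and> ?path")
proof
  assume good: ?good
  hence g: "lam3_cond V d" "lam_penult_cond V d" by simp_all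
  interpret good_dist_space V d by unfold_locales (rule g)+
  show "diam G \<le> 2 \<and> ?star \<or> diam G = 3 \<and> ?path"
  proof (cases "diam G \<le> 2")
    case True
    thus ?thesis using diameter_2_classification[OF g True n] by blast
  next
    case False
    have "diam G \<le> 3" unfolding diam_le using diameter_le_3 by blast
    with False have d3: "diam G = 3" by simp
    obtain u v where uv: "u \<in> V" "v \<in> V" "\<not> d u v \<le> 2" using False unfolding diam_le by blast
    hence "d u v = 3" using diameter_le_3[OF uv(1,2)] by linarith
    from diameter_3_classification[OF g uv(1,2) this]
    obtain a b c e where p: "a \<ge> 1" "b \<ge> 1" "c \<ge> 1" "e \<ge> 1" and cases:
      "G \<cong>\<^sub>G P4_product (complete_graph a) (complete_graph b) (complete_graph c) (complete_graph e) \<and>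
        clique_poly a b c e \<le> 0 \<or>
      G \<cong>\<^sub>G P4_product (edgeless_graph a) (complete_graph b) (complete_graph c) (complete_graph e) \<or>
      G \<cong>\<^sub>G P4_product (complete_graph a) (complete_graph b) (edgeless_graph c) (complete_graph e) \<or>
      G \<cong>\<^sub>G P4_product (edgeless_graph a) (complete_graph b) (complete_graph c) (edgeless_graph e) \<and> a = 2 \<and> e \<le> 2 \<or>
      G \<cong>\<^sub>G P4_product (edgeless_graph a) (edgeless_graph b) (complete_graph c) (complete_graph e) \<and> a = 2 \<and> b \<le> 2" .
    show ?thesis
    proof (rule disjI2, rule conjI[OF d3], rule exI[of _ a], rule exI[of _ b], rule exI[of _ c],
        rule exI[of _ e], rule conjI[OF p(1)], rule conjI[OF p(2)], rule conjI[OF p(3)], rule conjI[OF p(4)])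
      from cases show "G \<cong>\<^sub>G P4_product (edgeless_graph a) (complete_graph b) (edgeless_graph c) (edgeless_graph e) \<and>
          (a = 1 \<and> c = 1 \<or> a = 1 \<and> c = 2 \<and> e \<le> 2 \<or> a = 1 \<and> c \<ge> 3 \<and> e = 1 \<or>
           a = 2 \<and> c = 1 \<and> e \<le> 2 \<or> a \<ge> 3 \<and> c = 1 \<and> e = 1)
      \<or> G \<cong>\<^sub>G P4_product (edgeless_graph a) (complete_graph b) (complete_graph c) (edgeless_graph e) \<and>
          (a = 1 \<or> a = 2 \<and> e \<le> 2 \<or> a \<ge> 3 \<and> e = 1)
      \<or> G \<cong>\<^sub>G P4_product (edgeless_graph a) (complete_graph b) (edgeless_graph c) (complete_graph e) \<and>
          (a = 1 \<or> a \<ge> 2 \<and> c = 1)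
      \<or> G \<cong>\<^sub>G P4_product (edgeless_graph a) (edgeless_graph b) (complete_graph c) (complete_graph e) \<and>
          (a = 1 \<or> a = 2 \<and> b \<le> 2 \<or> a \<ge> 3 \<and> b = 1)
      \<or> G \<cong>\<^sub>G P4_product (edgeless_graph a) (complete_graph b) (complete_graph c) (complete_graph e)
      \<or> G \<cong>\<^sub>G P4_product (complete_graph a) (complete_graph b) (edgeless_graph c) (complete_graph e)
      \<or> G \<cong>\<^sub>G P4_product (complete_graph a) (complete_graph b) (complete_graph c) (complete_graph e) \<and>
          int a + int b + int c + int e - 3 * int a * int c - 8 * int a * int e - 3 * int b * int e
          - int a * int b * int c - int a * int b * int e - int a * int c * int e
          - int b * int c * int e + int a * int b * int c * int e + 1 \<le> 0"
        unfolding clique_poly_def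
        by argo
    qed
  qed
next
  assume "diam G \<le> 2 \<and> ?star \<or> diam G = 3 \<and> ?path"
  thus ?good
  proof
    assume star: "diam G \<le> 2 \<and> ?star"
    note good = star_products_good[OF conjunct1[OF star]]
    note S1 = good[OF disjI1] and S2 = good[OF disjI2, OF disjI1] and S3 = good[OF disjI2, OF disjI2]
    note S = S1 S2[where ?t0.0 = True and ?t2.0 = False, unfolded monochrome_simps]
      S2[where ?t0.0 = False and ?t2.0 = False, unfolded monochrome_simps]
      S3[where ?t0.0 = True and ?t2.0 = True, unfolded monochrome_simps]
      S3[where ?t0.0 = True and ?t2.0 = False, unfolded monochrome_simps]
      S3[where ?t0.0 = False and ?t2.0 = True, unfolded monochrome_simps]
      S3[where ?t0.0 = False and ?t2.0 = False, unfolded monochrome_simps]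
    from star show ?good by (elim conjE disjE exE) (erule S)+
  next
    assume path: "diam G = 3 \<and> ?path"
    hence diam: "diam G \<le> 3" by simp
    from conjunct2[OF path] obtain a b c e :: nat where pos: "a \<ge> 1" "b \<ge> 1" "c \<ge> 1" "e \<ge> 1" and cases:
      "G \<cong>\<^sub>G P4_product (edgeless_graph a) (complete_graph b) (edgeless_graph c) (edgeless_graph e) \<and>
          (a = 1 \<and> c = 1 \<or> a = 1 \<and> c = 2 \<and> e \<le> 2 \<or> a = 1 \<and> c \<ge> 3 \<and> e = 1 \<or>
           a = 2 \<and> c = 1 \<and> e \<le> 2 \<or> a \<ge> 3 \<and> c = 1 \<and> e = 1)
      \<or> G \<cong>\<^sub>G P4_product (edgeless_graph a) (complete_graph b) (complete_graph c) (edgeless_graph e) \<and>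
          (a = 1 \<or> a = 2 \<and> e \<le> 2 \<or> a \<ge> 3 \<and> e = 1)
      \<or> G \<cong>\<^sub>G P4_product (edgeless_graph a) (complete_graph b) (edgeless_graph c) (complete_graph e) \<and>
          (a = 1 \<or> a \<ge> 2 \<and> c = 1)
      \<or> G \<cong>\<^sub>G P4_product (edgeless_graph a) (edgeless_graph b) (complete_graph c) (complete_graph e) \<and>
          (a = 1 \<or> a = 2 \<and> b \<le> 2 \<or> a \<ge> 3 \<and> b = 1)
      \<or> G \<cong>\<^sub>G P4_product (edgeless_graph a) (complete_graph b) (complete_graph c) (complete_graph e)
      \<or> G \<cong>\<^sub>G P4_product (complete_graph a) (complete_graph b) (edgeless_graph c) (complete_graph e)
      \<or> G \<cong>\<^sub>G P4_product (complete_graph a) (complete_graph b) (complete_graph c) (complete_graph e) \<and>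
          int a + int b + int c + int e - 3 * int a * int c - 8 * int a * int e - 3 * int b * int e
          - int a * int b * int c - int a * int b * int e - int a * int c * int e
          - int b * int c * int e + int a * int b * int c * int e + 1 \<le> 0"
      by (elim exE conjE) (rule that)
    note good = path_products_good[OF diam pos]
    from cases show ?good
    proof (elim disjE)
      assume h: "G \<cong>\<^sub>G P4_product (edgeless_graph a) (complete_graph b) (edgeless_graph c) (edgeless_graph e) \<and>
          (a = 1 \<and> c = 1 \<or> a = 1 \<and> c = 2 \<and> e \<le> 2 \<or> a = 1 \<and> c \<ge> 3 \<and> e = 1 \<or>
           a = 2 \<and> c = 1 \<and> e \<le> 2 \<or> a \<ge> 3 \<and> c = 1 \<and> e = 1)"
      \<comment> \<open>A clique enters as size 1, so the size condition of each family becomes a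
        condition on its edgeless blocks.\<close>
      have "path_sizes_ok a 1 c e" using h unfolding path_sizes_ok_def by auto
      from good[of False True False False, unfolded monochrome_simps if_True if_False simp_thms, OF _ this] h
      show ?good by blast
    next
      assume h: "G \<cong>\<^sub>G P4_product (edgeless_graph a) (complete_graph b) (complete_graph c) (edgeless_graph e) \<and>
          (a = 1 \<or> a = 2 \<and> e \<le> 2 \<or> a \<ge> 3 \<and> e = 1)"
      have "path_sizes_ok a 1 1 e" using h unfolding path_sizes_ok_def by auto
      from good[of False True True False, unfolded monochrome_simps if_True if_False simp_thms, OF _ this] h
      show ?good by blast
    next
      assume h: "G \<cong>\<^sub>G P4_product (edgeless_graph a) (complete_graph b) (edgeless_graph c) (complete_graph e) \<and>
          (a = 1 \<or> a \<ge> 2 \<and> c = 1)"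
      have "path_sizes_ok a 1 c 1" using h unfolding path_sizes_ok_def by auto
      from good[of False True False True, unfolded monochrome_simps if_True if_False simp_thms, OF _ this] h
      show ?good by blast
    next
      assume h: "G \<cong>\<^sub>G P4_product (edgeless_graph a) (edgeless_graph b) (complete_graph c) (complete_graph e) \<and>
          (a = 1 \<or> a = 2 \<and> b \<le> 2 \<or> a \<ge> 3 \<and> b = 1)"
      have "path_sizes_ok a b 1 1" using h unfolding path_sizes_ok_def by auto
      from good[of False False True True, unfolded monochrome_simps if_True if_False simp_thms, OF _ this] h
      show ?good by blast
    next
      assume h: "G \<cong>\<^sub>G P4_product (edgeless_graph a) (complete_graph b) (complete_graph c) (complete_graph e)"
      have "path_sizes_ok a 1 1 1" unfolding path_sizes_ok_def by auto
      from good[of False True True True, unfolded monochrome_simps if_True if_False simp_thms, OF _ this] h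
      show ?good by blast
    next
      assume h: "G \<cong>\<^sub>G P4_product (complete_graph a) (complete_graph b) (edgeless_graph c) (complete_graph e)"
      have "path_sizes_ok 1 1 c 1" unfolding path_sizes_ok_def by auto
      from good[of True True False True, unfolded monochrome_simps if_True if_False simp_thms, OF _ this] h
      show ?good by blast
    next
      assume h: "G \<cong>\<^sub>G P4_product (complete_graph a) (complete_graph b) (complete_graph c) (complete_graph e) \<and>
          int a + int b + int c + int e - 3 * int a * int c - 8 * int a * int e - 3 * int b * int e
          - int a * int b * int c - int a * int b * int e - int a * int c * int e
          - int b * int c * int e + int a * int b * int c * int e + 1 \<le> 0"
      have "path_sizes_ok 1 1 1 1" unfolding path_sizes_ok_def by auto
      from good[of True True True True, unfolded monochrome_simps if_True if_False simp_thms, OF _ this] h[folded clique_poly_def]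
      show ?good by blast
    qed
  qed
qed

end

theorem theorem3p1:
  fixes G :: "'a pair_pre_digraph" and vs :: "'a list" and n :: nat
  assumes "pair_graph G"
    and "Digraph_Component.connected (with_proj G)"
    and "distinct vs" and "set vs = pverts G"
    and "n = card (pverts G)" and "n \<ge> 3"
  shows "dist_eigenvalue G vs 3 \<le> - 1 \<and> dist_eigenvalue G vs (n - 1) \<ge> - 2 \<longleftrightarrow>
    (diam G \<le> 2 \<and>
      (n \<ge> 4 \<and> G \<cong>\<^sub>G complete_graph n
     \<or> (\<exists>a b. a \<ge> 2 \<and> b \<ge> 1 \<and>
          G \<cong>\<^sub>G graph_join (complete_graph a) (edgeless_graph b))
     \<or> (\<exists>a b c. a \<ge> 2 \<and> b \<ge> 2 \<and> c \<ge> 2 \<and>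
          G \<cong>\<^sub>G graph_join (complete_graph a) (graph_union (complete_graph b) (complete_graph c)))
     \<or> (\<exists>a b c. a \<ge> 2 \<and> b \<ge> 2 \<and> c \<ge> 1 \<and>
          G \<cong>\<^sub>G graph_join (complete_graph a) (graph_union (complete_graph b) (edgeless_graph c)))
     \<or> (\<exists>a b. a \<ge> 1 \<and> b \<ge> 1 \<and>
          G \<cong>\<^sub>G graph_join (edgeless_graph a) (edgeless_graph b))
     \<or> (\<exists>a b c. a \<ge> 1 \<and> b \<ge> 2 \<and> c \<ge> 2 \<and>
          G \<cong>\<^sub>G graph_join (edgeless_graph a) (graph_union (complete_graph b) (complete_graph c)))
     \<or> (\<exists>a b c. a \<ge> 1 \<and> c \<ge> 1 \<and> b \<ge> 2 \<and>
          G \<cong>\<^sub>G graph_join (edgeless_graph a) (graph_union (complete_graph b) (edgeless_graph c)))))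
    \<or>
    (diam G = 3 \<and>
      (\<exists>a b c d :: nat. a \<ge> 1 \<and> b \<ge> 1 \<and> c \<ge> 1 \<and> d \<ge> 1 \<and>
       (G \<cong>\<^sub>G P4_product (edgeless_graph a) (complete_graph b) (edgeless_graph c) (edgeless_graph d) \<and>
          (a = 1 \<and> c = 1 \<or> a = 1 \<and> c = 2 \<and> d \<le> 2 \<or> a = 1 \<and> c \<ge> 3 \<and> d = 1 \<or>
           a = 2 \<and> c = 1 \<and> d \<le> 2 \<or> a \<ge> 3 \<and> c = 1 \<and> d = 1)
      \<or> G \<cong>\<^sub>G P4_product (edgeless_graph a) (complete_graph b) (complete_graph c) (edgeless_graph d) \<and>
          (a = 1 \<or> a = 2 \<and> d \<le> 2 \<or> a \<ge> 3 \<and> d = 1)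
      \<or> G \<cong>\<^sub>G P4_product (edgeless_graph a) (complete_graph b) (edgeless_graph c) (complete_graph d) \<and>
          (a = 1 \<or> a \<ge> 2 \<and> c = 1)
      \<or> G \<cong>\<^sub>G P4_product (edgeless_graph a) (edgeless_graph b) (complete_graph c) (complete_graph d) \<and>
          (a = 1 \<or> a = 2 \<and> b \<le> 2 \<or> a \<ge> 3 \<and> b = 1)
      \<or> G \<cong>\<^sub>G P4_product (edgeless_graph a) (complete_graph b) (complete_graph c) (complete_graph d)
      \<or> G \<cong>\<^sub>G P4_product (complete_graph a) (complete_graph b) (edgeless_graph c) (complete_graph d)
      \<or> G \<cong>\<^sub>G P4_product (complete_graph a) (complete_graph b) (complete_graph c) (complete_graph d) \<and>
          int a + int b + int c + int d - 3 * int a * int c - 8 * int a * int d - 3 * int b * int d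
          - int a * int b * int c - int a * int b * int d - int a * int c * int d
          - int b * int c * int d + int a * int b * int c * int d + 1 \<le> 0)))"
proof -
  interpret pair_graph G by fact
  have ne: "pverts G \<noteq> {}"
  proof
    assume "pverts G = {}"
    with assms(5,6) show False by simp
  qed
  interpret connected_graph G by unfold_locales (rule assms(2), rule ne)
  have len: "length vs = n" using distinct_card[OF assms(3)] by (simp only: assms(4,5))
  have "dist_eigenvalue G vs 3 \<le> - 1 \<longleftrightarrow> lam3_cond V d"
    "dist_eigenvalue G vs (n - 1) \<ge> - 2 \<longleftrightarrow> lam_penult_cond V d"
    by (rule dist_eigenvalue_conds[OF assms(3) len assms(6), unfolded assms(4)], erule (1) D.dist_sym)+
  note conds = this
  show ?thesis unfolding conds by (rule block_classification[OF assms(5,6)])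
qed

end
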